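(* Let $\mathcal T$ be a regular rooted tree with generation levels $t_0,\dots,t_{N_{\mathcal T}}$ and branching numbers $b_0,\dots,b_{N_{\mathcal T}}$, and use the measures $\mu,\nu$, the subspaces $\mathcal F_{\mathcal T},\mathcal F_{\mathsf v}^{\langle j\rangle}$ and the components $f_{\mathsf o},f_{\mathsf v}^{\langle j\rangle}$ defined in the context. Then one has the orthogonal decomposition $$L^2_\mu(\mathcal T)=\mathcal F_{\mathcal T}\oplus\bigoplus_{k=0}^{N_{\mathcal T}}\ \bigoplus_{\mathsf v\in\mathsf V_k}\ \bigoplus_{j=1}^{b_k-1}\mathcal F_{\mathsf v}^{\langle j\rangle}$$ (direct sums over empty index sets are omitted), and the identity $$\int_{\mathcal T}|f(x)|^2\,\mu(\mathrm dx)=\int_0^\infty|f_{\mathsf o}(t)|^2\,\nu(\mathrm dt)+\sum_{k=0}^{N_{\mathcal T}}\sum_{\mathsf v\in\mathsf V_k}\sum_{j=1}^{b_k-1}\int_{t_k}^\infty|f_{\mathsf v}^{\langle j\rangle}(t)|^2\,\nu(\mathrm dt)$$ holds for every $f\in L^2_\mu(\mathcal T)$. Additionally, if $f\in H^1_{0,\mu}(\mathcal T)$, then $f_{\mathsf o}\in H^1_{0,\nu}([0,\infty))$ and $f_{\mathsf v}^{\langle j\rangle}\in H^1_{0,\nu}([t_k,\infty))$ for all $k\in\{0,\dots,N_{\mathcal T}\}$, $\mathsf v\in\mathsf V_k$, $j\in\{1,\dots,b_k-1\}$, and $$\int_{\mathcal T}|f'(x)|^2\,\mu(\mathrm dx)=\int_0^\infty\Big|\frac{\mathrm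 df_{\mathsf o}(t)}{\mathrm dt}\Big|^2\nu(\mathrm dt)+\sum_{k=0}^{N_{\mathcal T}}\sum_{\mathsf v\in\mathsf V_k}\sum_{j=1}^{b_k-1}\int_{t_k}^\infty\Big|\frac{\mathrm df_{\mathsf v}^{\langle j\rangle}(t)}{\mathrm dt}\Big|^2\nu(\mathrm dt).$$
   Context: Regular rooted tree. Let $\widetilde{\mathcal T}$ be a compact rooted metric tree (finite tree, edges of finite positive length) with vertex set $\mathsf V$, root $\mathsf o$, and nonempty set $\mathsf L\subset\mathsf V\setminus\{\mathsf o\}$ of leaves (degree-one vertices other than the root); $\mathcal T$ is obtained by attaching to each vertex of $\mathsf L$ a finite non-zero number of half-lines. $|x|$ is the path distance of $x\in\mathcal T$ to $\mathsf o$; edges are oriented and parametrised by arc length away from the root, with $f'$ the weak derivative in this coordinate. $\mathcal T$ is regular if there are $N_{\mathcal T}\in\mathbb N$, levels $0=t_0<t_1<\dots<t_{N_{\mathcal T}}$ and positive integers $b_0,\dots,b_{N_{\mathcal T}}$ such that: $\mathsf V=\bigsqcup_{k=0}^{N_{\mathcal T}}\mathsf V_k$ with $\mathsf V_k=\{\mathsf v\in\mathsf V:|\mathsf v|=t_k\}$; every $\mathsf v\in\mathsf V_k$ has exactly $b_k$ outgoing edges (edges emanating away from the root); and $\mathsf V_{N_{\mathcal T}}=\mathsf L$ (so each such vertex carries $b_{N_{\mathcal T}}$ half-lines). Write $x\preceq y$ if $x$ lies on the path from $\mathsf o$ to $y$. For an edge $\mathsf e$ from $\mathsf v$ to $\mathsf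 w$ ($\mathsf v\preceq\mathsf w$), $\mathcal T_{\mathsf e}=\mathsf e\cup\{x\in\mathcal T:\mathsf w\preceq x\}$; for a half-line $\mathsf e$, $\mathcal T_{\mathsf e}=\mathsf e$. For a subtree $\mathcal S\subset\mathcal T$, $g_{\mathcal S}(t)=\#\{x\in\mathcal S:|x|=t\}$. Measures and spaces. $G(t)=\frac2{\sqrt\pi}e^{-t^2}$, $\mu(\mathrm dx)=G(|x|)\,\mathrm dx$ on $\mathcal T$, and $\nu(\mathrm dt)=g_{\mathcal T}(t)G(t)\,\mathrm dt$ on $[0,\infty)$. Functions are complex valued. $H^1_{0,\mu}(\mathcal T)$: continuous functions on $\mathcal T$ which are in $H^1_\mu(\mathsf e)$ on each edge $\mathsf e$ and vanish at $\mathsf o$. $H^1_{0,\nu}([c,\infty))$: functions in $H^1_\nu([c,\infty))$ (function and weak derivative in $L^2_\nu$) vanishing at $c$. Subspaces. $\mathcal F_{\mathcal S}$ is the space of $f\in L^2_\mu(\mathcal T)$ vanishing outside $\mathcal S$ and with $f(x)=f(y)$ whenever $x,y\in\mathcal S$, $|x|=|y|$. $P_{\mathcal S}$ is the orthogonal projection onto $\mathcal F_{\mathcal S}$: $(P_{\mathcal S}f)(x)=g_{\mathcal S}(|x|)^{-1}\sum_{y\in\mathcal S,|y|=|x|}f(y)$ for $x\in\mathcal S$, and $0$ otherwise. For $\mathsf v\in\mathsf V_k$ and an edge $\mathsf e$ emanating from $\mathsf v$, $J_{\mathsf e}:\mathcal F_{\mathcal T_{\mathsf e}}\to L^2_\nu([t_k,\infty))$,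 $J_{\mathsf e}f(t)=(b_0\cdots b_k)^{-1/2}f(x)$ with $x\in\mathcal T_{\mathsf e}$, $|x|=t$, is an isometric isomorphism. Let $\mathsf e_{\mathsf v}^1,\dots,\mathsf e_{\mathsf v}^{b_k}$ be the edges emanating from $\mathsf v\in\mathsf V_k$, and $J_{\mathsf v}:\bigoplus_{r=1}^{b_k}\mathcal F_{\mathcal T_{\mathsf e_{\mathsf v}^r}}\to(L^2_\nu([t_k,\infty)))^{b_k}$, $(f_1,\dots,f_{b_k})\mapsto(J_{\mathsf e_{\mathsf v}^1}f_1,\dots,J_{\mathsf e_{\mathsf v}^{b_k}}f_{b_k})$. With $\omega_k=e^{2\pi i/b_k}$ and $\mathbf h_k^{\langle j\rangle}=b_k^{-1/2}(\omega_k^j,\omega_k^{2j},\dots,\omega_k^{(b_k-1)j},1)$ for $j=1,\dots,b_k$, set $\mathcal F_{\mathsf v}^{\langle j\rangle}=J_{\mathsf v}^{-1}\{\mathbf h_k^{\langle j\rangle}\varphi:\varphi\in L^2_\nu([t_k,\infty))\}$. Let $J_{\mathsf o}:\mathcal F_{\mathcal T}\to L^2_\nu([0,\infty))$, $J_{\mathsf o}f(t)=f(x)$, $|x|=t$. Components. For $f\in L^2_\mu(\mathcal T)$: $f_{\mathsf o}=J_{\mathsf o}P_{\mathcal T}f\in L^2_\nu([0,\infty))$ and, for $\mathsf v\in\mathsf V_k$, $f_{\mathsf v}^{\langle j\rangle}=b_k^{-1/2}\sum_{r=1}^{b_k}\omega_k^{-rj}J_{\mathsf e_{\mathsf v}^r}P_{\mathcal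 T_{\mathsf e_{\mathsf v}^r}}f\in L^2_\nu([t_k,\infty))$.
   Formalization: Regularity additionally requires every finite edge to join a vertex of generation k to one of generation k+1; if edges may skip a level with branching number above 1, the maps J_e need not be isometric and the orthogonality can fail. *)

theory Defs
  imports "HOL-Analysis.Analysis" "Graph_Theory.Digraph" "Graph_Theory.Arc_Walk"
begin

section \<open>Rooted metric trees with half-lines attached to the leaves\<close>

text \<open>
  The field \<open>skel\<close> is the finite directed graph underlying the compact tree, with every
  arc oriented away from the root \<open>origin\<close>; \<open>edge_len\<close> gives the edge lengths.
  The half-lines are named by \<open>rays\<close>, further elements of the arc type; the vertex to which
  a half-line is attached is its \<open>tail\<close> (its \<open>head\<close> is irrelevant).
\<close>

record ('a, 'b) metric_tree =
  skel :: "('a, 'b) pre_digraph"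
  origin :: 'a
  edge_len :: "'b \<Rightarrow> real"
  rays :: "'b set"

definition edges :: "('a, 'b) metric_tree \<Rightarrow> 'b set" where
  "edges T = arcs (skel T) \<union> rays T"

definition out_edges :: "('a, 'b) metric_tree \<Rightarrow> 'a \<Rightarrow> 'b set" where
  "out_edges T v = {e \<in> edges T. tail (skel T) e = v}"

definition leaves :: "('a, 'b) metric_tree \<Rightarrow> 'a set" where
  "leaves T = {v \<in> verts (skel T). v \<noteq> origin T \<and>
     in_degree (skel T) v + out_degree (skel T) v = 1}"

text \<open>
  A finite directed graph is a tree oriented away from the root iff every vertex is reached
  from the root by exactly one directed walk.
\<close>

definition rooted_metric_tree :: "('a, 'b) metric_tree \<Rightarrow> bool" where
  "rooted_metric_tree T \<longleftrightarrow>
     fin_digraph (skel T) \<and> origin T \<in> verts (skel T) \<and>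
     (\<forall>v\<in>verts (skel T). \<exists>!p. pre_digraph.awalk (skel T) (origin T) p v) \<and>
     (\<forall>e\<in>arcs (skel T). 0 < edge_len T e) \<and>
     leaves T \<noteq> {} \<and>
     rays T \<inter> arcs (skel T) = {} \<and>
     (\<forall>e\<in>rays T. tail (skel T) e \<in> leaves T) \<and>
     (\<forall>v\<in>leaves T. finite {e \<in> rays T. tail (skel T) e = v} \<and>
                    {e \<in> rays T. tail (skel T) e = v} \<noteq> {})"


subsection \<open>Points\<close>

text \<open>
  A point of the tree is a vertex or an interior point \<open>Inner e s\<close> of an edge, where
  \<open>s\<close> is the arc length from the tail of \<open>e\<close>.
\<close>

datatype ('a, 'b) point = Vertex 'a | Inner 'b real

definition open_ivl :: "('a, 'b) metric_tree \<Rightarrow> 'b \<Rightarrow> real set" where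
  "open_ivl T e = (if e \<in> rays T then {0<..} else {0<..<edge_len T e})"

definition closed_ivl :: "('a, 'b) metric_tree \<Rightarrow> 'b \<Rightarrow> real set" where
  "closed_ivl T e = (if e \<in> rays T then {0..} else {0..edge_len T e})"

definition edge_point :: "('a, 'b) metric_tree \<Rightarrow> 'b \<Rightarrow> real \<Rightarrow> ('a, 'b) point" where
  "edge_point T e s =
     (if s = 0 then Vertex (tail (skel T) e)
      else if e \<notin> rays T \<and> s = edge_len T e then Vertex (head (skel T) e)
      else Inner e s)"

definition edge_points :: "('a, 'b) metric_tree \<Rightarrow> 'b \<Rightarrow> ('a, 'b) point set" where
  "edge_points T e = edge_point T e ` closed_ivl T e"

definition points :: "('a, 'b) metric_tree \<Rightarrow> ('a, 'b) point set" where
  "points T = Vertex ` verts (skel T) \<union> (\<Union>e\<in>edges T. edge_points T e)"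

definition root_walk :: "('a, 'b) metric_tree \<Rightarrow> 'a \<Rightarrow> 'b list" where
  "root_walk T v = (THE p. pre_digraph.awalk (skel T) (origin T) p v)"

definition vertex_dist :: "('a, 'b) metric_tree \<Rightarrow> 'a \<Rightarrow> real" where
  "vertex_dist T v = sum_list (map (edge_len T) (root_walk T v))"

primrec root_dist :: "('a, 'b) metric_tree \<Rightarrow> ('a, 'b) point \<Rightarrow> real" where
  "root_dist T (Vertex v) = vertex_dist T v"
| "root_dist T (Inner e s) = vertex_dist T (tail (skel T) e) + s"

definition vertex_path :: "('a, 'b) metric_tree \<Rightarrow> 'a \<Rightarrow> ('a, 'b) point set" where
  "vertex_path T v = {Vertex (origin T)} \<union> (\<Union>e\<in>set (root_walk T v). edge_points T e)"

primrec root_path :: "('a, 'b) metric_tree \<Rightarrow> ('a, 'b) point \<Rightarrow> ('a, 'b) point set" where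
  "root_path T (Vertex v) = vertex_path T v"
| "root_path T (Inner e s) =
     vertex_path T (tail (skel T) e) \<union> edge_point T e ` {0..s}"

definition precedes :: "('a, 'b) metric_tree \<Rightarrow> ('a, 'b) point \<Rightarrow> ('a, 'b) point \<Rightarrow> bool" where
  "precedes T x y \<longleftrightarrow> x \<in> root_path T y"

definition subtree :: "('a, 'b) metric_tree \<Rightarrow> 'b \<Rightarrow> ('a, 'b) point set" where
  "subtree T e = (if e \<in> rays T then edge_points T e
     else edge_points T e \<union> {x \<in> points T. precedes T (Vertex (head (skel T) e)) x})"

definition sphere_of :: "('a, 'b) metric_tree \<Rightarrow> ('a, 'b) point set \<Rightarrow> real \<Rightarrow> ('a, 'b) point set" where
  "sphere_of T S s = {x \<in> S. root_dist T x = s}"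

definition branching_fn :: "('a, 'b) metric_tree \<Rightarrow> ('a, 'b) point set \<Rightarrow> real \<Rightarrow> nat" where
  "branching_fn T S s = card (sphere_of T S s)"


subsection \<open>Regularity\<close>

definition generation :: "('a, 'b) metric_tree \<Rightarrow> (nat \<Rightarrow> real) \<Rightarrow> nat \<Rightarrow> 'a set" where
  "generation T t k = {v \<in> verts (skel T). root_dist T (Vertex v) = t k}"

text \<open>
  The vertices at distance \<open>t k\<close> form the \<open>k\<close>-th generation: edges lead from one
  generation to the next. Were edges allowed to skip a level, subtrees emanating from the same
  vertex could have different branching, and the maps \<open>J_edge\<close> below would not be isometric.
\<close>

definition regular_tree ::
    "('a, 'b) metric_tree \<Rightarrow> nat \<Rightarrow> (nat \<Rightarrow> real) \<Rightarrow> (nat \<Rightarrow> nat) \<Rightarrow> bool" where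
  "regular_tree T N t b \<longleftrightarrow>
     rooted_metric_tree T \<and>
     t 0 = 0 \<and> (\<forall>k<N. t k < t (Suc k)) \<and> (\<forall>k\<le>N. 0 < b k) \<and>
     verts (skel T) = (\<Union>k\<le>N. generation T t k) \<and>
     (\<forall>e\<in>arcs (skel T). \<forall>k\<le>N. tail (skel T) e \<in> generation T t k \<longrightarrow>
        head (skel T) e \<in> generation T t (Suc k)) \<and>
     (\<forall>k\<le>N. \<forall>v\<in>generation T t k. card (out_edges T v) = b k) \<and>
     generation T t N = leaves T"


subsection \<open>Topology and measures\<close>

text \<open>
  The topology is that of the closed edges glued at the vertices; as there are finitely many
  edges, it is the topology of the path metric.
\<close>

definition tree_topology :: "('a, 'b) metric_tree \<Rightarrow> ('a, 'b) point topology" where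
  "tree_topology T = topology (\<lambda>U. U \<subseteq> points T \<and>
     (\<forall>e\<in>edges T. openin (top_of_set (closed_ivl T e)) {s \<in> closed_ivl T e. edge_point T e s \<in> U}))"

lemma openin_tree_topology:
  "openin (tree_topology T) U \<longleftrightarrow> U \<subseteq> points T \<and>
     (\<forall>e\<in>edges T. openin (top_of_set (closed_ivl T e)) {s \<in> closed_ivl T e. edge_point T e s \<in> U})"
proof -
  have "istopology (\<lambda>U. U \<subseteq> points T \<and>
     (\<forall>e\<in>edges T. openin (top_of_set (closed_ivl T e)) {s \<in> closed_ivl T e. edge_point T e s \<in> U}))"
    (is "istopology ?P")
    unfolding istopology_def
  proof (intro conjI allI impI)
    fix A B assume "?P A" "?P B"
    moreover have "{s \<in> closed_ivl T e. edge_point T e s \<in> A \<inter> B} =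
        {s \<in> closed_ivl T e. edge_point T e s \<in> A} \<inter> {s \<in> closed_ivl T e. edge_point T e s \<in> B}" for e
      by auto
    ultimately show "A \<inter> B \<subseteq> points T"
      "\<forall>e\<in>edges T. openin (top_of_set (closed_ivl T e)) {s \<in> closed_ivl T e. edge_point T e s \<in> A \<inter> B}"
      by (auto simp only: intro!: openin_Int)
  next
    fix \<K> assume K: "\<forall>K\<in>\<K>. ?P K"
    then show "\<Union>\<K> \<subseteq> points T" by blast
    have "{s \<in> closed_ivl T e. edge_point T e s \<in> \<Union>\<K>} =
        (\<Union>K\<in>\<K>. {s \<in> closed_ivl T e. edge_point T e s \<in> K})" for e
      by auto
    then show "\<forall>e\<in>edges T. openin (top_of_set (closed_ivl T e)) {s \<in> closed_ivl T e. edge_point T e s \<in> \<Union>\<K>}"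
      using K by (auto simp only: intro!: openin_Union)
  qed
  then show ?thesis
    by (simp add: tree_topology_def topology_inverse')
qed

text \<open>Lebesgue (length) measure: vertices are null sets.\<close>

definition edge_trace :: "('a, 'b) metric_tree \<Rightarrow> 'b \<Rightarrow> ('a, 'b) point set \<Rightarrow> real set" where
  "edge_trace T e A = {s \<in> open_ivl T e. Inner e s \<in> A}"

definition tree_length :: "('a, 'b) metric_tree \<Rightarrow> ('a, 'b) point measure" where
  "tree_length T = measure_of (points T)
     {A. A \<subseteq> points T \<and> (\<forall>e\<in>edges T. edge_trace T e A \<in> sets borel)}
     (\<lambda>A. \<Sum>e\<in>edges T. emeasure lborel (edge_trace T e A))"

lemma sigma_algebra_edge_trace:
  "sigma_algebra (points T) {A. A \<subseteq> points T \<and> (\<forall>e\<in>edges T. edge_trace T e A \<in> sets borel)}"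
    (is "sigma_algebra _ ?S")
proof (rule sigma_algebra_iff2[THEN iffD2], intro conjI ballI allI impI)
  show "?S \<subseteq> Pow (points T)" "{} \<in> ?S"
    by (auto simp: edge_trace_def)
next
  fix A assume A: "A \<in> ?S"
  have "edge_trace T e (points T - A) \<in> sets borel" if e: "e \<in> edges T" for e
  proof -
    have "Inner e s \<in> points T" if "s \<in> open_ivl T e" for s
    proof -
      have "edge_point T e s = Inner e s" "s \<in> closed_ivl T e"
        using that by (auto simp: edge_point_def open_ivl_def closed_ivl_def split: if_splits)
      then show ?thesis
        using e unfolding points_def edge_points_def by (metis UN_I UnI2 image_eqI)
    qed
    then have "edge_trace T e (points T - A) = open_ivl T e - edge_trace T e A"
      by (auto simp: edge_trace_def)
    moreover have "open_ivl T e \<in> sets borel"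
      by (auto simp: open_ivl_def)
    ultimately show ?thesis using A e by auto
  qed
  then show "points T - A \<in> ?S" by auto
next
  fix A :: "nat \<Rightarrow> _" assume A: "range A \<subseteq> ?S"
  have "edge_trace T e (\<Union>i. A i) = (\<Union>i. edge_trace T e (A i))" for e
    by (auto simp: edge_trace_def)
  then show "(\<Union>i. A i) \<in> ?S" using A by (auto simp: image_subset_iff)
qed

lemma sets_tree_length:
  "sets (tree_length T) = {A. A \<subseteq> points T \<and> (\<forall>e\<in>edges T. edge_trace T e A \<in> sets borel)}"
  unfolding tree_length_def
  by (rule sigma_algebra.sets_measure_of_eq[OF sigma_algebra_edge_trace])

lemma emeasure_tree_length:
  assumes "finite (edges T)" "A \<in> sets (tree_length T)"
  shows "emeasure (tree_length T) A = (\<Sum>e\<in>edges T. emeasure lborel (edge_trace T e A))"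
proof (rule emeasure_measure_of[OF tree_length_def _ _ _ assms(2)])
  show "positive (sets (tree_length T)) (\<lambda>A. \<Sum>e\<in>edges T. emeasure lborel (edge_trace T e A))"
    by (simp add: positive_def edge_trace_def)
  show "countably_additive (sets (tree_length T)) (\<lambda>A. \<Sum>e\<in>edges T. emeasure lborel (edge_trace T e A))"
  proof (rule countably_additiveI)
    fix A :: "nat \<Rightarrow> _"
    assume A: "range A \<subseteq> sets (tree_length T)" "disjoint_family A"
    have "(\<Sum>i. emeasure lborel (edge_trace T e (A i))) = emeasure lborel (edge_trace T e (\<Union>i. A i))"
      if "e \<in> edges T" for e
    proof -
      have "edge_trace T e (\<Union>i. A i) = (\<Union>i. edge_trace T e (A i))"
        by (auto simp: edge_trace_def)
      moreover have "disjoint_family (\<lambda>i. edge_trace T e (A i))"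
        using A(2) by (auto simp: disjoint_family_on_def edge_trace_def)
      moreover have "range (\<lambda>i. edge_trace T e (A i)) \<subseteq> sets lborel"
        using A(1) that by (auto simp: sets_tree_length image_subset_iff)
      ultimately show ?thesis by (simp add: suminf_emeasure)
    qed
    then show "(\<Sum>i. \<Sum>e\<in>edges T. emeasure lborel (edge_trace T e (A i))) =
        (\<Sum>e\<in>edges T. emeasure lborel (edge_trace T e (\<Union>i. A i)))"
      by (subst suminf_sum) auto
  qed
qed auto

definition gauss :: "real \<Rightarrow> real" where
  "gauss s = 2 / sqrt pi * exp (- (s\<^sup>2))"

definition mu :: "('a, 'b) metric_tree \<Rightarrow> ('a, 'b) point measure" where
  "mu T = density (tree_length T) (\<lambda>x. ennreal (gauss (root_dist T x)))"

definition nu :: "('a, 'b) metric_tree \<Rightarrow> real measure" where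
  "nu T = density (restrict_space lborel {0..})
     (\<lambda>s. ennreal (real (branching_fn T (points T) s) * gauss s))"

text \<open>The measure \<open>nu\<close> on the half-line \<open>[c, \<infinity>)\<close>.\<close>

definition nu_from :: "('a, 'b) metric_tree \<Rightarrow> real \<Rightarrow> real measure" where
  "nu_from T c = restrict_space (nu T) {c..}"

text \<open>The measure \<open>mu\<close> on a single edge, in the arc length coordinate of that edge.\<close>

definition mu_edge :: "('a, 'b) metric_tree \<Rightarrow> 'b \<Rightarrow> real measure" where
  "mu_edge T e = density (restrict_space lborel (open_ivl T e))
     (\<lambda>s. ennreal (gauss (vertex_dist T (tail (skel T) e) + s)))"


section \<open>Function spaces\<close>

text \<open>Elements of \<open>L2\<close> are functions; equality in the space is equality almost everywhere.\<close>

definition L2 :: "'x measure \<Rightarrow> ('x \<Rightarrow> complex) set" where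
  "L2 M = {f \<in> borel_measurable M. integrable M (\<lambda>x. (cmod (f x))\<^sup>2)}"

definition L2_inner :: "'x measure \<Rightarrow> ('x \<Rightarrow> complex) \<Rightarrow> ('x \<Rightarrow> complex) \<Rightarrow> complex" where
  "L2_inner M f g = (\<integral>x. f x * cnj (g x) \<partial>M)"

text \<open>
  Orthogonal direct sum decomposition of \<open>L2 M\<close> into finitely many linear subspaces:
  uniqueness (almost everywhere) of the components and closedness of the summands
  follow from the conditions below.
\<close>

definition L2_subspace :: "'x measure \<Rightarrow> ('x \<Rightarrow> complex) set \<Rightarrow> bool" where
  "L2_subspace M F \<longleftrightarrow> F \<subseteq> L2 M \<and> (\<lambda>x. 0) \<in> F \<and>
     (\<forall>f\<in>F. \<forall>g\<in>F. (\<lambda>x. f x + g x) \<in> F) \<and> (\<forall>c. \<forall>f\<in>F. (\<lambda>x. c * f x) \<in> F)"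

definition orthogonal_decomposition ::
    "'x measure \<Rightarrow> 'i set \<Rightarrow> ('i \<Rightarrow> ('x \<Rightarrow> complex) set) \<Rightarrow> bool" where
  "orthogonal_decomposition M I F \<longleftrightarrow>
     finite I \<and> (\<forall>i\<in>I. L2_subspace M (F i)) \<and>
     (\<forall>i\<in>I. \<forall>j\<in>I. i \<noteq> j \<longrightarrow> (\<forall>f\<in>F i. \<forall>g\<in>F j. L2_inner M f g = 0)) \<and>
     (\<forall>f\<in>L2 M. \<exists>g. (\<forall>i\<in>I. g i \<in> F i) \<and> (AE x in M. f x = (\<Sum>i\<in>I. g i x)))"

definition test_function :: "real set \<Rightarrow> (real \<Rightarrow> real) \<Rightarrow> bool" where
  "test_function U \<phi> \<longleftrightarrow>
     (\<forall>n s. ((deriv ^^ n) \<phi>) field_differentiable (at s)) \<and>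
     compact (closure {s. \<phi> s \<noteq> 0}) \<and> closure {s. \<phi> s \<noteq> 0} \<subseteq> U"

definition locally_integrable :: "real set \<Rightarrow> (real \<Rightarrow> complex) \<Rightarrow> bool" where
  "locally_integrable U f \<longleftrightarrow> (\<forall>K. compact K \<and> K \<subseteq> U \<longrightarrow> set_integrable lborel K f)"

definition has_weak_deriv :: "real set \<Rightarrow> (real \<Rightarrow> complex) \<Rightarrow> (real \<Rightarrow> complex) \<Rightarrow> bool" where
  "has_weak_deriv U f g \<longleftrightarrow> locally_integrable U f \<and> locally_integrable U g \<and>
     (\<forall>\<phi>. test_function U \<phi> \<longrightarrow>
        (LINT s:U|lborel. f s * of_real (deriv \<phi> s)) = - (LINT s:U|lborel. g s * of_real (\<phi> s)))"

text \<open>A weak derivative is determined up to a null set of the open set \<open>U\<close>.\<close>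

definition weak_deriv :: "real set \<Rightarrow> (real \<Rightarrow> complex) \<Rightarrow> real \<Rightarrow> complex" where
  "weak_deriv U f = (SOME g. has_weak_deriv U f g)"

definition H1 :: "real measure \<Rightarrow> real set \<Rightarrow> (real \<Rightarrow> complex) set" where
  "H1 M U = {f \<in> L2 M. \<exists>g\<in>L2 M. has_weak_deriv U f g}"

text \<open>Vanishing at \<open>c\<close> refers to the continuous representative on \<open>[c, \<infinity>)\<close>.\<close>

definition H10_nu :: "('a, 'b) metric_tree \<Rightarrow> real \<Rightarrow> (real \<Rightarrow> complex) set" where
  "H10_nu T c = {f \<in> H1 (nu_from T c) {c<..}.
     \<exists>f'. continuous_on {c..} f' \<and> f' c = 0 \<and> (AE s in nu_from T c. f s = f' s)}"

definition H10_mu :: "('a, 'b) metric_tree \<Rightarrow> (('a, 'b) point \<Rightarrow> complex) set" where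
  "H10_mu T = {f. continuous_map (tree_topology T) euclidean f \<and>
     (\<forall>e\<in>edges T. (\<lambda>s. f (Inner e s)) \<in> H1 (mu_edge T e) (open_ivl T e)) \<and>
     f (Vertex (origin T)) = 0}"

primrec tree_deriv ::
    "('a, 'b) metric_tree \<Rightarrow> (('a, 'b) point \<Rightarrow> complex) \<Rightarrow> ('a, 'b) point \<Rightarrow> complex" where
  "tree_deriv T f (Vertex v) = 0"
| "tree_deriv T f (Inner e s) = weak_deriv (open_ivl T e) (\<lambda>r. f (Inner e r)) s"


section \<open>Symmetric subspaces and components\<close>

definition radial_space ::
    "('a, 'b) metric_tree \<Rightarrow> ('a, 'b) point set \<Rightarrow> (('a, 'b) point \<Rightarrow> complex) set" where
  "radial_space T S = {f \<in> L2 (mu T). (\<forall>x\<in>points T - S. f x = 0) \<and>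
     (\<forall>x\<in>S. \<forall>y\<in>S. root_dist T x = root_dist T y \<longrightarrow> f x = f y)}"

definition radial_proj ::
    "('a, 'b) metric_tree \<Rightarrow> ('a, 'b) point set \<Rightarrow> (('a, 'b) point \<Rightarrow> complex) \<Rightarrow>
     ('a, 'b) point \<Rightarrow> complex" where
  "radial_proj T S f x = (if x \<in> S
     then (\<Sum>y\<in>sphere_of T S (root_dist T x). f y) / of_nat (branching_fn T S (root_dist T x))
     else 0)"

text \<open>
  The functions \<open>J_root\<close> and \<open>J_edge\<close> evaluate at any point at distance \<open>s\<close> from the
  root; on \<open>radial_space\<close> the choice of the point is immaterial. The argument \<open>k\<close> of
  \<open>J_edge\<close> is the generation of the tail of the edge.
\<close>

definition J_root ::
    "('a, 'b) metric_tree \<Rightarrow> (('a, 'b) point \<Rightarrow> complex) \<Rightarrow> real \<Rightarrow> complex" where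
  "J_root T f s = f (SOME x. x \<in> points T \<and> root_dist T x = s)"

definition J_edge ::
    "('a, 'b) metric_tree \<Rightarrow> (nat \<Rightarrow> nat) \<Rightarrow> nat \<Rightarrow> 'b \<Rightarrow>
     (('a, 'b) point \<Rightarrow> complex) \<Rightarrow> real \<Rightarrow> complex" where
  "J_edge T b k e f s =
     f (SOME x. x \<in> subtree T e \<and> root_dist T x = s) / of_real (sqrt (real (\<Prod>i\<le>k. b i)))"

definition omega :: "(nat \<Rightarrow> nat) \<Rightarrow> nat \<Rightarrow> complex" where
  "omega b k = exp (2 * of_real pi * \<i> / of_nat (b k))"

text \<open>The \<open>r\<close>-th entry, \<open>1 \<le> r \<le> b k\<close>, of the \<open>j\<close>-th vector of the discrete Fourier basis.\<close>

definition fourier_vec :: "(nat \<Rightarrow> nat) \<Rightarrow> nat \<Rightarrow> nat \<Rightarrow> nat \<Rightarrow> complex" where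
  "fourier_vec b k j r = omega b k ^ (r * j) / of_real (sqrt (real (b k)))"

text \<open>
  In the following, \<open>E v r\<close> with \<open>1 \<le> r \<le> b k\<close> enumerates the edges emanating from the
  vertex \<open>v\<close> of generation \<open>k\<close>. The direct sum of the spaces belonging to these edges is
  realised inside \<open>L2 (mu T)\<close>; their subtrees only share the vertex \<open>v\<close>.
\<close>

definition mode_space ::
    "('a, 'b) metric_tree \<Rightarrow> (nat \<Rightarrow> real) \<Rightarrow> (nat \<Rightarrow> nat) \<Rightarrow> ('a \<Rightarrow> nat \<Rightarrow> 'b) \<Rightarrow>
     nat \<Rightarrow> 'a \<Rightarrow> nat \<Rightarrow> (('a, 'b) point \<Rightarrow> complex) set" where
  "mode_space T t b E k v j = {(\<lambda>x. \<Sum>r=1..b k. f r x) | f.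
     (\<forall>r\<in>{1..b k}. f r \<in> radial_space T (subtree T (E v r))) \<and>
     (\<exists>\<phi>\<in>L2 (nu_from T (t k)). \<forall>r\<in>{1..b k}.
        AE s in nu_from T (t k). J_edge T b k (E v r) (f r) s = fourier_vec b k j r * \<phi> s)}"

definition root_component ::
    "('a, 'b) metric_tree \<Rightarrow> (('a, 'b) point \<Rightarrow> complex) \<Rightarrow> real \<Rightarrow> complex" where
  "root_component T f = J_root T (radial_proj T (points T) f)"

definition mode_component ::
    "('a, 'b) metric_tree \<Rightarrow> (nat \<Rightarrow> nat) \<Rightarrow> ('a \<Rightarrow> nat \<Rightarrow> 'b) \<Rightarrow>
     nat \<Rightarrow> 'a \<Rightarrow> nat \<Rightarrow> (('a, 'b) point \<Rightarrow> complex) \<Rightarrow> real \<Rightarrow> complex" where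
  "mode_component T b E k v j f s =
     (\<Sum>r=1..b k. omega b k powi (- int (r * j)) *
        J_edge T b k (E v r) (radial_proj T (subtree T (E v r)) f) s) / of_real (sqrt (real (b k)))"

text \<open>The summands, indexed by \<open>None\<close> (radial functions) and \<open>Some (k, v, j)\<close>.\<close>

definition summand_index ::
    "('a, 'b) metric_tree \<Rightarrow> nat \<Rightarrow> (nat \<Rightarrow> real) \<Rightarrow> (nat \<Rightarrow> nat) \<Rightarrow> (nat \<times> 'a \<times> nat) option set" where
  "summand_index T N t b =
     {None} \<union> {Some (k, v, j) | k v j. k \<le> N \<and> v \<in> generation T t k \<and> j \<in> {1..b k - 1}}"

fun summand ::
    "('a, 'b) metric_tree \<Rightarrow> (nat \<Rightarrow> real) \<Rightarrow> (nat \<Rightarrow> nat) \<Rightarrow> ('a \<Rightarrow> nat \<Rightarrow> 'b) \<Rightarrow>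
     (nat \<times> 'a \<times> nat) option \<Rightarrow> (('a, 'b) point \<Rightarrow> complex) set" where
  "summand T t b E None = radial_space T (points T)"
| "summand T t b E (Some (k, v, j)) = mode_space T t b E k v j"

end

theory Submission
  imports Defs
begin

text \<open>
  Functions on a sphere of radius \<open>s\<close> around the root are encoded by their values along the
  half-lines: every half-line \<open>\<rho>\<close> determines a geodesic \<open>s \<mapsto> ray_point \<rho> s\<close> from the root
  to infinity, and by regularity \<open>\<mu>\<close> is the average over \<open>\<rho>\<close> of the images of \<open>\<nu>\<close>. In this
  picture averaging over a subtree becomes averaging over the half-lines below an edge, and the
  radial functions together with the Fourier modes at the vertices form an orthogonal Haar basis
  of the functions of \<open>\<rho>\<close>; its completeness is a telescoping sum over the generations. The
  decomposition and the first identity are the expansion and Parseval's identity for this basis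
  at almost every \<open>s\<close>, integrated in \<open>s\<close>.

  A function in \<open>H\<^sup>1\<close> is absolutely continuous along every half-line, so the components of \<open>f'\<close>
  are the weak derivatives of the components of \<open>f\<close>, and the second identity is Parseval's
  identity for \<open>f'\<close>. The mode at a vertex \<open>v\<close> vanishes at its level because all half-lines
  through \<open>v\<close> take the value \<open>f v\<close> there and the mode has mean zero.
\<close>

section \<open>Smooth functions on the line\<close>

text \<open>The sphere of radius s changes its size at the levels, and so would any basis of
  functions on it. The half-lines are one finite index set for all radii: a point of generation m
  lies on \<open>prod_above m\<close> of them, whichever point it is, so averages over spheres are
  averages over half-lines. The modes at vertices beyond radius s vanish at s by themselves, because
  their half-lines have not yet separated; this is how the lower limits t k of the integrals arise.
  Statements about a radius s are made off the finitely many levels, where spheres consist of inner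
  points of edges. In the Sobolev part the obstacle is that \<open>weak_deriv\<close> is an
  arbitrary choice among functions satisfying an identity against test functions. Testing with
  smooth approximations of indicators of intervals ties it to the values of f: this gives the
  fundamental theorem of calculus inside an edge and uniqueness up to null sets. Weak derivatives on
  the separate edges carry no information at the vertices; the integrated form does extend across
  them, by continuity of f, and is then turned back into a weak derivative in the radius.\<close>

primrec diff_n :: "nat \<Rightarrow> (real \<Rightarrow> real) \<Rightarrow> bool" where
  "diff_n 0 f \<longleftrightarrow> (\<forall>x. f field_differentiable at x)"
| "diff_n (Suc n) f \<longleftrightarrow> (\<forall>x. f field_differentiable at x) \<and> diff_n n (deriv f)"

definition smooth :: "(real \<Rightarrow> real) \<Rightarrow> bool" where
  "smooth f \<longleftrightarrow> (\<forall>n. diff_n n f)"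

text \<open>\<open>diff_n\<close> peels off the first derivative, which suits inductions over
  arbitrary f, whereas \<open>test_function\<close> iterates \<open>deriv\<close> from the outside.
  The two agree because \<open>deriv\<close> commutes with its powers.\<close>

lemma diff_n_iff: "diff_n n f \<longleftrightarrow> (\<forall>m\<le>n. \<forall>x. ((deriv ^^ m) f) field_differentiable at x)"
proof (induction n arbitrary: f)
  case (Suc n)
  have "(\<forall>m\<le>Suc n. \<forall>x. ((deriv ^^ m) f) field_differentiable at x) \<longleftrightarrow>
      (\<forall>x. f field_differentiable at x) \<and>
      (\<forall>m\<le>n. \<forall>x. ((deriv ^^ Suc m) f) field_differentiable at x)"
    using All_less_Suc2[of "Suc n" "\<lambda>m. \<forall>x. ((deriv ^^ m) f) field_differentiable at x"]
    by (simp only: less_Suc_eq_le funpow_0)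
  then show ?case
    using Suc by (simp add: funpow_swap1)
qed simp

lemma smooth_iff: "smooth f \<longleftrightarrow> (\<forall>n s. ((deriv ^^ n) f) field_differentiable at s)"
  unfolding smooth_def diff_n_iff by blast

lemma diff_n_differentiable: "diff_n n f \<Longrightarrow> f field_differentiable at x"
  by (cases n) auto

text \<open>Trades \<open>deriv f\<close> for an explicit formula f', so that each closure proof
  below only has to exhibit a derivative.\<close>

lemma diff_n_SucI:
  assumes "\<And>x. (f has_real_derivative f' x) (at x)" "diff_n n f'"
  shows "diff_n (Suc n) f"
proof -
  have "deriv f = f'"
    using assms(1) by (auto intro: DERIV_imp_deriv)
  then show ?thesis
    using assms by (auto simp: field_differentiable_def)
qed

lemma diff_n_SucD: "diff_n (Suc n) f \<Longrightarrow> diff_n n f"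
  by (induction n arbitrary: f) (auto intro: diff_n_differentiable)

lemma diff_n_deriv: "diff_n n f \<Longrightarrow> (f has_real_derivative deriv f x) (at x)"
  using DERIV_deriv_iff_field_differentiable diff_n_differentiable by blast

lemma diff_n_const: "diff_n n (\<lambda>x. c)"
proof (induction n arbitrary: c)
  case (Suc n) show ?case by (rule diff_n_SucI[OF _ Suc[of 0]]) (auto intro!: derivative_eq_intros)
qed simp

lemma diff_n_add: "diff_n n f \<Longrightarrow> diff_n n g \<Longrightarrow> diff_n n (\<lambda>x. f x + g x)"
proof (induction n arbitrary: f g)
  case (Suc n)
  show ?case
    by (rule diff_n_SucI[OF _ Suc.IH[of "deriv f" "deriv g"]])
      (use Suc.prems in \<open>auto intro!: DERIV_add diff_n_deriv[of "Suc n"]\<close>)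
qed (auto intro: field_differentiable_add)

lemma diff_n_mult: "diff_n n f \<Longrightarrow> diff_n n g \<Longrightarrow> diff_n n (\<lambda>x. f x * g x)"
proof (induction n arbitrary: f g)
  case (Suc n)
  show ?case
  proof (rule diff_n_SucI)
    show "((\<lambda>x. f x * g x) has_real_derivative deriv f x * g x + deriv g x * f x) (at x)" for x
      by (intro DERIV_mult diff_n_deriv[of "Suc n"] Suc.prems)
    show "diff_n n (\<lambda>x. deriv f x * g x + deriv g x * f x)"
      using Suc.prems by (intro diff_n_add Suc.IH) (auto intro: diff_n_SucD)
  qed
qed (auto intro: field_differentiable_mult)

text \<open>Here f stays fixed in the induction: the derivative of 1/f is -f' (1/f)^2, a product of
  f' with copies of 1/f itself, to which the induction hypothesis applies.\<close>

lemma diff_n_inverse: "diff_n n f \<Longrightarrow> (\<And>x. f x \<noteq> 0) \<Longrightarrow> diff_n n (\<lambda>x. inverse (f x))"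
proof (induction n)
  case (Suc n)
  have IH: "diff_n n (\<lambda>x. inverse (f x))"
    using Suc diff_n_SucD by blast
  show ?case
  proof (rule diff_n_SucI)
    show "((\<lambda>x. inverse (f x)) has_real_derivative (-1) * (deriv f x * (inverse (f x) * inverse (f x)))) (at x)" for x
      by (rule derivative_eq_intros diff_n_deriv[of "Suc n"] Suc.prems refl)+ (use Suc.prems in auto)
    show "diff_n n (\<lambda>x. (-1) * (deriv f x * (inverse (f x) * inverse (f x))))"
      using Suc.prems by (intro diff_n_mult IH diff_n_const) auto
  qed
qed (auto intro: field_differentiable_inverse)

lemma DERIV_affine:
  assumes "\<And>x. (f has_real_derivative f' x) (at x)"
  shows "((\<lambda>x. f (a * x + c)) has_real_derivative a * f' (a * x + c)) (at (x :: real))"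
proof -
  have "((\<lambda>x. a * x + c) has_real_derivative a) (at x)"
    by (auto intro!: derivative_eq_intros)
  from DERIV_chain'[OF this assms] show ?thesis
    by (simp add: mult.commute)
qed

lemma diff_n_affine: "diff_n n f \<Longrightarrow> diff_n n (\<lambda>x. f (a * x + c))"
proof (induction n arbitrary: f)
  case 0
  then have f: "(f has_real_derivative deriv f x) (at x)" for x
    using DERIV_deriv_iff_field_differentiable by auto
  from DERIV_affine[OF f] show ?case
    by (auto simp: field_differentiable_def)
next
  case (Suc n)
  show ?case
  proof (rule diff_n_SucI)
    show "((\<lambda>x. f (a * x + c)) has_real_derivative a * deriv f (a * x + c)) (at x)" for x
      by (rule DERIV_affine[OF diff_n_deriv[OF Suc.prems]])
    show "diff_n n (\<lambda>x. a * deriv f (a * x + c))"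
      using Suc by (intro diff_n_mult diff_n_const Suc.IH) auto
  qed
qed

text \<open>All the powers x^m are carried along because differentiation turns the m-th function
  into a combination of those with numbers m + 1 and m + 2; smoothness of the whole family is then a
  single induction.\<close>

definition exp_flat :: "nat \<Rightarrow> real \<Rightarrow> real" where
  "exp_flat m x = (if 0 < x then exp (- 1 / x) / x ^ m else 0)"

lemma has_derivative_exp_flat:
  "(exp_flat m has_real_derivative (- real m) * exp_flat (Suc m) x + exp_flat (m + 2) x) (at x)"
proof -
  consider "x < 0" | "x = 0" | "0 < x" by linarith
  then show ?thesis
  proof cases
    case 1
    have "((\<lambda>x. 0) has_real_derivative 0) (at x)" by simp
    then have "(exp_flat m has_real_derivative 0) (at x)"
      by (rule has_field_derivative_transform_within_open[of _ _ _ "{..<0}"]) (use 1 in \<open>auto simp: exp_flat_def\<close>)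
    then show ?thesis using 1 by (simp add: exp_flat_def)
  next
    case 2
    \<comment> \<open>The difference quotient at 0. With z = 1/y it is z^(m+1) / exp z, which tends
      to 0 as z tends to infinity.\<close>
    have "((\<lambda>y. exp_flat m y / y) \<longlongrightarrow> 0) (at_right 0)"
    proof -
      have lim: "((\<lambda>y::real. y ^ Suc m / exp y) \<longlongrightarrow> 0) at_top"
        by (rule tendsto_power_div_exp_0)
      have "((\<lambda>y::real. (inverse y) ^ Suc m / exp (inverse y)) \<longlongrightarrow> 0) (at_right 0)"
        by (rule filterlim_compose[OF lim filterlim_inverse_at_top_right])
      then show ?thesis
        by (rule Lim_transform_eventually)
          (auto simp: exp_flat_def exp_minus divide_simps eventually_at_filter)
    qed
    moreover have "((\<lambda>y. exp_flat m y / y) \<longlongrightarrow> 0) (at_left 0)"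
      by (rule Lim_transform_eventually[of "\<lambda>_. 0"])
         (auto simp: exp_flat_def eventually_at_filter)
    ultimately have "((\<lambda>y. exp_flat m y / y) \<longlongrightarrow> 0) (at 0)"
      by (simp add: filterlim_at_split)
    then show ?thesis
      using 2 by (simp add: has_field_derivative_iff exp_flat_def)
  next
    case 3
    have "((\<lambda>x. exp (- 1 / x) / x ^ m) has_real_derivative
      (- real m) * exp_flat (Suc m) x + exp_flat (m + 2) x) (at x)"
    proof -
      have "((\<lambda>x::real. - 1 / x) has_real_derivative 1 / x\<^sup>2) (at x)"
        using 3 by (auto intro!: derivative_eq_intros simp: power2_eq_square)
      from DERIV_divide[OF DERIV_chain'[OF this DERIV_exp] DERIV_pow[of m]] show ?thesis
        by (rule DERIV_cong) (use 3 in \<open>cases m; simp add: exp_flat_def field_simps power2_eq_square\<close>)+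
    qed
    then show ?thesis
      by (rule has_field_derivative_transform_within_open[of _ _ _ "{0<..}"]) (use 3 in \<open>auto simp: exp_flat_def\<close>)
  qed
qed

lemma diff_n_exp_flat: "diff_n n (exp_flat m)"
proof (induction n arbitrary: m)
  case 0
  show ?case using has_derivative_exp_flat by (auto simp: field_differentiable_def)
next
  case (Suc n)
  show ?case
    by (rule diff_n_SucI[OF has_derivative_exp_flat]) (intro diff_n_add diff_n_mult diff_n_const Suc)
qed

text \<open>The usual transition function, 0 up to 0 and 1 from 1 on. The denominator is positive
  because x and 1 - x are never both nonpositive.\<close>

definition smooth_step :: "real \<Rightarrow> real" where
  "smooth_step x = exp_flat 0 x * inverse (exp_flat 0 x + exp_flat 0 (1 - x))"

lemma exp_flat_nonneg: "0 \<le> exp_flat 0 x" and exp_flat_pos: "0 < x \<Longrightarrow> 0 < exp_flat 0 x"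
  by (auto simp: exp_flat_def)

lemma smooth_step_denominator: "0 < exp_flat 0 x + exp_flat 0 (1 - x)"
  using exp_flat_nonneg[of x] exp_flat_nonneg[of "1 - x"] exp_flat_pos[of x] exp_flat_pos[of "1 - x"]
  by (cases "0 < x") auto

lemma diff_n_smooth_step: "diff_n n smooth_step"
proof -
  have "diff_n n (\<lambda>x. exp_flat 0 ((-1) * x + 1))"
    by (rule diff_n_affine[OF diff_n_exp_flat])
  then have "diff_n n (\<lambda>x. exp_flat 0 (1 - x))"
    by simp
  then have "diff_n n (\<lambda>x. exp_flat 0 x * inverse (exp_flat 0 x + exp_flat 0 (1 - x)))"
    using smooth_step_denominator by (intro diff_n_mult diff_n_inverse diff_n_add diff_n_exp_flat) (auto simp: less_imp_neq[symmetric])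
  then show ?thesis
    unfolding smooth_step_def[abs_def] .
qed

lemma smooth_step_0: "x \<le> 0 \<Longrightarrow> smooth_step x = 0"
  by (simp add: smooth_step_def exp_flat_def)

lemma smooth_step_1: "1 \<le> x \<Longrightarrow> smooth_step x = 1"
  by (simp add: smooth_step_def exp_flat_def)

lemma smooth_step_bounds: "0 \<le> smooth_step x" "smooth_step x \<le> 1"
  using exp_flat_nonneg[of x] exp_flat_nonneg[of "1 - x"] smooth_step_denominator[of x]
  by (auto simp: smooth_step_def field_simps)

lemma smooth_smooth_step: "smooth smooth_step"
  by (simp add: smooth_def diff_n_smooth_step)

lemma smooth_add: "smooth f \<Longrightarrow> smooth g \<Longrightarrow> smooth (\<lambda>x. f x + g x)"
  and smooth_mult: "smooth f \<Longrightarrow> smooth g \<Longrightarrow> smooth (\<lambda>x. f x * g x)"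
  and smooth_const: "smooth (\<lambda>x. c)"
  and smooth_affine: "smooth f \<Longrightarrow> smooth (\<lambda>x. f (a * x + c))"
  by (simp_all add: smooth_def diff_n_add diff_n_mult diff_n_const diff_n_affine)

lemma smooth_diff: "smooth f \<Longrightarrow> smooth g \<Longrightarrow> smooth (\<lambda>x. f x - g x)"
  using smooth_add[of f "\<lambda>x. (-1) * g x"] smooth_mult[OF smooth_const[of "-1"], of g] by simp

lemma smooth_DERIV: "smooth f \<Longrightarrow> (f has_real_derivative deriv f x) (at x)"
  using diff_n_deriv[of 0] smooth_def by blast

lemma smooth_deriv: "smooth f \<Longrightarrow> smooth (deriv f)"
  unfolding smooth_def by (meson diff_n.simps(2))

lemma smooth_continuous_on: "smooth f \<Longrightarrow> continuous_on S f"
  by (meson DERIV_isCont continuous_at_imp_continuous_on smooth_DERIV)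

lemma smooth_borel_measurable: "smooth f \<Longrightarrow> f \<in> borel_measurable borel"
  by (simp add: borel_measurable_continuous_onI smooth_continuous_on)

section \<open>Test functions approximating indicators of intervals\<close>

lemma test_functionI:
  assumes "smooth f" "\<And>s. s \<notin> {a..b} \<Longrightarrow> f s = 0" "{a..b} \<subseteq> U"
  shows "test_function U f"
proof -
  have "closure {s. f s \<noteq> 0} \<subseteq> {a..b}"
    using assms(2) by (intro closure_minimal) (auto simp del: atLeastAtMost_iff)
  moreover from this have "compact (closure {s. f s \<noteq> 0})"
    by (meson bounded_closed_interval bounded_subset closed_closure compact_eq_bounded_closed)
  ultimately show ?thesis
    using assms(1,3) unfolding test_function_def smooth_iff by (metis order_trans)
qed

lemma test_function_smooth: "test_function U \<phi> \<Longrightarrow> smooth \<phi>"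
  by (simp add: test_function_def smooth_iff)

text \<open>A smooth stand-in for the indicator of (x, y]. The step at x lives on [x, x + 1/c] and
  the one at y on [y, y + 1/c], so the support exceeds [x, y] only to the right.\<close>

definition plateau :: "real \<Rightarrow> real \<Rightarrow> real \<Rightarrow> real \<Rightarrow> real" where
  "plateau c x y s = smooth_step (c * (s - x)) - smooth_step (c * (s - y))"

lemma smooth_shifted_step: "smooth (\<lambda>s. smooth_step (c * (s - x)))"
  using smooth_affine[OF smooth_smooth_step, of c "- c * x"] by (simp add: algebra_simps)

lemma smooth_plateau: "smooth (plateau c x y)"
  unfolding plateau_def[abs_def] by (intro smooth_diff smooth_shifted_step)

lemma deriv_plateau: "deriv (plateau c x y) s =
    c * deriv smooth_step (c * (s - x)) - c * deriv smooth_step (c * (s - y))"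
proof -
  have "((\<lambda>s. smooth_step (c * (s - x))) has_real_derivative c * deriv smooth_step (c * (s - x))) (at s)" for x
    using DERIV_affine[of smooth_step, OF smooth_DERIV[OF smooth_smooth_step], of c "- c * x" s]
    by (simp add: algebra_simps)
  then show ?thesis
    unfolding plateau_def[abs_def] by (intro DERIV_imp_deriv DERIV_diff)
qed

lemma plateau_eq_0:
  assumes "0 < c" "x \<le> y" "s \<notin> {x..y + 1 / c}"
  shows "plateau c x y s = 0"
proof (cases "s < x")
  case True
  then show ?thesis using assms(1,2) by (simp add: plateau_def smooth_step_0 mult_nonneg_nonpos)
next
  case False
  then have "y + 1 / c < s" using assms(3) by simp
  then have "1 \<le> c * (s - y)" using assms(1) by (simp add: field_simps)
  moreover have "c * (s - y) \<le> c * (s - x)" using assms(1,2) by simp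
  ultimately have "1 \<le> c * (s - x)" by linarith
  with \<open>1 \<le> c * (s - y)\<close> show ?thesis by (simp add: plateau_def smooth_step_1)
qed

lemma abs_plateau_le: "\<bar>plateau c x y s\<bar> \<le> 1"
  using smooth_step_bounds[of "c * (s - x)"] smooth_step_bounds[of "c * (s - y)"]
  by (simp add: plateau_def abs_le_iff)

lemma smooth_step_limit:
  assumes "filterlim c at_top sequentially"
  shows "(\<lambda>n. smooth_step (c n * (s - x))) \<longlonglongrightarrow> (if x < s then 1 else 0)"
proof (cases "x < s")
  case True
  have "\<forall>\<^sub>F n in sequentially. 1 / (s - x) \<le> c n \<and> 0 \<le> c n"
    using assms by (auto simp: filterlim_at_top eventually_conj_iff)
  then have "\<forall>\<^sub>F n in sequentially. smooth_step (c n * (s - x)) = 1"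
    by eventually_elim (use True in \<open>auto intro!: smooth_step_1 simp: field_simps\<close>)
  then show ?thesis
    using True by (simp add: tendsto_eventually)
next
  case False
  have "\<forall>\<^sub>F n in sequentially. 0 \<le> c n"
    using assms by (auto simp: filterlim_at_top)
  then have "\<forall>\<^sub>F n in sequentially. smooth_step (c n * (s - x)) = 0"
    by eventually_elim (use False in \<open>auto intro!: smooth_step_0 mult_nonneg_nonpos\<close>)
  then show ?thesis
    using False by (simp add: tendsto_eventually)
qed

lemma plateau_limit:
  assumes "filterlim c at_top sequentially" "x \<le> y"
  shows "(\<lambda>n. plateau (c n) x y s) \<longlonglongrightarrow> indicator {x<..y} s"
  using tendsto_diff[OF smooth_step_limit[OF assms(1), of s x] smooth_step_limit[OF assms(1), of s y]] assms(2)
  by (cases "x < s"; cases "y < s") (auto simp: plateau_def)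

lemma plateau_integral_limit:
  fixes g :: "real \<Rightarrow> complex"
  assumes c: "filterlim c at_top sequentially" "\<And>n. 0 < c n" "\<And>n. {x..y + 1 / c n} \<subseteq> K"
    and xy: "x \<le> y" and g: "set_integrable lborel K g" and K: "compact K" "K \<subseteq> U"
  shows "(\<lambda>n. LINT s:U|lborel. g s * of_real (plateau (c n) x y s)) \<longlonglongrightarrow> (LINT s:{x..y}|lborel. g s)"
proof -
  have gK: "integrable lborel (\<lambda>s. indicator K s *\<^sub>R g s)"
    using g by (simp add: set_integrable_def)
  have eq: "indicator U s *\<^sub>R (g s * of_real (plateau (c n) x y s)) =
      (indicator K s *\<^sub>R g s) * of_real (plateau (c n) x y s)" for s n
  proof (cases "s \<in> K")
    case False
    then have "plateau (c n) x y s = 0"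
      using c(2,3)[of n] xy by (intro plateau_eq_0) auto
    then show ?thesis by simp
  qed (use K in auto)
  have "(\<lambda>n. LINT s|lborel. (indicator K s *\<^sub>R g s) * of_real (plateau (c n) x y s)) \<longlonglongrightarrow>
      (LINT s|lborel. (indicator K s *\<^sub>R g s) * of_real (indicator {x<..y} s))"
  proof (rule integral_dominated_convergence[where w = "\<lambda>s. norm (indicator K s *\<^sub>R g s)"])
    show "AE s in lborel. (\<lambda>n. (indicator K s *\<^sub>R g s) * of_real (plateau (c n) x y s)) \<longlonglongrightarrow>
        (indicator K s *\<^sub>R g s) * of_real (indicator {x<..y} s)"
      by (intro AE_I2 tendsto_intros plateau_limit c xy)
    show "AE s in lborel. norm ((indicator K s *\<^sub>R g s) * of_real (plateau (c n) x y s)) \<le> norm (indicator K s *\<^sub>R g s)" for n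
      using abs_plateau_le[of "c n" x y] by (intro AE_I2) (simp add: norm_mult mult_left_le mult_left_mono)
    show "(\<lambda>s. (indicator K s *\<^sub>R g s) * of_real (plateau (c n) x y s)) \<in> borel_measurable lborel" for n
      using borel_measurable_integrable[OF gK] smooth_borel_measurable[OF smooth_plateau, of "c n" x y] by measurable
    show "(\<lambda>s. (indicator K s *\<^sub>R g s) * of_real (indicator {x<..y} s)) \<in> borel_measurable lborel"
      using borel_measurable_integrable[OF gK] by measurable
    show "integrable lborel (\<lambda>s. norm (indicator K s *\<^sub>R g s))"
      using gK by (rule integrable_norm)
  qed
  moreover have "(LINT s|lborel. (indicator K s *\<^sub>R g s) * of_real (indicator {x<..y} s)) = (LINT s:{x..y}|lborel. g s)"
  proof -
    have "0 < 1 / c 0" using c(2)[of 0] by simp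
    then have "{x..y} \<subseteq> {x..y + 1 / c 0}" by auto
    with c(3)[of 0] have "{x..y} \<subseteq> K" by blast
    then show ?thesis
      unfolding set_lebesgue_integral_def
      by (intro integral_discrete_difference[of "{x}"]) (auto simp: indicator_def)
  qed
  ultimately show ?thesis
    unfolding set_lebesgue_integral_def eq by simp
qed

lemma integral_deriv_smooth:
  assumes "smooth f" "a \<le> b"
  shows "(LINT u:{a..b}|lborel. of_real (deriv f u)) = complex_of_real (f b - f a)"
proof -
  have "(LINT u:{a..b}|lborel. deriv f u) = f b - f a"
    unfolding set_lebesgue_integral_def
    by (intro integral_FTC_Icc assms smooth_continuous_on smooth_deriv)
      (auto simp flip: has_real_derivative_iff_has_vector_derivative
        intro!: has_field_derivative_at_within smooth_DERIV assms)
  then show ?thesis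
    by (simp only: set_integral_complex_of_real)
qed

lemma deriv_smooth_step_eq_0: "u \<notin> {0..1} \<Longrightarrow> deriv smooth_step u = 0"
proof (cases "u < 0")
  case True
  have "(smooth_step has_real_derivative 0) (at u)"
    by (rule has_field_derivative_transform_within_open[of "\<lambda>_. 0" _ _ "{..<0}"]) (use True in \<open>auto simp: smooth_step_0\<close>)
  then show ?thesis by (rule DERIV_imp_deriv)
next
  case False
  assume "u \<notin> {0..1}"
  then have "1 < u" using False by simp
  then have "(smooth_step has_real_derivative 0) (at u)"
    using has_field_derivative_transform_within_open[of "\<lambda>_. 1" 0 u "{1<..}" smooth_step]
    by (simp add: smooth_step_1)
  then show ?thesis by (rule DERIV_imp_deriv)
qed

text \<open>The rescaled bumps \<open>c * deriv smooth_step (c * (s - x))\<close> form an approximate identity at \<open>x\<close>.\<close>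

lemma smooth_step_delta:
  fixes f :: "real \<Rightarrow> complex"
  assumes c: "filterlim c at_top sequentially" "\<And>n. 0 < c n" "\<And>n. {x..x + 1 / c n} \<subseteq> {x..d}"
    and f: "continuous_on {x..d} f" and d: "{x..d} \<subseteq> U"
  shows "(\<lambda>n. LINT s:U|lborel. f s * of_real (c n * deriv smooth_step (c n * (s - x)))) \<longlonglongrightarrow> f x"
    and "set_integrable lborel U (\<lambda>s. f s * of_real (c n * deriv smooth_step (c n * (s - x))))"
proof -
  \<comment> \<open>The integrand after the substitution u = c (s - x): the shrinking support
    becomes the fixed interval [0, 1], and f is evaluated at points tending to x.\<close>
  define h where "h n u = indicator {0..1} u *\<^sub>R (f (x + u / c n) * of_real (deriv smooth_step u))" for n u
  have in_d: "x + u / c n \<in> {x..d}" if "u \<in> {0..1}" for u n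
  proof -
    have "x + u / c n \<in> {x..x + 1 / c n}" using that c(2)[of n] by (auto simp: field_simps)
    then show ?thesis using c(3) by blast
  qed
  have S': "continuous_on {0..1} (deriv smooth_step)"
    by (rule smooth_continuous_on[OF smooth_deriv[OF smooth_smooth_step]])
  have cont: "continuous_on {0..1} (\<lambda>u. f (x + u / c n) * of_real (deriv smooth_step u))" for n
    using in_d c(2) by (intro continuous_intros continuous_on_compose2[OF f] S') (auto simp: less_imp_neq[symmetric])
  have int_h: "integrable lborel (h n)" for n
    unfolding h_def by (rule borel_integrable_compact[OF compact_Icc cont])
  have eq: "indicator U s *\<^sub>R (f s * of_real (c n * deriv smooth_step (c n * (s - x)))) =
      c n *\<^sub>R h n (- c n * x + c n * s)" for s n
  proof (cases "c n * (s - x) \<in> {0..1}")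
    case True
    have "x + c n * (s - x) / c n = s" using c(2)[of n] by (simp add: field_simps)
    with in_d[OF True, of n] have "s \<in> U" using d by auto
    then show ?thesis using True \<open>x + c n * (s - x) / c n = s\<close>
      by (simp add: h_def algebra_simps scaleR_conv_of_real)
  next
    case False
    then show ?thesis using deriv_smooth_step_eq_0[OF False] by (simp add: h_def algebra_simps)
  qed
  show int: "set_integrable lborel U (\<lambda>s. f s * of_real (c n * deriv smooth_step (c n * (s - x))))" for n
    unfolding set_integrable_def eq using c(2)[of n]
    by (intro integrable_scaleR_right lborel_integrable_real_affine[OF int_h]) auto
  have "(LINT s:U|lborel. f s * of_real (c n * deriv smooth_step (c n * (s - x)))) = (LINT u|lborel. h n u)" for n
    unfolding set_lebesgue_integral_def eq
    using lborel_integral_real_affine[of "c n" "h n" "- c n * x"] c(2)[of n] by simp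
  moreover have "(\<lambda>n. LINT u|lborel. h n u) \<longlonglongrightarrow>
      (LINT u|lborel. indicator {0..1} u *\<^sub>R (f x * of_real (deriv smooth_step u)))"
  proof -
    obtain B where B: "norm (f s) \<le> B" if "s \<in> {x..d}" for s
      using compact_imp_bounded[OF compact_continuous_image[OF f compact_Icc]] unfolding bounded_iff by blast
    show ?thesis
    proof (rule integral_dominated_convergence[where w = "\<lambda>u. indicator {0..1} u *\<^sub>R (B * \<bar>deriv smooth_step u\<bar>)"])
      show "AE u in lborel. (\<lambda>n. h n u) \<longlonglongrightarrow> indicator {0..1} u *\<^sub>R (f x * of_real (deriv smooth_step u))"
      proof (intro AE_I2)
        fix u :: real
        show "(\<lambda>n. h n u) \<longlonglongrightarrow> indicator {0..1} u *\<^sub>R (f x * of_real (deriv smooth_step u))"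
        proof (cases "u \<in> {0..1}")
          case True
          have "(\<lambda>n. x + u / c n) \<longlonglongrightarrow> x + 0"
            by (intro tendsto_intros real_tendsto_divide_at_top[OF tendsto_const c(1)])
          moreover have "x \<in> {x..d}" using in_d[of 0 0] by simp
          ultimately have "(\<lambda>n. f (x + u / c n)) \<longlonglongrightarrow> f x"
            by (intro continuous_on_tendsto_compose[OF f]) (use True in_d in auto)
          then show ?thesis using True unfolding h_def by (intro tendsto_intros)
        qed (simp add: h_def)
      qed
      show "AE u in lborel. norm (h n u) \<le> indicator {0..1} u *\<^sub>R (B * \<bar>deriv smooth_step u\<bar>)" for n
        using B in_d by (intro AE_I2) (auto simp: h_def norm_mult indicator_def intro!: mult_right_mono)
      show "integrable lborel (\<lambda>u. indicator {0..1} u *\<^sub>R (B * \<bar>deriv smooth_step u\<bar>))"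
        by (intro borel_integrable_compact continuous_intros S') auto
      show "(\<lambda>u. indicator {0..1} u *\<^sub>R (f x * of_real (deriv smooth_step u))) \<in> borel_measurable lborel"
        using smooth_borel_measurable[OF smooth_deriv[OF smooth_smooth_step]] by measurable
    qed (use int_h in auto)
  qed
  \<comment> \<open>The bump has mass \<open>smooth_step 1 - smooth_step 0\<close>, which is
    1.\<close>
  moreover have "(LINT u|lborel. indicator {0..1} u *\<^sub>R (f x * of_real (deriv smooth_step u))) = f x"
    using integral_deriv_smooth[OF smooth_smooth_step, of 0 1]
    by (simp add: set_lebesgue_integral_def mult_scaleR_right[symmetric] smooth_step_0 smooth_step_1 del: mult_scaleR_right)
  ultimately show "(\<lambda>n. LINT s:U|lborel. f s * of_real (c n * deriv smooth_step (c n * (s - x)))) \<longlonglongrightarrow> f x"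
    by simp
qed

section \<open>Weak derivatives\<close>

lemma has_weak_derivD:
  assumes "has_weak_deriv U f g"
  shows "locally_integrable U f" "locally_integrable U g"
    "test_function U \<phi> \<Longrightarrow>
      (LINT s:U|lborel. f s * of_real (deriv \<phi> s)) = - (LINT s:U|lborel. g s * of_real (\<phi> s))"
  using assms by (auto simp: has_weak_deriv_def)

lemma locally_integrableD: "locally_integrable U f \<Longrightarrow> compact K \<Longrightarrow> K \<subseteq> U \<Longrightarrow> set_integrable lborel K f"
  by (simp add: locally_integrable_def)

text \<open>Provides the room to the right of y that the descending step of a plateau takes
  up.\<close>

lemma enlarge_Icc_in_open:
  fixes U :: "real set"
  assumes "open U" "{x..y} \<subseteq> U" "x \<le> y"
  obtains d where "0 < d" "{x..y + d} \<subseteq> U"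
proof -
  obtain r where r: "0 < r" "cball y r \<subseteq> U"
    using assms open_contains_cball[of U] by force
  then have "{x..y + r} \<subseteq> U"
    using assms(2,3) by (auto simp: subset_iff dist_real_def) (metis add_diff_cancel_left' atLeastAtMost_iff abs_of_nonpos diff_le_0_iff_le linear minus_diff_eq add.commute diff_le_eq)
  with r that show ?thesis by blast
qed

text \<open>Against the plateau over [x, y], the left side of the weak derivative identity is a bump
  at x minus a bump at y, which tends to f x - f y by continuity of f; the right side tends to minus
  the integral of g over [x, y].\<close>

lemma weak_deriv_FTC:
  assumes wd: "has_weak_deriv U f g" and U: "open U" and f: "continuous_on U f"
    and xy: "x \<le> y" "{x..y} \<subseteq> U"
  shows "f y - f x = (LINT s:{x..y}|lborel. g s)"
proof -
  obtain d where d: "0 < d" "{x..y + d} \<subseteq> U"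
    using enlarge_Icc_in_open[OF U xy(2,1)] .
  \<comment> \<open>A slope tending to infinity with 1 / c n at most d, so that every plateau stays
    inside {x..y + d}.\<close>
  define c where "c n = real (Suc n) / d" for n
  have c: "filterlim c at_top sequentially"
    unfolding c_def using d(1) by real_asymp
  have c_pos: "0 < c n" for n
    using d(1) by (simp add: c_def)
  have c_le: "1 / c n \<le> d" for n
    using d(1) by (simp add: c_def field_simps)
  have test: "test_function U (plateau (c n) x y)" for n
    by (rule test_functionI[OF smooth_plateau plateau_eq_0[OF c_pos xy(1)]])
      (use c_le[of n] d(2) in \<open>auto simp: subset_iff\<close>)
  note g = locally_integrableD[OF has_weak_derivD(2)[OF wd] compact_Icc d(2)]
  have "(\<lambda>n. LINT s:U|lborel. g s * of_real (plateau (c n) x y s)) \<longlonglongrightarrow> (LINT s:{x..y}|lborel. g s)"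
    by (rule plateau_integral_limit[OF c c_pos _ xy(1) g compact_Icc d(2)])
      (use c_le in \<open>auto simp: intro: order_trans[OF _ add_left_mono]\<close>)
  moreover
  have dx: "{x..x + d} \<subseteq> U" and dy: "{y..y + d} \<subseteq> U"
    using d xy by (auto simp: subset_iff)
  note fx = smooth_step_delta[OF c c_pos _ continuous_on_subset[OF f dx] dx]
    and fy = smooth_step_delta[OF c c_pos _ continuous_on_subset[OF f dy] dy]
  have "(\<lambda>n. (LINT s:U|lborel. f s * of_real (c n * deriv smooth_step (c n * (s - x)))) -
      (LINT s:U|lborel. f s * of_real (c n * deriv smooth_step (c n * (s - y))))) \<longlonglongrightarrow> f x - f y"
    by (intro tendsto_diff fx(1) fy(1)) (use c_le in auto)
  moreover have "(LINT s:U|lborel. f s * of_real (c n * deriv smooth_step (c n * (s - x)))) -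
      (LINT s:U|lborel. f s * of_real (c n * deriv smooth_step (c n * (s - y)))) =
      - (LINT s:U|lborel. g s * of_real (plateau (c n) x y s))" for n
  proof -
    have "(LINT s:U|lborel. f s * of_real (c n * deriv smooth_step (c n * (s - x)))) -
      (LINT s:U|lborel. f s * of_real (c n * deriv smooth_step (c n * (s - y)))) =
      (LINT s:U|lborel. f s * of_real (deriv (plateau (c n) x y) s))"
      using fx(2)[of n] fy(2)[of n] c_le
      by (subst set_integral_diff(2)[symmetric]) (auto simp: deriv_plateau algebra_simps)
    then show ?thesis
      using has_weak_derivD(3)[OF wd test[of n]] by simp
  qed
  ultimately have "f x - f y = - (LINT s:{x..y}|lborel. g s)"
    using LIMSEQ_unique[OF _ tendsto_minus] by (metis (no_types, lifting) ext)
  then show ?thesis by (metis minus_diff_eq minus_minus)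
qed

text \<open>The Borel sets over which q, extended by 0, integrates to 0 are closed under complements
  and disjoint unions and contain all sets {..y}, an intersection-stable generator. Hence they are
  all Borel sets, which forces q to vanish almost everywhere.\<close>

lemma AE_zero_if_Icc_integrals_zero:
  fixes q :: "real \<Rightarrow> complex"
  assumes q: "set_integrable lborel {a..b} q"
    and zero: "\<And>y. y \<in> {a..b} \<Longrightarrow> (LINT s:{a..y}|lborel. q s) = 0"
  shows "AE s in lborel. s \<in> {a..b} \<longrightarrow> q s = 0"
proof -
  define h where "h s = indicator {a..b} s *\<^sub>R q s" for s
  have h: "integrable lborel h"
    using q by (simp add: set_integrable_def h_def[abs_def])
  have hA: "set_integrable lborel A h" if "A \<in> sets lborel" for A
    using h that integrable_mult_indicator unfolding set_integrable_def by blast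
  have "(LINT s:A|lborel. h s) = 0" if "A \<in> sets lborel" for A
  proof -
    have A: "A \<in> sigma_sets UNIV (range (\<lambda>y::real. {..y}))"
      using that by (simp add: borel_eq_atMost)
    have whole: "integral\<^sup>L lborel h = 0"
    proof (cases "a \<le> b")
      case True then show ?thesis using zero[of b] by (simp add: set_lebesgue_integral_def h_def[abs_def])
    qed (simp add: h_def[abs_def])
    have "Int_stable (range (\<lambda>y::real. {..y}))"
      by (auto simp: Int_stable_def)
    moreover have "range (\<lambda>y::real. {..y}) \<subseteq> Pow UNIV" by simp
    ultimately show ?thesis using A
    proof (induction rule: sigma_sets_induct_disjoint)
      case (basic A)
      then obtain y where A: "A = {..y}" by auto
      show ?case
      proof (cases "a \<le> y \<and> a \<le> b")
        case True
        have "indicator A s *\<^sub>R h s = indicator {a..min y b} s *\<^sub>R q s" for s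
          by (auto simp: A h_def indicator_def)
        then show ?thesis using zero[of "min y b"] True by (simp add: set_lebesgue_integral_def)
      next
        case False
        then have "(\<lambda>s. indicator A s *\<^sub>R h s) = (\<lambda>s. 0)"
          by (auto simp: A h_def indicator_def fun_eq_iff)
        then show ?thesis by (simp add: set_lebesgue_integral_def)
      qed
    next
      case (compl A)
      then have "A \<in> sets lborel" by (simp add: borel_eq_atMost)
      then have "set_integrable lborel (UNIV - A) h" "set_integrable lborel A h"
        by (auto intro!: hA)
      moreover have "(UNIV - A) \<inter> A = {}" by blast
      ultimately have "integral\<^sup>L lborel h = (LINT s:UNIV - A|lborel. h s) + (LINT s:A|lborel. h s)"
        using set_integral_Un[of "UNIV - A" A lborel h] by (simp add: set_lebesgue_integral_def Un_Diff_cancel2)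
      then show ?case using compl whole by simp
    next
      case (union A)
      then have A: "A i \<in> sets lborel" for i
        using union(2) by (auto simp: borel_eq_atMost)
      have "(\<Union>i. A i) \<in> sets lborel" using A by blast
      then show ?case
        using lebesgue_integral_countable_add[OF A _ hA[OF \<open>(\<Union>i. A i) \<in> sets lborel\<close>]] union
        by (simp add: disjoint_family_on_def)
    qed (simp add: set_lebesgue_integral_def)
  qed
  from sigma_finite_measure.density_zero[OF lborel.sigma_finite_measure_axioms h this] show ?thesis
    by (rule AE_mp) (auto simp: h_def intro!: AE_I2)
qed

text \<open>Plateaus recover the integral over each compact interval from the test function
  identity, so g and h have equal integrals there and agree almost everywhere on it. Countably many
  intervals with rational ends cover U.\<close>

lemma weak_deriv_unique:
  assumes g: "has_weak_deriv U f g" and h: "has_weak_deriv U f h" and U: "open U"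
  shows "AE s in lborel. s \<in> U \<longrightarrow> g s = h s"
proof -
  have eq: "(LINT s:{x..y}|lborel. g s) = (LINT s:{x..y}|lborel. h s)"
    if xy: "x \<le> y" "{x..y} \<subseteq> U" for x y
  proof -
    obtain d where d: "0 < d" "{x..y + d} \<subseteq> U"
      using enlarge_Icc_in_open[OF U xy(2,1)] .
    define c where "c n = real (Suc n) / d" for n
    have c: "filterlim c at_top sequentially"
      unfolding c_def using d(1) by real_asymp
    have c_pos: "0 < c n" and c_le: "1 / c n \<le> d" for n
      using d(1) by (simp_all add: c_def field_simps)
    have test: "test_function U (plateau (c n) x y)" for n
      by (rule test_functionI[OF smooth_plateau plateau_eq_0[OF c_pos xy(1)]])
        (use c_le[of n] d(2) in \<open>auto simp: subset_iff\<close>)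
    have lim: "(\<lambda>n. LINT s:U|lborel. k s * of_real (plateau (c n) x y s)) \<longlonglongrightarrow> (LINT s:{x..y}|lborel. k s)"
      if "has_weak_deriv U f k" for k
      by (rule plateau_integral_limit[OF c c_pos _ xy(1) locally_integrableD[OF has_weak_derivD(2)[OF that] compact_Icc d(2)] compact_Icc d(2)])
        (use c_le in \<open>auto simp: intro: order_trans[OF _ add_left_mono]\<close>)
    have "(LINT s:U|lborel. g s * of_real (plateau (c n) x y s)) = (LINT s:U|lborel. h s * of_real (plateau (c n) x y s))" for n
      using has_weak_derivD(3)[OF g test[of n]] has_weak_derivD(3)[OF h test[of n]] by simp
    with lim[OF g] lim[OF h] show ?thesis
      using LIMSEQ_unique by auto
  qed
  have AE_Icc: "AE s in lborel. s \<in> {a..b} \<longrightarrow> g s = h s" if "{a..b} \<subseteq> U" for a b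
  proof -
    have sub: "set_integrable lborel {a..b} g" "set_integrable lborel {a..b} h"
      using that g h by (auto intro: locally_integrableD[OF has_weak_derivD(2)])
    have "AE s in lborel. s \<in> {a..b} \<longrightarrow> g s - h s = 0"
    proof (rule AE_zero_if_Icc_integrals_zero)
      show "set_integrable lborel {a..b} (\<lambda>s. g s - h s)"
        by (rule set_integral_diff(1)[OF sub])
      show "(LINT s:{a..y}|lborel. g s - h s) = 0" if y: "y \<in> {a..b}" for y
      proof -
        have "set_integrable lborel {a..y} g" "set_integrable lborel {a..y} h"
          using y by (auto intro: set_integrable_subset[OF sub(1)] set_integrable_subset[OF sub(2)])
        moreover have "{a..y} \<subseteq> U" using y \<open>{a..b} \<subseteq> U\<close> by auto
        ultimately show ?thesis
          using eq[of a y] y by (simp add: set_integral_diff(2))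
      qed
    qed
    then show ?thesis by simp
  qed
  define Q where "Q = {(a, b). a \<in> \<rat> \<and> b \<in> \<rat> \<and> {a..b} \<subseteq> U}"
  have "countable Q"
    by (rule countable_subset[of _ "\<rat> \<times> \<rat>"]) (auto simp: Q_def countable_rat)
  then have "AE s in lborel. \<forall>(a, b)\<in>Q. s \<in> {a..b} \<longrightarrow> g s = h s"
    using AE_Icc by (subst AE_ball_countable) (auto simp: Q_def)
  then show ?thesis
  proof (rule AE_mp, intro AE_I2 impI)
    fix s assume *: "\<forall>(a, b)\<in>Q. s \<in> {a..b} \<longrightarrow> g s = h s" and "s \<in> U"
    then obtain r where r: "0 < r" "ball s r \<subseteq> U"
      using U open_contains_ball by blast
    obtain a where a: "a \<in> \<rat>" "s - r < a" "a < s" using Rats_dense_in_real[of "s - r" s] r by auto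
    obtain b where b: "b \<in> \<rat>" "s < b" "b < s + r" using Rats_dense_in_real[of s "s + r"] r by auto
    have "{a..b} \<subseteq> ball s r" using a b by (auto simp: dist_real_def)
    with r a b have "(a, b) \<in> Q" by (auto simp: Q_def)
    with * a b show "g s = h s" by auto
  qed
qed

lemma integrable_tensor:
  fixes u v :: "real \<Rightarrow> complex"
  assumes u[measurable]: "integrable lborel u" and v[measurable]: "integrable lborel v"
  shows "integrable (lborel \<Otimes>\<^sub>M lborel) (\<lambda>(r, s). u r * v s)"
proof (rule lborel_pair.Fubini_integrable)
  show "integrable lborel (\<lambda>r. LINT s|lborel. norm (case (r, s) of (r, s) \<Rightarrow> u r * v s))"
    using u by (simp add: norm_mult)
  show "AE r in lborel. integrable lborel (\<lambda>s. case (r, s) of (r, s) \<Rightarrow> u r * v s)"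
    using v by simp
qed measurable

text \<open>Both sides are the integral of g r * h s over the triangle c <= r <= s <= d, taken in
  the two orders.\<close>

lemma integral_triangle_swap:
  fixes g h :: "real \<Rightarrow> complex"
  assumes g: "set_integrable lborel {c..d} g" and h: "set_integrable lborel {c..d} h"
  shows "(LINT s:{c..d}|lborel. (LINT r:{c..s}|lborel. g r) * h s) =
    (LINT r:{c..d}|lborel. g r * (LINT s:{r..d}|lborel. h s))"
proof -
  define u where "u r = indicator {c..d} r *\<^sub>R g r" for r
  define v where "v s = indicator {c..d} s *\<^sub>R h s" for s
  define H where "H r s = indicator {r. fst r \<le> snd r} (r, s) *\<^sub>R (u r * v s)" for r s
  have u: "integrable lborel u" and v: "integrable lborel v"
    using g h by (simp_all add: set_integrable_def u_def[abs_def] v_def[abs_def])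
  have "{r::real \<times> real. fst r \<le> snd r} \<in> sets (lborel \<Otimes>\<^sub>M lborel)"
    by (simp only: lborel_prod sets_lborel) (intro borel_closed closed_Collect_le continuous_intros)
  from integrable_mult_indicator[OF this integrable_tensor[OF u v]]
  have "integrable (lborel \<Otimes>\<^sub>M lborel) (case_prod H)"
    by (simp add: H_def[abs_def] case_prod_unfold)
  from lborel_pair.Fubini_integral[OF this]
  have "(LINT s|lborel. LINT r|lborel. H r s) = (LINT r|lborel. LINT s|lborel. H r s)" .
  moreover have "(LINT r|lborel. H r s) = indicator {c..d} s *\<^sub>R ((LINT r:{c..s}|lborel. g r) * h s)" for s
  proof -
    have "H r s = (indicator {c..s} r *\<^sub>R g r) * v s" for r
      by (auto simp: H_def u_def v_def indicator_def)
    then have "(LINT r|lborel. H r s) = (LINT r:{c..s}|lborel. g r) * v s"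
      by (simp only: set_lebesgue_integral_def integral_mult_left_zero)
    then show ?thesis by (simp add: v_def)
  qed
  moreover have "(LINT s|lborel. H r s) = indicator {c..d} r *\<^sub>R (g r * (LINT s:{r..d}|lborel. h s))" for r
  proof -
    have "H r s = u r * (indicator {r..d} s *\<^sub>R h s)" for s
      by (auto simp: H_def u_def v_def indicator_def)
    then have "(LINT s|lborel. H r s) = u r * (LINT s:{r..d}|lborel. h s)"
      by (simp only: set_lebesgue_integral_def integral_mult_right_zero)
    then show ?thesis by (simp add: u_def)
  qed
  ultimately show ?thesis
    by (simp add: set_lebesgue_integral_def)
qed

lemma test_function_support:
  assumes "test_function U \<phi>"
  obtains K where "compact K" "K \<subseteq> U" "\<And>s. s \<notin> K \<Longrightarrow> \<phi> s = 0" "\<And>s. s \<notin> K \<Longrightarrow> deriv \<phi> s = 0"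
proof
  define K where "K = closure {s. \<phi> s \<noteq> 0}"
  show "compact K" "K \<subseteq> U"
    using assms by (auto simp: test_function_def K_def)
  show zero: "\<phi> s = 0" if "s \<notin> K" for s
    using that closure_subset[of "{s. \<phi> s \<noteq> 0}"] by (auto simp: K_def)
  show "deriv \<phi> s = 0" if "s \<notin> K" for s
  proof (rule DERIV_imp_deriv)
    have "open (- K)" by (simp add: K_def open_Compl)
    moreover have "s \<in> - K" using that by simp
    moreover have "\<And>x. x \<in> - K \<Longrightarrow> 0 = \<phi> x" using zero by simp
    ultimately show "(\<phi> has_real_derivative 0) (at s)"
      by (rule has_field_derivative_transform_within_open[OF DERIV_const])
  qed
qed

text \<open>The converse of \<open>weak_deriv_FTC\<close> on [c, \<infinity>): with w written as a
  constant plus the integral of g, integration by parts against a test function is Fubini's theorem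
  on a triangle.\<close>

lemma FTC_has_weak_deriv:
  assumes g: "\<And>d. set_integrable lborel {c..d} g" and w: "continuous_on {c..} w"
    and FTC: "\<And>y. c \<le> y \<Longrightarrow> w y - w c = (LINT s:{c..y}|lborel. g s)"
  shows "has_weak_deriv {c<..} w g"
  unfolding has_weak_deriv_def
proof (intro conjI allI impI)
  show "locally_integrable {c<..} w"
    unfolding locally_integrable_def set_integrable_def
    using w by (auto intro!: borel_integrable_compact elim!: continuous_on_subset)
  show "locally_integrable {c<..} g"
    unfolding locally_integrable_def
  proof safe
    fix K assume K: "compact K" "K \<subseteq> {c<..}"
    then obtain d where "\<forall>s\<in>K. s \<le> d"
      using compact_imp_bounded bounded_real abs_le_D1 by metis
    with K have "K \<subseteq> {c..d}" by (auto simp: subset_iff less_imp_le)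
    with K show "set_integrable lborel K g"
      by (intro set_integrable_subset[OF g]) (auto intro: borel_compact)
  qed
next
  fix \<phi> assume \<phi>: "test_function {c<..} \<phi>"
  obtain K where K: "compact K" "K \<subseteq> {c<..}" "\<And>s. s \<notin> K \<Longrightarrow> \<phi> s = 0" "\<And>s. s \<notin> K \<Longrightarrow> deriv \<phi> s = 0"
    using test_function_support[OF \<phi>] by metis
  note sm = test_function_smooth[OF \<phi>]
  obtain d0 where d0: "\<forall>s\<in>K. s \<le> d0"
    using compact_imp_bounded[OF K(1)] bounded_real abs_le_D1 by metis
  \<comment> \<open>A right end strictly beyond the support of \<phi>; the maximum with c covers an
    empty support.\<close>
  define d where "d = max c d0 + 1"
  have d: "c \<le> d" "d \<notin> K" "c \<notin> K" "K \<subseteq> {c..d}"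
    using d0 K(2) by (auto simp: d_def subset_iff max_def)
  have int_deriv: "(LINT s:{r..d}|lborel. of_real (deriv \<phi> s)) = - complex_of_real (\<phi> r)" if "r \<in> {c..d}" for r
    using integral_deriv_smooth[OF sm, of r d] that K(3)[OF d(2)] by simp
  have cont: "continuous_on {c..d} (\<lambda>s. complex_of_real (deriv \<phi> s))"
    by (intro continuous_intros smooth_continuous_on[OF smooth_deriv[OF sm]])
  have int: "set_integrable lborel {c..d} (\<lambda>s. complex_of_real (deriv \<phi> s))"
    unfolding set_integrable_def by (intro borel_integrable_compact cont compact_Icc)
  have cw: "continuous_on {c..d} w"
    by (rule continuous_on_subset[OF w]) auto
  have int_w: "set_integrable lborel {c..d} (\<lambda>s. w s * of_real (deriv \<phi> s))"
    unfolding set_integrable_def by (intro borel_integrable_compact continuous_on_mult cw cont compact_Icc)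
  have "(LINT s:{c<..}|lborel. w s * of_real (deriv \<phi> s)) = (LINT s:{c..d}|lborel. w s * of_real (deriv \<phi> s))"
    unfolding set_lebesgue_integral_def
  proof (rule Bochner_Integration.integral_cong)
    show "indicator {c<..} s *\<^sub>R (w s * of_real (deriv \<phi> s)) = indicator {c..d} s *\<^sub>R (w s * of_real (deriv \<phi> s))" for s
      using K(2) K(4)[of s] d by (cases "s \<in> K") (auto simp: indicator_def)
  qed simp
  also have "\<dots> = (LINT s:{c..d}|lborel. w c * of_real (deriv \<phi> s)) +
      (LINT s:{c..d}|lborel. (w s - w c) * of_real (deriv \<phi> s))"
    by (subst set_integral_add(2)[symmetric])
      (use int set_integral_diff(1)[OF int_w set_integrable_mult_right[OF int, of "w c"]] in \<open>auto simp: algebra_simps\<close>)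
  \<comment> \<open>The constant contributes w c times \<phi> d - \<phi> c, and both values
    vanish.\<close>
  also have "(LINT s:{c..d}|lborel. w c * of_real (deriv \<phi> s)) = 0"
    using int_deriv[of c] K(3)[OF d(3)] d(1) by simp
  also have "(LINT s:{c..d}|lborel. (w s - w c) * of_real (deriv \<phi> s)) =
      (LINT s:{c..d}|lborel. (LINT r:{c..s}|lborel. g r) * of_real (deriv \<phi> s))"
    unfolding set_lebesgue_integral_def using FTC
    by (intro Bochner_Integration.integral_cong) (auto simp: indicator_def set_lebesgue_integral_def)
  also have "\<dots> = (LINT r:{c..d}|lborel. g r * (LINT s:{r..d}|lborel. of_real (deriv \<phi> s)))"
    by (rule integral_triangle_swap[OF g int])
  also have "\<dots> = (LINT r:{c..d}|lborel. - (g r * of_real (\<phi> r)))"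
    by (rule set_lebesgue_integral_cong) (auto simp: int_deriv)
  also have "\<dots> = - (LINT r:{c<..}|lborel. g r * of_real (\<phi> r))"
    unfolding set_lebesgue_integral_def Bochner_Integration.integral_minus[symmetric]
  proof (rule Bochner_Integration.integral_cong)
    show "indicator {c..d} s *\<^sub>R - (g s * of_real (\<phi> s)) = - (indicator {c<..} s *\<^sub>R (g s * of_real (\<phi> s)))" for s
      using K(2) K(3)[of s] d by (cases "s \<in> K") (auto simp: indicator_def)
  qed simp
  finally show "(LINT s:{c<..}|lborel. w s * of_real (deriv \<phi> s)) = - (LINT s:{c<..}|lborel. g s * of_real (\<phi> s))"
    by simp
qed

text \<open>The defect D between w and the integral of g is continuous, and locally constant off P;
  a continuous function whose derivative is 0 off a finite set is constant. This carries the formula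
  across the vertices of the tree.\<close>

lemma FTC_piecewise:
  fixes g w :: "real \<Rightarrow> complex"
  assumes g: "\<And>d. set_integrable lborel {c..d} g" and w: "continuous_on {c..} w" and P: "finite P"
    and FTC: "\<And>x y. c \<le> x \<Longrightarrow> x \<le> y \<Longrightarrow> {x..y} \<inter> P = {} \<Longrightarrow> w y - w x = (LINT s:{x..y}|lborel. g s)"
    and y: "c \<le> y"
  shows "w y - w c = (LINT s:{c..y}|lborel. g s)"
proof -
  have g': "set_integrable lborel {x..z} g" if "c \<le> x" for x z
    using that by (intro set_integrable_subset[OF g[of z]]) auto
  \<comment> \<open>For the gauge integral, continuity and additivity in the upper limit are
    directly at hand.\<close>
  have HK: "(LINT s:{x..z}|lborel. g s) = integral {x..z} g" "g integrable_on {x..z}" if "c \<le> x" for x z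
    using set_borel_integral_eq_integral[OF g'[OF that]] by auto
  define D where "D x = w x - integral {c..x} g" for x
  have "D y = D c"
  proof (rule has_derivative_zero_unique_strong_interval[of "insert c P"])
    show "finite (insert c P)" using P by simp
    show "continuous_on {c..y} D"
      unfolding D_def by (intro continuous_intros indefinite_integral_continuous_1 HK continuous_on_subset[OF w]) auto
    show "(D has_derivative (\<lambda>h. 0)) (at x within {c..y})" if x: "x \<in> {c..y} - insert c P" for x
    proof -
      have "open (- insert c P)" using P by (intro open_Compl finite_imp_closed) auto
      then have "open ({c<..} \<inter> - insert c P)" by (intro open_Int open_greaterThan)
      moreover have "x \<in> {c<..} \<inter> - insert c P" using x by auto
      ultimately obtain r where r: "0 < r" "ball x r \<subseteq> {c<..} \<inter> - insert c P"
        using open_contains_ball by blast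
      have const: "D z = D x" if z: "z \<in> ball x r" for z
      proof -
        have *: "D b = D a" if "a \<le> b" "{a..b} \<subseteq> ball x r" for a b
        proof -
          have "c \<le> a" "{a..b} \<inter> P = {}" using that r by force+
          moreover have "integral {c..a} g + integral {a..b} g = integral {c..b} g"
            using \<open>c \<le> a\<close> \<open>a \<le> b\<close> by (intro Henstock_Kurzweil_Integration.integral_combine HK) auto
          ultimately show ?thesis
            using FTC[of a b] HK[of a b] that by (simp add: D_def algebra_simps)
        qed
        show ?thesis
          using *[of x z] *[of z x] z r(1) by (cases "x \<le> z") (auto simp: dist_real_def subset_iff)
      qed
      have "(D has_derivative (\<lambda>h. 0)) (at x)"
      proof (rule has_derivative_transform_within_open[OF has_derivative_const])
        show "open (ball x r)" "x \<in> ball x r" using r by auto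
        show "D x = D z" if "z \<in> ball x r" for z using const[OF that] by simp
      qed
      then show ?thesis by (rule has_derivative_at_withinI)
    qed
  qed (use y in auto)
  then show ?thesis
    using HK[of c y] by (simp add: D_def diff_eq_eq add.commute)
qed

section \<open>Changes on finite sets, and measurability of locally integrable functions\<close>

lemma set_integrable_cong_finite:
  fixes f f' :: "real \<Rightarrow> complex"
  assumes "set_integrable lborel A f" "finite P" "\<And>s. s \<in> A - P \<Longrightarrow> f s = f' s"
  shows "set_integrable lborel A f'"
proof -
  have "integrable lborel (\<lambda>s. indicator A s *\<^sub>R f s) \<longleftrightarrow> integrable lborel (\<lambda>s. indicator A s *\<^sub>R f' s)"
    using assms by (intro integrable_discrete_difference[of P]) (auto simp: indicator_def countable_finite)
  then show ?thesis using assms(1) by (simp add: set_integrable_def)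
qed

lemma set_integral_cong_finite:
  fixes f f' :: "real \<Rightarrow> complex"
  assumes "finite P" "\<And>s. s \<in> A - P \<Longrightarrow> f s = f' s"
  shows "(LINT s:A|lborel. f s) = (LINT s:A|lborel. f' s)"
  unfolding set_lebesgue_integral_def
  using assms by (intro integral_discrete_difference[of P]) (auto simp: indicator_def countable_finite)

text \<open>Components and Haar coefficients are compared only off the levels, a finite set; this
  transports weak derivatives from one to the other.\<close>

lemma has_weak_deriv_cong_finite:
  assumes "has_weak_deriv U f g" and P: "finite P"
    and f: "\<And>s. s \<in> U - P \<Longrightarrow> f s = f' s" and g: "\<And>s. s \<in> U - P \<Longrightarrow> g s = g' s"
  shows "has_weak_deriv U f' g'"
  unfolding has_weak_deriv_def
proof (intro conjI allI impI)
  show "locally_integrable U f'" "locally_integrable U g'"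
    unfolding locally_integrable_def
    by (auto intro!: set_integrable_cong_finite[OF locally_integrableD[OF has_weak_derivD(1)[OF assms(1)]] P f]
        set_integrable_cong_finite[OF locally_integrableD[OF has_weak_derivD(2)[OF assms(1)]] P g])
  fix \<phi> assume "test_function U \<phi>"
  from has_weak_derivD(3)[OF assms(1) this]
  show "(LINT s:U|lborel. f' s * of_real (deriv \<phi> s)) = - (LINT s:U|lborel. g' s * of_real (\<phi> s))"
    using set_integral_cong_finite[OF P, of U "\<lambda>s. f s * of_real (deriv \<phi> s)" "\<lambda>s. f' s * of_real (deriv \<phi> s)"]
      set_integral_cong_finite[OF P, of U "\<lambda>s. g s * of_real (\<phi> s)" "\<lambda>s. g' s * of_real (\<phi> s)"] f g
    by simp
qed

text \<open>Local integrability speaks of compact sets only, but U is an increasing union of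
  countably many of these. This is how a function picked by \<open>weak_deriv\<close> is seen to be
  measurable.\<close>

lemma locally_integrable_measurable:
  assumes "locally_integrable U f" "open U"
  shows "(\<lambda>s. indicator U s *\<^sub>R f s) \<in> borel_measurable borel"
proof -
  obtain K where K: "\<And>n::nat. compact (K n)" "\<And>n. K n \<subseteq> U" "\<And>n. K n \<subseteq> interior (K (Suc n))"
      "\<Union> (range K) = U"
    using open_Union_compact_subsets[OF assms(2)] by metis
  have K_Suc: "K n \<subseteq> K (Suc n)" for n
    using K(3)[of n] interior_subset by blast
  have "(\<lambda>s. indicator (K n) s *\<^sub>R f s) \<in> borel_measurable borel" for n
    using locally_integrableD[OF assms(1) K(1,2)] by (auto simp: set_integrable_def dest: borel_measurable_integrable)
  moreover have "(\<lambda>n. indicator (K n) s *\<^sub>R f s) \<longlonglongrightarrow> indicator U s *\<^sub>R f s" for s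
  proof (cases "s \<in> U")
    case True
    then obtain m where "s \<in> K m" using K(4) by blast
    have "s \<in> K n" if "m \<le> n" for n
      using that \<open>s \<in> K m\<close> by (induction rule: dec_induct) (use K_Suc in auto)
    then have "\<forall>\<^sub>F n in sequentially. indicator (K n) s *\<^sub>R f s = indicator U s *\<^sub>R f s"
      using True by (auto intro!: eventually_sequentiallyI[of m])
    then show ?thesis by (rule tendsto_eventually)
  next
    case False
    then have "s \<notin> K n" for n using K(2) by auto
    then show ?thesis using False by simp
  qed
  ultimately show ?thesis
    by (rule borel_measurable_LIMSEQ_metric)
qed

section \<open>Walks and half-lines in a regular tree\<close>

locale regular_metric_tree =
  fixes T :: "('a, 'b) metric_tree" and N :: nat and t :: "nat \<Rightarrow> real" and b :: "nat \<Rightarrow> nat"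
  assumes regular: "regular_tree T N t b"
begin

abbreviation G where "G \<equiv> skel T"
abbreviation V where "V k \<equiv> generation T t k"

definition level_edges :: "nat \<Rightarrow> 'b set" where
  "level_edges k = {e \<in> edges T. tail G e \<in> V k}"

text \<open>Meant for half-lines too, which are not arcs of the skeleton: hence a root walk with one
  edge appended instead of a walk in \<open>G\<close>.\<close>

definition edge_walk :: "'b \<Rightarrow> 'b list" where
  "edge_walk e = root_walk T (tail G e) @ [e]"

text \<open>The edge of generation k on the way to the half-line \<rho>: up to N, list positions are
  generations.\<close>

definition anc :: "'b \<Rightarrow> nat \<Rightarrow> 'b" where
  "anc \<rho> k = edge_walk \<rho> ! k"

lemma rooted: "rooted_metric_tree T"
  using regular by (simp add: regular_tree_def)

lemma fin_digraph: "fin_digraph G"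
  using rooted by (simp add: rooted_metric_tree_def)

sublocale fin_digraph G by (rule fin_digraph)

lemma origin_in: "origin T \<in> verts G"
  and unique_walk: "v \<in> verts G \<Longrightarrow> \<exists>!p. awalk (origin T) p v"
  and edge_len_pos: "e \<in> arcs G \<Longrightarrow> 0 < edge_len T e"
  and rays_disjoint: "rays T \<inter> arcs G = {}"
  and ray_tail_leaf: "e \<in> rays T \<Longrightarrow> tail G e \<in> leaves T"
  and leaf_rays: "v \<in> leaves T \<Longrightarrow> finite {e \<in> rays T. tail G e = v}"
    "v \<in> leaves T \<Longrightarrow> {e \<in> rays T. tail G e = v} \<noteq> {}"
  using rooted by (auto simp: rooted_metric_tree_def)

lemma t_0: "t 0 = 0"
  and t_Suc: "k < N \<Longrightarrow> t k < t (Suc k)"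
  and b_pos: "k \<le> N \<Longrightarrow> 0 < b k"
  and verts_eq: "verts G = (\<Union>k\<le>N. V k)"
  and head_generation: "e \<in> arcs G \<Longrightarrow> k \<le> N \<Longrightarrow> tail G e \<in> V k \<Longrightarrow> head G e \<in> V (Suc k)"
  and card_out: "k \<le> N \<Longrightarrow> v \<in> V k \<Longrightarrow> card (out_edges T v) = b k"
  and V_N: "V N = leaves T"
  using regular unfolding regular_tree_def by blast+

lemma leaves_verts: "leaves T \<subseteq> verts G"
  by (auto simp: leaves_def)

lemma t_mono: "k < m \<Longrightarrow> m \<le> N \<Longrightarrow> t k < t m"
proof (induction m)
  case (Suc m)
  then show ?case using t_Suc[of m] by (cases "k = m") auto
qed simp

lemma t_le: "k \<le> m \<Longrightarrow> m \<le> N \<Longrightarrow> t k \<le> t m"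
  using t_mono[of k m] by (cases "k = m") auto

lemma t_nonneg: "k \<le> N \<Longrightarrow> 0 \<le> t k"
  using t_le[of 0 k] by (simp add: t_0)

lemma V_verts: "v \<in> V k \<Longrightarrow> v \<in> verts G"
  and vertex_dist_V: "v \<in> V k \<Longrightarrow> vertex_dist T v = t k"
  by (auto simp: generation_def)

lemma V_disjoint: "v \<in> V k \<Longrightarrow> v \<in> V m \<Longrightarrow> k \<le> N \<Longrightarrow> m \<le> N \<Longrightarrow> k = m"
  using t_mono[of k m] t_mono[of m k] by (auto simp: generation_def) (metis linorder_neqE_nat less_irrefl)

lemma finite_V: "finite (V k)"
  by (rule finite_subset[OF _ finite_verts]) (auto simp: generation_def)

lemma root_walk_unique: "awalk (origin T) p v \<Longrightarrow> root_walk T v = p"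
  unfolding root_walk_def using unique_walk[of v] awalk_last_in_verts[of _ p v]
  by (metis the1_equality)

lemma root_walk: "v \<in> verts G \<Longrightarrow> awalk (origin T) (root_walk T v) v"
  using unique_walk root_walk_unique by blast

lemma root_walk_inj: "u \<in> verts G \<Longrightarrow> v \<in> verts G \<Longrightarrow> root_walk T u = root_walk T v \<Longrightarrow> u = v"
  by (metis awalk_conv root_walk)

lemma root_walk_origin: "root_walk T (origin T) = []"
  by (rule root_walk_unique) (simp add: awalk_Nil_iff origin_in)

lemma origin_V0: "origin T \<in> V 0"
  by (simp add: generation_def origin_in vertex_dist_def root_walk_origin t_0)

lemma root_walk_head: "e \<in> arcs G \<Longrightarrow> root_walk T (head G e) = edge_walk e"
  unfolding edge_walk_def
  by (intro root_walk_unique awalk_appendI[OF root_walk arc_implies_awalk]) auto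

lemma vertex_dist_head: "e \<in> arcs G \<Longrightarrow> vertex_dist T (head G e) = vertex_dist T (tail G e) + edge_len T e"
  by (simp add: vertex_dist_def root_walk_head edge_walk_def)

text \<open>The root walk to the head of an arc ends with that arc.\<close>

lemma head_inj: "e \<in> arcs G \<Longrightarrow> e' \<in> arcs G \<Longrightarrow> head G e = head G e' \<Longrightarrow> e = e'"
  by (metis root_walk_head edge_walk_def append1_eq_conv)

lemma head_neq_origin: "e \<in> arcs G \<Longrightarrow> head G e \<noteq> origin T"
  using root_walk_head[of e] root_walk_origin by (auto simp: edge_walk_def)

lemma root_walk_last:
  assumes "v \<in> verts G" "v \<noteq> origin T"
  obtains e where "e \<in> arcs G" "head G e = v"
proof -
  have w: "awalk (origin T) (root_walk T v) v" using root_walk assms by blast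
  then have "root_walk T v \<noteq> []" using assms by (auto simp: awalk_Nil_iff)
  then obtain p e where "root_walk T v = p @ [e]" by (metis rev_exhaust)
  with w have "e \<in> arcs G" "head G e = v" by (auto simp: awalk_simps)
  then show ?thesis using that by blast
qed

text \<open>No arc starts in the last generation: its vertices are leaves, whose only incidence is
  used up by the arc entering them. So every tail has a generation below N, and lengths are
  differences of consecutive levels.\<close>

lemma arc_tail_generation:
  assumes "e \<in> arcs G"
  obtains k where "k < N" "tail G e \<in> V k" "head G e \<in> V (Suc k)" "edge_len T e = t (Suc k) - t k"
proof -
  have "tail G e \<in> verts G" using assms by simp
  then obtain k where k: "k \<le> N" "tail G e \<in> V k" using verts_eq by blast
  have "k \<noteq> N"
  proof
    assume "k = N"
    then have leaf: "tail G e \<in> leaves T" using k V_N by simp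
    then have "tail G e \<noteq> origin T" "in_degree G (tail G e) + out_degree G (tail G e) = 1"
      by (auto simp: leaves_def)
    moreover obtain e' where "e' \<in> arcs G" "head G e' = tail G e"
      using root_walk_last[of "tail G e"] leaf leaves_verts \<open>tail G e \<noteq> origin T\<close> by blast
    then have "e' \<in> in_arcs G (tail G e)" "e \<in> out_arcs G (tail G e)"
      using assms by auto
    then have "0 < in_degree G (tail G e)" "0 < out_degree G (tail G e)"
      unfolding in_degree_def out_degree_def by (auto simp: card_gt_0_iff)
    ultimately show False by simp
  qed
  with k have "k < N" by simp
  moreover have "head G e \<in> V (Suc k)" using head_generation assms k by blast
  moreover from this have "edge_len T e = t (Suc k) - t k"
    using vertex_dist_head[OF assms] vertex_dist_V k by (metis add_diff_cancel_left')
  ultimately show ?thesis using that k by blast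
qed

lemma ray_tail: "e \<in> rays T \<Longrightarrow> tail G e \<in> V N"
  using ray_tail_leaf V_N by simp

lemma edges_cases:
  assumes "e \<in> edges T"
  obtains "e \<in> rays T" "e \<notin> arcs G" | "e \<in> arcs G" "e \<notin> rays T"
  using assms rays_disjoint by (auto simp: edges_def)

lemma tail_verts: "e \<in> edges T \<Longrightarrow> tail G e \<in> verts G"
  by (auto simp: edges_def dest!: ray_tail_leaf intro: subsetD[OF leaves_verts])

lemma edge_level:
  assumes "e \<in> edges T"
  obtains k where "k \<le> N" "e \<in> level_edges k"
  using tail_verts[OF assms] verts_eq assms by (auto simp: level_edges_def)

lemma level_edges_edges: "e \<in> level_edges k \<Longrightarrow> e \<in> edges T"
  by (simp add: level_edges_def)

lemma level_edges_unique: "e \<in> level_edges k \<Longrightarrow> e \<in> level_edges m \<Longrightarrow> k \<le> N \<Longrightarrow> m \<le> N \<Longrightarrow> k = m"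
  by (auto simp: level_edges_def intro: V_disjoint)

lemma level_edges_N: "level_edges N = rays T"
proof -
  have "e \<in> rays T" if "e \<in> edges T" "tail G e \<in> V N" for e
    using that(1)
  proof (cases rule: edges_cases)
    case 2
    then obtain k where "k < N" "tail G e \<in> V k" using arc_tail_generation by metis
    then show ?thesis using V_disjoint[of _ k N] that by auto
  qed
  then show ?thesis by (auto simp: level_edges_def edges_def ray_tail)
qed

lemma level_edges_arc:
  assumes "e \<in> level_edges k" "k < N"
  shows "e \<in> arcs G" "e \<notin> rays T" "edge_len T e = t (Suc k) - t k" "head G e \<in> V (Suc k)"
proof -
  have e: "e \<in> edges T" "tail G e \<in> V k" using assms(1) by (auto simp: level_edges_def)
  show nr: "e \<notin> rays T"
  proof
    assume "e \<in> rays T"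
    then show False using V_disjoint[OF e(2) ray_tail] assms(2) by auto
  qed
  then show a: "e \<in> arcs G" using e by (auto simp: edges_def)
  then obtain m where m: "m < N" "tail G e \<in> V m" "head G e \<in> V (Suc m)" "edge_len T e = t (Suc m) - t m"
    using arc_tail_generation by metis
  then have "m = k" using V_disjoint[OF m(2) e(2)] assms(2) by simp
  with m show "edge_len T e = t (Suc k) - t k" "head G e \<in> V (Suc k)" by auto
qed

lemma out_edges_level: "k \<le> N \<Longrightarrow> v \<in> V k \<Longrightarrow> out_edges T v = {e \<in> level_edges k. tail G e = v}"
  by (auto simp: out_edges_def level_edges_def)

lemma finite_rays: "finite (rays T)"
proof -
  have "finite (\<Union>v\<in>leaves T. {e \<in> rays T. tail G e = v})"
    using leaf_rays(1) finite_subset[OF leaves_verts] by auto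
  moreover have "rays T \<subseteq> (\<Union>v\<in>leaves T. {e \<in> rays T. tail G e = v})"
    using ray_tail_leaf by auto
  ultimately show ?thesis by (rule rev_finite_subset)
qed

lemma finite_edges: "finite (edges T)"
  by (simp add: edges_def finite_rays)

lemma finite_level_edges: "finite (level_edges k)"
  by (rule finite_subset[OF _ finite_edges]) (auto simp: level_edges_def)

lemma edges_eq_Union: "edges T = (\<Union>k\<le>N. level_edges k)"
  using edge_level by (auto simp: level_edges_edges)

text \<open>Three facts proved in one induction: the walk of e is the walk of the arc e' entering
  its tail, followed by e, and e' lies one generation closer to the root.\<close>

lemma edge_walk_prefix:
  assumes "e \<in> level_edges m" "m \<le> N" "k \<le> m"
  shows "length (edge_walk e) = Suc m \<and> edge_walk e ! k \<in> level_edges k \<and>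
    edge_walk (edge_walk e ! k) = take (Suc k) (edge_walk e)"
  using assms
proof (induction m arbitrary: e k)
  case 0
  have "tail G e = origin T"
  proof (rule ccontr)
    assume "tail G e \<noteq> origin T"
    moreover have "tail G e \<in> verts G" using 0 tail_verts level_edges_edges by blast
    ultimately obtain e' where e': "e' \<in> arcs G" "head G e' = tail G e" using root_walk_last by metis
    then obtain m where "m < N" "head G e' \<in> V (Suc m)" using arc_tail_generation by metis
    then show False using V_disjoint[of "tail G e" 0 "Suc m"] 0 e' by (auto simp: level_edges_def)
  qed
  then show ?case using 0 by (simp add: edge_walk_def root_walk_origin)
next
  case (Suc m)
  have e: "tail G e \<in> V (Suc m)" "e \<in> edges T" using Suc.prems by (auto simp: level_edges_def)
  have "tail G e \<noteq> origin T"
    using V_disjoint[OF e(1), of 0] origin_V0 Suc.prems by auto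
  then obtain e' where e': "e' \<in> arcs G" "head G e' = tail G e"
    using root_walk_last tail_verts[OF e(2)] by metis
  then obtain m' where m': "m' < N" "tail G e' \<in> V m'" "head G e' \<in> V (Suc m')"
    using arc_tail_generation by metis
  then have "m' = m" using V_disjoint[of "tail G e" "Suc m" "Suc m'"] e e' Suc.prems by auto
  then have "e' \<in> level_edges m" using e' m' by (simp add: level_edges_def edges_def)
  note IH = Suc.IH[OF this]
  have walk: "edge_walk e = edge_walk e' @ [e]"
    using root_walk_head[OF e'(1)] e'(2) by (simp add: edge_walk_def)
  have len: "length (edge_walk e') = Suc m" using IH[of m] Suc.prems by simp
  show ?case
  proof (cases "k = Suc m")
    case True
    then show ?thesis using walk len Suc.prems by (simp add: nth_append)
  next
    case False
    then have "k \<le> m" using Suc.prems by simp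
    then show ?thesis using IH[of k] walk len Suc.prems by (simp add: nth_append)
  qed
qed

lemma length_edge_walk: "e \<in> level_edges m \<Longrightarrow> m \<le> N \<Longrightarrow> length (edge_walk e) = Suc m"
  using edge_walk_prefix by blast

lemma nth_edge_walk: "e \<in> level_edges m \<Longrightarrow> m \<le> N \<Longrightarrow> k \<le> m \<Longrightarrow> edge_walk e ! k \<in> level_edges k"
  using edge_walk_prefix by blast

lemma edge_walk_nth: "e \<in> level_edges m \<Longrightarrow> m \<le> N \<Longrightarrow> k \<le> m \<Longrightarrow> edge_walk (edge_walk e ! k) = take (Suc k) (edge_walk e)"
  using edge_walk_prefix by blast

lemma anc_level: "\<rho> \<in> rays T \<Longrightarrow> k \<le> N \<Longrightarrow> anc \<rho> k \<in> level_edges k"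
  unfolding anc_def by (rule nth_edge_walk[of _ N]) (auto simp: level_edges_N)

lemma edge_walk_anc: "\<rho> \<in> rays T \<Longrightarrow> k \<le> N \<Longrightarrow> edge_walk (anc \<rho> k) = take (Suc k) (edge_walk \<rho>)"
  unfolding anc_def by (rule edge_walk_nth[of _ N]) (auto simp: level_edges_N)

lemma anc_N: "\<rho> \<in> rays T \<Longrightarrow> anc \<rho> N = \<rho>"
  using length_edge_walk[of \<rho> N] by (simp add: anc_def edge_walk_def nth_append level_edges_N)

text \<open>The edges of a walk have distinct generations, so the generation of e fixes its
  position. This turns membership in a subtree into a condition on \<open>anc\<close>.\<close>

lemma mem_edge_walk_anc:
  assumes "\<rho> \<in> rays T" "m \<le> N" "e \<in> level_edges k" "k \<le> N"
  shows "e \<in> set (edge_walk (anc \<rho> m)) \<longleftrightarrow> k \<le> m \<and> anc \<rho> k = e"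
proof -
  have len: "length (edge_walk \<rho>) = Suc N"
    using length_edge_walk[of \<rho> N] assms by (simp add: level_edges_N)
  have "e \<in> set (edge_walk (anc \<rho> m)) \<longleftrightarrow> (\<exists>i\<le>m. anc \<rho> i = e)"
    unfolding edge_walk_anc[OF assms(1,2)] in_set_conv_nth
    using len assms(2) by (auto simp: anc_def less_Suc_eq_le)
  also have "\<dots> \<longleftrightarrow> k \<le> m \<and> anc \<rho> k = e"
  proof
    assume "\<exists>i\<le>m. anc \<rho> i = e"
    then obtain i where i: "i \<le> m" "anc \<rho> i = e" by blast
    then have "i = k" using level_edges_unique[of e i k] anc_level[of \<rho> i] assms by auto
    with i show "k \<le> m \<and> anc \<rho> k = e" by simp
  qed blast
  finally show ?thesis .
qed

text \<open>Both vertices have the root walk \<open>take (Suc k) (edge_walk \<rho>)\<close>, and a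
  vertex is determined by its root walk.\<close>

lemma head_anc:
  assumes "\<rho> \<in> rays T" "k < N"
  shows "head G (anc \<rho> k) = tail G (anc \<rho> (Suc k))"
proof -
  have e: "anc \<rho> (Suc k) \<in> edges T" "anc \<rho> k \<in> arcs G"
    using anc_level[of \<rho> "Suc k"] level_edges_arc(1)[OF anc_level[of \<rho> k]] assms level_edges_edges by auto
  have len: "length (edge_walk \<rho>) = Suc N"
    using length_edge_walk[of \<rho> N] assms by (simp add: level_edges_N)
  have "root_walk T (tail G (anc \<rho> (Suc k))) @ [anc \<rho> (Suc k)] = take (Suc (Suc k)) (edge_walk \<rho>)"
    using edge_walk_anc[of \<rho> "Suc k"] assms by (simp add: edge_walk_def)
  also have "\<dots> = take (Suc k) (edge_walk \<rho>) @ [anc \<rho> (Suc k)]"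
    using len assms by (simp add: anc_def take_Suc_conv_app_nth)
  finally have "root_walk T (tail G (anc \<rho> (Suc k))) = root_walk T (head G (anc \<rho> k))"
    using edge_walk_anc[of \<rho> k] root_walk_head[OF e(2)] assms by simp
  then show ?thesis
    using root_walk_inj tail_verts[OF e(1)] e(2) by (metis head_in_verts)
qed

lemma tail_anc_0: "\<rho> \<in> rays T \<Longrightarrow> tail G (anc \<rho> 0) = origin T"
proof -
  assume r: "\<rho> \<in> rays T"
  have l: "anc \<rho> 0 \<in> level_edges 0" using anc_level[of \<rho> 0] r by simp
  then have "length (edge_walk (anc \<rho> 0)) = Suc 0" by (rule length_edge_walk) simp
  then have "root_walk T (tail G (anc \<rho> 0)) = []" by (simp add: edge_walk_def)
  then show ?thesis using root_walk[OF tail_verts[OF level_edges_edges[OF l]]] by (simp add: awalk_Nil_iff)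
qed

text \<open>A vertex other than the root has exactly one incoming arc. So sorting the half-lines by
  edges of generation k is the same as sorting them by vertices of generation k + 1, which makes the
  sum over generations telescope.\<close>

lemma tail_anc_eq_iff:
  assumes "\<rho> \<in> rays T" "\<sigma> \<in> rays T" "k < N"
  shows "tail G (anc \<rho> (Suc k)) = tail G (anc \<sigma> (Suc k)) \<longleftrightarrow> anc \<rho> k = anc \<sigma> k"
  using head_inj[of "anc \<rho> k" "anc \<sigma> k"] level_edges_arc(1)[OF anc_level[of _ k]] assms
  by (auto simp flip: head_anc)

section \<open>Counting the half-lines below an edge\<close>

definition rays_below :: "nat \<Rightarrow> 'b \<Rightarrow> 'b set" where
  "rays_below k e = {\<rho> \<in> rays T. anc \<rho> k = e}"

text \<open>The common number of half-lines below the edges of generation k, by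
  \<open>card_rays_below\<close>.\<close>

definition prod_above :: "nat \<Rightarrow> nat" where
  "prod_above k = (\<Prod>i\<in>{k<..N}. b i)"

lemma finite_rays_below: "finite (rays_below k e)"
  using finite_rays by (simp add: rays_below_def)

lemma rays_below_Suc:
  assumes "e \<in> level_edges k" "k < N"
  shows "rays_below k e = (\<Union>e'\<in>out_edges T (head G e). rays_below (Suc k) e')"
proof -
  have h: "head G e \<in> V (Suc k)" using level_edges_arc(4)[OF assms] .
  have "anc \<rho> k = e \<longleftrightarrow> anc \<rho> (Suc k) \<in> out_edges T (head G e)" if r: "\<rho> \<in> rays T" for \<rho>
  proof -
    have "anc \<rho> (Suc k) \<in> level_edges (Suc k)" using anc_level[of \<rho> "Suc k"] r assms by simp
    then have "anc \<rho> (Suc k) \<in> out_edges T (head G e) \<longleftrightarrow> head G (anc \<rho> k) = head G e"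
      using head_anc[OF r assms(2)] by (simp add: out_edges_def level_edges_def)
    also have "\<dots> \<longleftrightarrow> anc \<rho> k = e"
      using head_inj[of "anc \<rho> k" e] level_edges_arc(1)[OF assms] level_edges_arc(1)[OF anc_level[OF r, of k]] assms by auto
    finally show ?thesis by simp
  qed
  then show ?thesis by (auto simp: rays_below_def)
qed

text \<open>Downward induction on the generation: the half-lines below e are shared out among the b
  (Suc k) edges leaving its head, and each of these has the same number below it.\<close>

lemma card_rays_below:
  assumes "e \<in> level_edges k" "k \<le> N"
  shows "card (rays_below k e) = prod_above k"
  using assms(2,1)
proof (induction arbitrary: e rule: inc_induct)
  case base
  then have "rays_below N e = {e}"
    by (auto simp: rays_below_def anc_N level_edges_N)
  then show ?case by (simp add: prod_above_def)
next
  case (step k)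
  have h: "head G e \<in> V (Suc k)" using level_edges_arc(4)[OF step(4,2)] .
  have out: "e' \<in> level_edges (Suc k)" if "e' \<in> out_edges T (head G e)" for e'
    using that out_edges_level[OF _ h] step by auto
  have "card (rays_below k e) = (\<Sum>e'\<in>out_edges T (head G e). card (rays_below (Suc k) e'))"
    unfolding rays_below_Suc[OF step(4,2)]
    by (rule card_UN_disjoint) (auto simp: rays_below_def finite_rays out_edges_def finite_edges)
  also have "\<dots> = b (Suc k) * prod_above (Suc k)"
    using step.IH[OF out] card_out[OF _ h] step by simp
  also have "\<dots> = prod_above k"
  proof -
    have "{k<..N} = insert (Suc k) {Suc k<..N}" using step by auto
    then show ?thesis by (simp add: prod_above_def)
  qed
  finally show ?case .
qed

lemma prod_above_pos: "0 < prod_above k"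
  unfolding prod_above_def by (intro prod_pos) (auto intro: b_pos)

lemma rays_below_nonempty: "e \<in> level_edges k \<Longrightarrow> k \<le> N \<Longrightarrow> rays_below k e \<noteq> {}"
  using card_rays_below[of e k] prod_above_pos[of k] by (auto simp: card_gt_0_iff)

lemma card_rays_level: "k \<le> N \<Longrightarrow> card (rays T) = card (level_edges k) * prod_above k"
proof -
  assume k: "k \<le> N"
  have "rays T = (\<Union>e\<in>level_edges k. rays_below k e)"
    using anc_level k by (auto simp: rays_below_def)
  then have "card (rays T) = (\<Sum>e\<in>level_edges k. card (rays_below k e))"
    by (simp only:) (rule card_UN_disjoint, auto simp: rays_below_def finite_rays finite_level_edges)
  also have "\<dots> = card (level_edges k) * prod_above k"
    using card_rays_below k by simp
  finally show ?thesis .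
qed

lemma V_0: "V 0 = {origin T}"
proof -
  have "v = origin T" if v: "v \<in> V 0" for v
  proof (rule ccontr)
    assume "v \<noteq> origin T"
    then obtain e where e: "e \<in> arcs G" "head G e = v" using root_walk_last V_verts v by metis
    then obtain m where "m < N" "head G e \<in> V (Suc m)" using arc_tail_generation by metis
    then show False using V_disjoint[of v 0 "Suc m"] v e by auto
  qed
  then show ?thesis using origin_V0 by blast
qed

lemma card_rays: "card (rays T) = (\<Prod>i\<le>N. b i)"
proof -
  have "level_edges 0 = out_edges T (origin T)"
    by (auto simp: level_edges_def out_edges_def V_0)
  then have "card (rays T) = b 0 * prod_above 0"
    using card_rays_level[of 0] card_out[OF _ origin_V0] by simp
  moreover have "{..N} = insert 0 {0<..N}" by auto
  ultimately show ?thesis by (simp add: prod_above_def)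
qed

lemma prod_below_above: "k \<le> N \<Longrightarrow> (\<Prod>i\<le>k. b i) * prod_above k = card (rays T)"
proof -
  assume "k \<le> N"
  then have "{..N} = {..k} \<union> {k<..N}" by auto
  moreover have "prod b ({..k} \<union> {k<..N}) = prod b {..k} * prod b {k<..N}"
    by (rule prod.union_disjoint) auto
  ultimately show ?thesis unfolding card_rays prod_above_def by simp
qed

lemma card_rays_pos: "0 < card (rays T)"
  unfolding card_rays by (intro prod_pos) (auto intro: b_pos)

end

section \<open>Geodesics to infinity and spheres\<close>

text \<open>For passing from sums over half-lines to sums over the points or edges on them, each of
  which is hit equally often.\<close>

lemma sum_const_fibres:
  fixes f :: "'c \<Rightarrow> 'd :: comm_semiring_1"
  assumes "finite A" "\<And>x. x \<in> A \<Longrightarrow> card {y \<in> A. h y = h x} = c"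
  shows "(\<Sum>x\<in>A. f (h x)) = of_nat c * (\<Sum>y\<in>h ` A. f y)"
proof -
  have "(\<Sum>x\<in>A. f (h x)) = (\<Sum>y\<in>h ` A. \<Sum>x | x \<in> A \<and> h x = y. f (h x))"
    by (rule sum.image_gen[OF assms(1)])
  also have "\<dots> = (\<Sum>y\<in>h ` A. of_nat c * f y)"
    using assms(2) by (intro sum.cong) auto
  finally show ?thesis by (simp add: sum_distrib_left)
qed

context regular_metric_tree
begin

definition piece :: "nat \<Rightarrow> real set" where
  "piece m = (if m < N then {t m<..<t (Suc m)} else {t m<..})"

definition closed_piece :: "nat \<Rightarrow> real set" where
  "closed_piece m = (if m < N then {t m..t (Suc m)} else {t m..})"

text \<open>At s = t k the maximum is k, so there \<open>ray_point\<close> begins the next edge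
  instead of ending the previous one.\<close>

definition level :: "real \<Rightarrow> nat" where
  "level s = Max {m. m \<le> N \<and> t m \<le> s}"

definition ray_point :: "'b \<Rightarrow> real \<Rightarrow> ('a, 'b) point" where
  "ray_point \<rho> s = edge_point T (anc \<rho> (level s)) (s - t (level s))"

lemma level_eqI:
  assumes "m \<le> N" "t m \<le> s" "m < N \<Longrightarrow> s < t (Suc m)"
  shows "level s = m"
  unfolding level_def
proof (rule Max_eqI)
  show "k \<le> m" if "k \<in> {k. k \<le> N \<and> t k \<le> s}" for k
  proof (rule ccontr)
    assume "\<not> k \<le> m"
    then have "m < N" "t (Suc m) \<le> t k" using that t_le[of "Suc m" k] by auto
    then show False using assms that by auto
  qed
qed (use assms in auto)

lemma level_piece: "m \<le> N \<Longrightarrow> s \<in> piece m \<Longrightarrow> level s = m"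
  by (rule level_eqI) (auto simp: piece_def split: if_splits)

lemma piece_cases:
  assumes "0 \<le> s" "s \<notin> t ` {..N}"
  obtains m where "m \<le> N" "s \<in> piece m"
proof -
  have fin: "finite {m. m \<le> N \<and> t m \<le> s}" by simp
  have ne: "{m. m \<le> N \<and> t m \<le> s} \<noteq> {}" using assms(1) t_0 by (auto intro: exI[of _ 0])
  have m: "level s \<le> N" "t (level s) \<le> s" using Max_in[OF fin ne] by (auto simp: level_def)
  have "s < t (Suc (level s))" if "level s < N"
  proof (rule ccontr)
    assume "\<not> ?thesis"
    then have "Suc (level s) \<le> level s"
      using that Max_ge[OF fin, of "Suc (level s)"] by (simp add: level_def)
    then show False by simp
  qed
  moreover have "t (level s) \<noteq> s" using assms(2) m(1) by (metis atMost_iff image_eqI)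
  ultimately have "s \<in> piece (level s)" using m by (auto simp: piece_def)
  with m that show ?thesis by blast
qed

lemma piece_gt: "s \<in> piece m \<Longrightarrow> t m < s"
  by (auto simp: piece_def split: if_splits)

lemma piece_unique: "s \<in> piece k \<Longrightarrow> s \<in> piece m \<Longrightarrow> k \<le> N \<Longrightarrow> m \<le> N \<Longrightarrow> k = m"
  using level_piece by blast

lemma piece_less_iff: "s \<in> piece m \<Longrightarrow> m \<le> N \<Longrightarrow> k \<le> N \<Longrightarrow> t k < s \<longleftrightarrow> k \<le> m"
  using t_le[of k m] t_le[of "Suc m" k] by (cases "k \<le> m") (auto simp: piece_def split: if_splits)

lemma piece_not_level: "s \<in> piece m \<Longrightarrow> m \<le> N \<Longrightarrow> s \<notin> t ` {..N}"
proof
  assume s: "s \<in> piece m" "m \<le> N" "s \<in> t ` {..N}"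
  then obtain k where k: "k \<le> N" "s = t k" by auto
  then have "m < k" using piece_less_iff[OF s(1,2) k(1)] by simp
  then show False using s k t_le[of "Suc m" k] by (simp add: piece_def)
qed

text \<open>Arc length on an edge is the distance from the root minus t m. In terms of
  \<open>piece\<close>, arcs and half-lines are treated alike from here on.\<close>

lemma open_ivl_level:
  assumes "e \<in> level_edges m" "m \<le> N"
  shows "open_ivl T e = {r. t m + r \<in> piece m}" "closed_ivl T e = {r. t m + r \<in> closed_piece m}"
proof -
  have "open_ivl T e = {r. t m + r \<in> piece m} \<and> closed_ivl T e = {r. t m + r \<in> closed_piece m}"
  proof (cases "m < N")
    case True
    note level_edges_arc(2,3)[OF assms(1) True]
    with True show ?thesis
      by (auto simp: open_ivl_def closed_ivl_def piece_def closed_piece_def)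
  next
    case False
    then have "e \<in> rays T" using assms level_edges_N by (metis le_neq_implies_less)
    with False show ?thesis
      by (auto simp: open_ivl_def closed_ivl_def piece_def closed_piece_def)
  qed
  then show "open_ivl T e = {r. t m + r \<in> piece m}" "closed_ivl T e = {r. t m + r \<in> closed_piece m}"
    by blast+
qed

lemma edge_point_inner: "r \<in> open_ivl T e \<Longrightarrow> edge_point T e r = Inner e r"
  by (auto simp: open_ivl_def edge_point_def split: if_splits)

lemma open_subset_closed_ivl: "open_ivl T e \<subseteq> closed_ivl T e"
  by (auto simp: open_ivl_def closed_ivl_def)

lemma ray_point_inner: "\<rho> \<in> rays T \<Longrightarrow> m \<le> N \<Longrightarrow> s \<in> piece m \<Longrightarrow> ray_point \<rho> s = Inner (anc \<rho> m) (s - t m)"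
  unfolding ray_point_def level_piece
  by (rule edge_point_inner) (simp add: open_ivl_level[OF anc_level])

text \<open>At the right end t (Suc m) the function \<open>level\<close> has already jumped to the
  next edge, but by \<open>head_anc\<close> the vertex is the same. This is what makes f continuous
  along the half-line.\<close>

lemma ray_point_closed:
  assumes "\<rho> \<in> rays T" "m \<le> N" "s \<in> closed_piece m"
  shows "ray_point \<rho> s = edge_point T (anc \<rho> m) (s - t m)"
proof (cases "m < N \<and> s = t (Suc m)")
  case True
  note arc = level_edges_arc[OF anc_level[OF assms(1,2)]]
  have "level s = Suc m"
    using True t_Suc by (intro level_eqI) auto
  then have "ray_point \<rho> s = Vertex (tail G (anc \<rho> (Suc m)))"
    using True by (simp add: ray_point_def edge_point_def)
  also have "\<dots> = edge_point T (anc \<rho> m) (s - t m)"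
    using True arc head_anc[OF assms(1)] t_Suc[of m] by (simp add: edge_point_def)
  finally show ?thesis .
next
  case False
  then have "level s = m"
    using assms by (intro level_eqI) (auto simp: closed_piece_def split: if_splits)
  then show ?thesis by (simp add: ray_point_def)
qed

lemma ray_point_level:
  assumes "\<rho> \<in> rays T" "k \<le> N"
  shows "ray_point \<rho> (t k) = Vertex (tail G (anc \<rho> k))"
proof -
  have "t k \<in> closed_piece k" using assms t_Suc[of k] by (auto simp: closed_piece_def)
  then show ?thesis using ray_point_closed[OF assms] by (simp add: edge_point_def)
qed

section \<open>Spheres and subtrees described by half-lines\<close>

lemma Inner_points: "Inner e r \<in> points T \<longleftrightarrow> e \<in> edges T \<and> r \<in> open_ivl T e"
proof
  assume "Inner e r \<in> points T"
  then obtain e' r' where *: "e' \<in> edges T" "r' \<in> closed_ivl T e'" "Inner e r = edge_point T e' r'"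
    by (auto simp: points_def edge_points_def)
  then have "e' = e" "r' = r" by (auto simp: edge_point_def split: if_splits)
  with * show "e \<in> edges T \<and> r \<in> open_ivl T e"
    by (auto simp: edge_point_def closed_ivl_def open_ivl_def split: if_splits)
next
  assume *: "e \<in> edges T \<and> r \<in> open_ivl T e"
  then have "edge_point T e r = Inner e r" "r \<in> closed_ivl T e"
    using edge_point_inner open_subset_closed_ivl by auto
  then show "Inner e r \<in> points T"
    using * unfolding points_def edge_points_def by (metis UN_I UnI2 image_eqI)
qed

lemma edge_point_points: "e \<in> edges T \<Longrightarrow> r \<in> closed_ivl T e \<Longrightarrow> edge_point T e r \<in> points T"
  by (auto simp: points_def edge_points_def)

lemma Vertex_points:
  assumes "Vertex v \<in> points T"
  shows "v \<in> verts G"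
proof (cases "Vertex v \<in> Vertex ` verts G")
  case False
  then obtain e r where e: "e \<in> edges T" "Vertex v = edge_point T e r"
    using assms unfolding points_def edge_points_def by blast
  then have "v = tail G e \<or> e \<notin> rays T \<and> v = head G e"
    by (auto simp: edge_point_def split: if_splits)
  then show ?thesis
    using tail_verts[OF e(1)] e(1) by (auto simp: edges_def)
qed auto

lemma root_dist_Inner: "e \<in> level_edges m \<Longrightarrow> root_dist T (Inner e r) = t m + r"
  by (simp add: level_edges_def vertex_dist_V)

text \<open>Vertices occur at levels only, and a radius off the levels belongs to one piece, which
  gives the generation of the edge.\<close>

lemma points_at:
  assumes "m \<le> N" "s \<in> piece m"
  shows "{x \<in> points T. root_dist T x = s} = (\<lambda>e. Inner e (s - t m)) ` level_edges m"
proof safe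
  fix x assume x: "x \<in> points T" "s = root_dist T x"
  show "x \<in> (\<lambda>e. Inner e (root_dist T x - t m)) ` level_edges m"
  proof (cases x)
    case (Vertex v)
    then have "v \<in> verts G" using Vertex_points x by blast
    then have "s \<in> t ` {..N}" using x Vertex verts_eq by (auto simp: vertex_dist_V)
    then show ?thesis using piece_not_level assms by blast
  next
    case (Inner e r)
    then have e: "e \<in> edges T" "r \<in> open_ivl T e" using x Inner_points by auto
    then obtain k where k: "k \<le> N" "e \<in> level_edges k" using edge_level by metis
    then have "s = t k + r" using x Inner root_dist_Inner by simp
    then have "s \<in> piece k" using e open_ivl_level[OF k(2,1)] by simp
    then have "k = m" using piece_unique assms k by blast
    then show ?thesis using Inner k x \<open>s = t k + r\<close> by auto
  qed
next
  fix e assume e: "e \<in> level_edges m"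
  then show "root_dist T (Inner e (s - t m)) = s" using root_dist_Inner[OF e] by simp
  show "Inner e (s - t m) \<in> points T"
    using e assms open_ivl_level[OF e] level_edges_edges by (auto simp: Inner_points)
qed

lemma anc_image: "k \<le> N \<Longrightarrow> (\<lambda>\<rho>. anc \<rho> k) ` rays T = level_edges k"
  using anc_level rays_below_nonempty by (fastforce simp: rays_below_def)

lemma sphere_points:
  assumes "m \<le> N" "s \<in> piece m"
  shows "sphere_of T (points T) s = (\<lambda>\<rho>. ray_point \<rho> s) ` rays T"
proof -
  have "(\<lambda>\<rho>. ray_point \<rho> s) ` rays T = (\<lambda>e. Inner e (s - t m)) ` (\<lambda>\<rho>. anc \<rho> m) ` rays T"
    using ray_point_inner[OF _ assms] by (auto simp: image_image)
  then show ?thesis unfolding sphere_of_def using points_at[OF assms] anc_image assms by simp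
qed

lemma branching_points:
  assumes "m \<le> N" "s \<in> piece m"
  shows "branching_fn T (points T) s = card (level_edges m)"
  unfolding branching_fn_def sphere_of_def points_at[OF assms]
  by (rule card_image) (auto simp: inj_on_def)

lemma Vertex_edge_points:
  assumes "a \<in> arcs G" "Vertex v \<in> edge_points T a"
  shows "v = tail G a \<or> v = head G a"
  using assms by (auto simp: edge_points_def edge_point_def split: if_splits)

text \<open>A vertex on the path is an end of some arc a of the walk. If the head of e is the tail
  of a, then the part of the walk before a is the root walk to the head of e, and that ends with
  e.\<close>

lemma head_mem_vertex_path:
  assumes e: "e \<in> arcs G" and v: "v \<in> verts G"
  shows "Vertex (head G e) \<in> vertex_path T v \<longleftrightarrow> e \<in> set (root_walk T v)"
proof
  assume "e \<in> set (root_walk T v)"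
  moreover have "Vertex (head G e) \<in> edge_points T e"
    using e edge_len_pos[OF e] rays_disjoint unfolding edge_points_def
    by (intro image_eqI[of _ _ "edge_len T e"]) (auto simp: edge_point_def closed_ivl_def)
  ultimately show "Vertex (head G e) \<in> vertex_path T v"
    by (auto simp: vertex_path_def)
next
  assume "Vertex (head G e) \<in> vertex_path T v"
  then obtain a where a: "a \<in> set (root_walk T v)" "Vertex (head G e) \<in> edge_points T a"
    using head_neq_origin[OF e] by (auto simp: vertex_path_def)
  have w: "awalk (origin T) (root_walk T v) v" using root_walk[OF v] .
  then have arc: "a \<in> arcs G" using a by (auto simp: awalk_def)
  from Vertex_edge_points[OF arc a(2)] show "e \<in> set (root_walk T v)"
  proof
    assume h: "head G e = tail G a"
    from a(1) obtain p q where pq: "root_walk T v = p @ a # q" by (meson split_list)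
    have "awalk (origin T) p (tail G a)"
      using w unfolding pq by (auto simp: awalk_def)
    then have "root_walk T (tail G a) = p" by (rule root_walk_unique)
    then have "edge_walk e = p" using root_walk_head[OF e] h by simp
    then show ?thesis by (auto simp: pq edge_walk_def)
  next
    assume "head G e = head G a"
    then show ?thesis using head_inj[OF e arc] a by simp
  qed
qed

text \<open>Among the points of e' up to r only its tail is a vertex, so \<open>precedes\<close>
  reduces to the vertex path of that tail and to \<open>head_mem_vertex_path\<close>. The last entry
  of \<open>edge_walk e'\<close> accounts for the case e = e'.\<close>

lemma Inner_subtree:
  assumes e: "e \<in> edges T" and e': "e' \<in> edges T" and r: "r \<in> open_ivl T e'"
  shows "Inner e' r \<in> subtree T e \<longleftrightarrow> e \<in> set (edge_walk e')"
proof -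
  have ep: "Inner e' r \<in> edge_points T e \<longleftrightarrow> e' = e"
  proof
    assume "Inner e' r \<in> edge_points T e"
    then show "e' = e" by (auto simp: edge_points_def edge_point_def split: if_splits)
  next
    assume "e' = e"
    then show "Inner e' r \<in> edge_points T e"
      using r edge_point_inner[OF r] open_subset_closed_ivl unfolding edge_points_def by (metis image_eqI subsetD)
  qed
  have w: "awalk (origin T) (root_walk T (tail G e')) (tail G e')"
    using root_walk tail_verts[OF e'] .
  show ?thesis
    using e
  proof (cases rule: edges_cases)
    case 1
    then have "e \<notin> set (root_walk T (tail G e'))" using w by (auto simp: awalk_def)
    then show ?thesis using 1 ep by (auto simp: subtree_def edge_walk_def)
  next
    case 2
    have "Vertex (head G e) \<in> edge_point T e' ` {0..r} \<longleftrightarrow> head G e = tail G e'"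
    proof
      assume "Vertex (head G e) \<in> edge_point T e' ` {0..r}"
      then show "head G e = tail G e'"
        using r by (auto simp: edge_point_def open_ivl_def split: if_splits)
    next
      assume "head G e = tail G e'"
      then show "Vertex (head G e) \<in> edge_point T e' ` {0..r}"
        using r by (intro image_eqI[of _ _ 0]) (auto simp: edge_point_def open_ivl_def split: if_splits)
    qed
    moreover have "e \<in> set (root_walk T (tail G e'))" if "head G e = tail G e'"
      using root_walk_head[OF 2(1)] that by (metis edge_walk_def in_set_conv_decomp)
    ultimately have "precedes T (Vertex (head G e)) (Inner e' r) \<longleftrightarrow> e \<in> set (root_walk T (tail G e'))"
      using head_mem_vertex_path[OF 2(1) tail_verts[OF e']] by (auto simp: precedes_def)
    moreover have "Inner e' r \<in> points T" using e' r by (simp add: Inner_points)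
    ultimately show ?thesis
      using 2 ep by (auto simp: subtree_def edge_walk_def)
  qed
qed

lemma ray_point_subtree:
  assumes "\<rho> \<in> rays T" "m \<le> N" "s \<in> piece m" "e \<in> level_edges k" "k \<le> N"
  shows "ray_point \<rho> s \<in> subtree T e \<longleftrightarrow> k \<le> m \<and> anc \<rho> k = e"
proof -
  have l: "anc \<rho> m \<in> level_edges m" using anc_level assms by blast
  have "s - t m \<in> open_ivl T (anc \<rho> m)" using open_ivl_level[OF l] assms by simp
  then show ?thesis
    using Inner_subtree[OF level_edges_edges[OF assms(4)] level_edges_edges[OF l]]
      mem_edge_walk_anc[OF assms(1,2,4,5)] ray_point_inner[OF assms(1-3)] by simp
qed

lemma subtree_points: "e \<in> edges T \<Longrightarrow> subtree T e \<subseteq> points T"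
  by (auto simp: subtree_def points_def)

lemma ray_point_points: "\<rho> \<in> rays T \<Longrightarrow> m \<le> N \<Longrightarrow> s \<in> piece m \<Longrightarrow> ray_point \<rho> s \<in> points T"
  using sphere_points[of m s] by (auto simp: sphere_of_def)

lemma root_dist_ray_point: "\<rho> \<in> rays T \<Longrightarrow> m \<le> N \<Longrightarrow> s \<in> piece m \<Longrightarrow> root_dist T (ray_point \<rho> s) = s"
  using sphere_points[of m s] by (auto simp: sphere_of_def)

lemma sphere_subtree:
  assumes "m \<le> N" "s \<in> piece m" "e \<in> level_edges k" "k \<le> m"
  shows "sphere_of T (subtree T e) s = (\<lambda>\<rho>. ray_point \<rho> s) ` rays_below k e"
proof -
  have "sphere_of T (subtree T e) s = sphere_of T (points T) s \<inter> subtree T e"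
    using subtree_points[OF level_edges_edges[OF assms(3)]] by (auto simp: sphere_of_def)
  then show ?thesis
    using sphere_points[OF assms(1,2)] ray_point_subtree[OF _ assms(1,2,3)] assms
    by (auto simp: rays_below_def)
qed

lemma ray_point_eq_iff:
  "\<rho> \<in> rays T \<Longrightarrow> \<sigma> \<in> rays T \<Longrightarrow> m \<le> N \<Longrightarrow> s \<in> piece m \<Longrightarrow> ray_point \<rho> s = ray_point \<sigma> s \<longleftrightarrow> anc \<rho> m = anc \<sigma> m"
  by (simp add: ray_point_inner)

text \<open>Geodesics never meet again once they have separated: the walk of their common edge
  contains all earlier edges of both.\<close>

lemma anc_eq_downward:
  assumes "\<rho> \<in> rays T" "\<sigma> \<in> rays T" "k \<le> m" "m \<le> N" "anc \<rho> m = anc \<sigma> m"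
  shows "anc \<rho> k = anc \<sigma> k"
  using mem_edge_walk_anc[OF assms(1,4) anc_level[OF assms(1)], of k]
    mem_edge_walk_anc[OF assms(2,4) anc_level[OF assms(1)], of k] assms by simp

text \<open>Every point of the sphere lies on \<open>prod_above m\<close> of the
  \<open>prod_above k\<close> half-lines below e; this multiplicity cancels in the quotient.\<close>

lemma sphere_sum:
  fixes f :: "('a, 'b) point \<Rightarrow> complex"
  assumes "m \<le> N" "s \<in> piece m" "e \<in> level_edges k" "k \<le> m"
  shows "(\<Sum>y\<in>sphere_of T (subtree T e) s. f y) / of_nat (branching_fn T (subtree T e) s) =
    (\<Sum>\<rho>\<in>rays_below k e. f (ray_point \<rho> s)) / of_nat (prod_above k)"
proof -
  have fib: "card {\<sigma> \<in> rays_below k e. ray_point \<sigma> s = ray_point \<rho> s} = prod_above m"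
    if \<rho>: "\<rho> \<in> rays_below k e" for \<rho>
  proof -
    have "{\<sigma> \<in> rays_below k e. ray_point \<sigma> s = ray_point \<rho> s} = rays_below m (anc \<rho> m)"
      using \<rho> ray_point_eq_iff[OF _ _ assms(1,2)] anc_eq_downward[OF _ _ assms(4,1)]
      by (auto simp: rays_below_def)
    then show ?thesis using card_rays_below[OF anc_level, of \<rho> m] \<rho> assms by (simp add: rays_below_def)
  qed
  note sums = sum_const_fibres[OF finite_rays_below fib]
  \<comment> \<open>The constant 1 in place of f counts the points of the sphere.\<close>
  show ?thesis
    using sums[of f] sums[of "\<lambda>_. 1 :: nat"] card_rays_below[OF assms(3)] prod_above_pos[of m] assms
    unfolding branching_fn_def sphere_subtree[OF assms] by simp
qed

lemma sphere_sum_points: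
  fixes f :: "('a, 'b) point \<Rightarrow> complex"
  assumes "m \<le> N" "s \<in> piece m"
  shows "(\<Sum>y\<in>sphere_of T (points T) s. f y) / of_nat (branching_fn T (points T) s) =
    (\<Sum>\<rho>\<in>rays T. f (ray_point \<rho> s)) / of_nat (card (rays T))"
proof -
  have fib: "card {\<sigma> \<in> rays T. ray_point \<sigma> s = ray_point \<rho> s} = prod_above m"
    if \<rho>: "\<rho> \<in> rays T" for \<rho>
  proof -
    have "{\<sigma> \<in> rays T. ray_point \<sigma> s = ray_point \<rho> s} = rays_below m (anc \<rho> m)"
      using \<rho> ray_point_eq_iff[OF _ _ assms(1,2)] by (auto simp: rays_below_def)
    then show ?thesis using card_rays_below[OF anc_level, of \<rho> m] \<rho> assms by simp
  qed
  note sums = sum_const_fibres[OF finite_rays fib]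
  show ?thesis
    using sums[of f] sums[of "\<lambda>_. 1 :: nat"] prod_above_pos[of m] assms
    unfolding branching_fn_def sphere_points[OF assms] by simp
qed

end

section \<open>The Haar basis\<close>

lemma omega_power_root: "omega b k ^ j = exp (2 * of_real pi * \<i> * of_nat j / of_nat (b k))"
  unfolding omega_def by (simp add: exp_of_nat_mult[symmetric] mult.commute)

lemma norm_omega: "norm (omega b k) = 1"
proof -
  have "omega b k = exp (\<i> * of_real (2 * pi / real (b k)))"
    by (simp add: omega_def field_simps)
  then show ?thesis by (simp only: norm_exp_i_times)
qed

lemma omega_unit: "omega b k ^ j * cnj (omega b k ^ j) = 1"
  by (simp add: complex_norm_square[symmetric] norm_power norm_omega del: complex_cnj_power flip: of_real_power)

lemma omega_ratio_eq_1_iff: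
  assumes "0 < b k"
  shows "omega b k ^ r * cnj (omega b k ^ s) = 1 \<longleftrightarrow> r mod b k = s mod b k"
proof -
  have "omega b k ^ r * cnj (omega b k ^ s) = 1 \<longleftrightarrow> omega b k ^ r = omega b k ^ s"
  proof
    assume "omega b k ^ r * cnj (omega b k ^ s) = 1"
    then have "omega b k ^ r * (omega b k ^ s * cnj (omega b k ^ s)) = omega b k ^ s"
      by (metis mult.assoc mult.commute mult_1)
    then show "omega b k ^ r = omega b k ^ s" by (simp only: omega_unit mult_1_right)
  qed (simp only: omega_unit)
  also have "\<dots> \<longleftrightarrow> r mod b k = s mod b k"
    unfolding omega_power_root using complex_root_unity_eq[of "b k" r s] assms
    by (simp add: cong_def)
  finally show ?thesis .
qed

lemma omega_power_b: "0 < b k \<Longrightarrow> omega b k ^ b k = 1"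
  using complex_root_unity[of "b k" 1] by (simp add: omega_def)

text \<open>The ratio is a root of unity of order dividing b k, so its geometric sum vanishes unless
  it equals 1.\<close>

lemma sum_omega_ratio:
  assumes "0 < b k"
  shows "(\<Sum>j<b k. (omega b k ^ r * cnj (omega b k ^ s)) ^ j) =
    (if r mod b k = s mod b k then of_nat (b k) else 0)"
proof -
  define z where "z = omega b k ^ r * cnj (omega b k ^ s)"
  have "z ^ b k = (omega b k ^ b k) ^ r * cnj ((omega b k ^ b k) ^ s)"
    by (simp add: z_def power_mult_distrib power_mult[symmetric] mult.commute)
  then have "z ^ b k = 1" using omega_power_b[of b k, OF assms] by simp
  moreover have "z = 1 \<longleftrightarrow> r mod b k = s mod b k"
    unfolding z_def by (rule omega_ratio_eq_1_iff[of b k, OF assms])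
  ultimately show ?thesis
    unfolding z_def[symmetric] using geometric_sum[of z "b k"] by auto
qed

lemma omega_ratio_power: "omega b k ^ (r * j) * cnj (omega b k ^ (s * j)) = (omega b k ^ r * cnj (omega b k ^ s)) ^ j"
  by (simp add: power_mult power_mult_distrib)

text \<open>Completeness of the Fourier basis with the mode j = 0 taken out, whence the -1. Indices
  in {1..b k} are congruent only when equal, b k being the one with residue 0.\<close>

lemma sum_omega_modes:
  assumes "r \<in> {1..b k}" "s \<in> {1..b k}"
  shows "(\<Sum>j=1..b k - 1. omega b k ^ (r * j) * cnj (omega b k ^ (s * j))) = of_bool (r = s) * of_nat (b k) - 1"
proof -
  have b: "0 < b k" using assms by simp
  have "{..<b k} = insert 0 {1..b k - 1}" using b by auto
  then have "(\<Sum>j<b k. (omega b k ^ r * cnj (omega b k ^ s)) ^ j) =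
      1 + (\<Sum>j=1..b k - 1. (omega b k ^ r * cnj (omega b k ^ s)) ^ j)"
    by simp
  moreover have "r mod b k = s mod b k \<longleftrightarrow> r = s"
    using assms by (cases "r = b k"; cases "s = b k") auto
  ultimately show ?thesis
    unfolding omega_ratio_power using sum_omega_ratio[of b k r s, OF b] by (auto simp: algebra_simps)
qed

lemma sum_omega_edges:
  assumes "0 < b k"
  shows "(\<Sum>r=1..b k. omega b k ^ (r * j) * cnj (omega b k ^ (r * i))) = (if j mod b k = i mod b k then of_nat (b k) else 0)"
proof -
  define z where "z = omega b k ^ j * cnj (omega b k ^ i)"
  have "z ^ b k = (omega b k ^ b k) ^ j * cnj ((omega b k ^ b k) ^ i)"
    by (simp add: z_def power_mult_distrib power_mult[symmetric] mult.commute)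
  then have z: "z ^ b k = 1" using omega_power_b[of b k, OF assms] by simp
  have "(\<Sum>r=1..b k. omega b k ^ (r * j) * cnj (omega b k ^ (r * i))) = (\<Sum>r=1..b k. z ^ r)"
    unfolding z_def omega_ratio_power[of b k j _ i, symmetric] by (simp only: mult.commute)
  \<comment> \<open>The index b k takes the place of 0, because z to the power b k is 1.\<close>
  also have "\<dots> = (\<Sum>r<b k. z ^ r)"
  proof -
    have "{..<b k} = insert 0 {1..<b k}" "{1..b k} = insert (b k) {1..<b k}" using assms by auto
    then show ?thesis using z by simp
  qed
  finally show ?thesis using sum_omega_ratio[of b k j i, OF assms] by (simp add: z_def)
qed

locale enumerated_tree = regular_metric_tree T N t b
  for T :: "('a, 'b) metric_tree" and N t b +
  fixes E :: "'a \<Rightarrow> nat \<Rightarrow> 'b"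
  assumes enum: "\<And>k v. k \<le> N \<Longrightarrow> v \<in> generation T t k \<Longrightarrow> bij_betw (E v) {1..b k} (out_edges T v)"
begin

abbreviation I where "I \<equiv> summand_index T N t b"

text \<open>
  Scaled such that the components of \<open>f\<close> at \<open>s\<close> are the sums over \<open>\<rho>\<close> of
  \<open>cnj (haar i \<rho>) * f (ray_point \<rho> s)\<close>; the squared norms are then \<open>1 / card (rays T)\<close>.
\<close>

definition haar :: "(nat \<times> 'a \<times> nat) option \<Rightarrow> 'b \<Rightarrow> complex" where
  "haar i \<rho> = (case i of None \<Rightarrow> 1 / of_nat (card (rays T))
     | Some (k, v, j) \<Rightarrow> (\<Sum>r=1..b k. fourier_vec b k j r * of_bool (anc \<rho> k = E v r)) /
         (of_nat (prod_above k) * of_real (sqrt (real (\<Prod>i\<le>k. b i)))))"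

lemma haar_None: "haar None \<rho> = 1 / of_nat (card (rays T))"
  by (simp add: haar_def)

lemma E_level: "k \<le> N \<Longrightarrow> v \<in> V k \<Longrightarrow> r \<in> {1..b k} \<Longrightarrow> E v r \<in> level_edges k \<and> tail G (E v r) = v"
  using bij_betw_apply[OF enum[of k v], of r] out_edges_level[of k v] by simp

lemma E_inj: "k \<le> N \<Longrightarrow> v \<in> V k \<Longrightarrow> r \<in> {1..b k} \<Longrightarrow> s \<in> {1..b k} \<Longrightarrow> E v r = E v s \<longleftrightarrow> r = s"
  using enum[of k v] by (meson bij_betw_imp_inj_on inj_on_eq_iff)

lemma anc_E:
  assumes "\<rho> \<in> rays T" "k \<le> N"
  obtains r where "r \<in> {1..b k}" "anc \<rho> k = E (tail G (anc \<rho> k)) r" "tail G (anc \<rho> k) \<in> V k"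
proof -
  have l: "anc \<rho> k \<in> level_edges k" using anc_level assms by blast
  then have v: "tail G (anc \<rho> k) \<in> V k" by (simp add: level_edges_def)
  then have "anc \<rho> k \<in> out_edges T (tail G (anc \<rho> k))" using out_edges_level assms l by auto
  then have "anc \<rho> k \<in> E (tail G (anc \<rho> k)) ` {1..b k}"
    using enum[OF assms(2) v] by (simp add: bij_betw_def)
  then show ?thesis using that v by blast
qed

lemma haar_at:
  assumes "k \<le> N" "v \<in> V k" "r \<in> {1..b k}" "anc \<rho> k = E v r"
  shows "haar (Some (k, v, j)) \<rho> = fourier_vec b k j r / (of_nat (prod_above k) * of_real (sqrt (real (\<Prod>i\<le>k. b i))))"
proof -
  have "(\<Sum>s=1..b k. fourier_vec b k j s * of_bool (anc \<rho> k = E v s)) = (\<Sum>s=1..b k. if s = r then fourier_vec b k j r else 0)"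
    using assms E_inj[OF assms(1,2,3)] by (intro sum.cong) auto
  then show ?thesis using assms(3) by (simp add: haar_def)
qed

lemma haar_outside:
  assumes "k \<le> N" "v \<in> V k" "tail G (anc \<rho> k) \<noteq> v"
  shows "haar (Some (k, v, j)) \<rho> = 0"
  using E_level[OF assms(1,2)] assms(3) by (auto simp: haar_def intro!: sum.neutral)

text \<open>In the denominator of \<open>haar\<close> the factor \<open>prod_above k\<close> comes
  from averaging over a subtree and the square root from \<open>J_edge\<close>. In the square, one
  copy of \<open>prod_above k\<close> completes the product of the b i to the number of all
  half-lines.\<close>

lemma scale_square:
  assumes "k \<le> N"
  shows "(complex_of_nat (prod_above k) * of_real (sqrt (real (\<Prod>i\<le>k. b i)))) * (of_nat (prod_above k) * of_real (sqrt (real (\<Prod>i\<le>k. b i)))) =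
    of_nat (prod_above k) * of_nat (card (rays T))"
proof -
  have "complex_of_real (sqrt (real (\<Prod>i\<le>k. b i))) * of_real (sqrt (real (\<Prod>i\<le>k. b i))) = of_nat (\<Prod>i\<le>k. b i)"
    unfolding of_real_mult[symmetric] by (simp del: of_nat_prod)
  then have "(complex_of_nat (prod_above k) * of_real (sqrt (real (\<Prod>i\<le>k. b i)))) * (of_nat (prod_above k) * of_real (sqrt (real (\<Prod>i\<le>k. b i)))) =
    of_nat (prod_above k) * (of_nat (\<Prod>i\<le>k. b i) * of_nat (prod_above k))"
    by (simp add: algebra_simps)
  then show ?thesis
    using prod_below_above[OF assms] by (metis of_nat_mult)
qed

lemma sqrt_b_square: "k \<le> N \<Longrightarrow> complex_of_real (sqrt (real (b k))) * of_real (sqrt (real (b k))) = of_nat (b k)"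
  unfolding of_real_mult[symmetric] by simp

lemma prod_above_step: "Suc k \<le> N \<Longrightarrow> prod_above k = b (Suc k) * prod_above (Suc k)"
proof -
  assume "Suc k \<le> N"
  then have "{k<..N} = insert (Suc k) {Suc k<..N}" by auto
  then show ?thesis by (simp add: prod_above_def)
qed

lemma card_rays_0: "card (rays T) = b 0 * prod_above 0"
  using prod_below_above[of 0] by simp

lemma haar_product:
  assumes "k \<le> N" "v \<in> V k" "r \<in> {1..b k}" "anc \<rho> k = E v r" "s \<in> {1..b k}" "anc \<sigma> k = E v s"
  shows "haar (Some (k, v, j)) \<rho> * cnj (haar (Some (k, v, i)) \<sigma>) =
    (omega b k ^ (r * j) * cnj (omega b k ^ (s * i))) / (of_nat (b k) * (of_nat (prod_above k) * of_nat (card (rays T))))"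
  unfolding haar_at[OF assms(1-4)] haar_at[OF assms(1,2,5,6)] fourier_vec_def
  by (simp add: scale_square[OF assms(1), symmetric] sqrt_b_square[OF assms(1), symmetric])

text \<open>The modes of generation k make up the difference of two averages: over half-lines with
  the same edge of generation k, and over those with the same vertex of generation k. Leaving out j
  = 0 leaves the functions of mean zero on the edges at a vertex.\<close>

lemma haar_level_kernel:
  assumes "k \<le> N" "\<rho> \<in> rays T" "\<sigma> \<in> rays T"
  shows "(\<Sum>v\<in>V k. \<Sum>j=1..b k - 1. haar (Some (k, v, j)) \<rho> * cnj (haar (Some (k, v, j)) \<sigma>)) =
    of_bool (anc \<rho> k = anc \<sigma> k) / (of_nat (prod_above k) * of_nat (card (rays T))) -
    of_bool (tail G (anc \<rho> k) = tail G (anc \<sigma> k)) / (of_nat (b k * prod_above k) * of_nat (card (rays T)))"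
proof -
  obtain r where r: "r \<in> {1..b k}" "anc \<rho> k = E (tail G (anc \<rho> k)) r" "tail G (anc \<rho> k) \<in> V k"
    using anc_E[OF assms(2,1)] .
  obtain s where s: "s \<in> {1..b k}" "anc \<sigma> k = E (tail G (anc \<sigma> k)) s" "tail G (anc \<sigma> k) \<in> V k"
    using anc_E[OF assms(3,1)] .
  define v where "v = tail G (anc \<rho> k)"
  have v: "v \<in> V k" "anc \<rho> k = E v r" using r by (auto simp: v_def)
  \<comment> \<open>Only the vertex of generation k on \<rho> contributes.\<close>
  have "(\<Sum>w\<in>V k. \<Sum>j=1..b k - 1. haar (Some (k, w, j)) \<rho> * cnj (haar (Some (k, w, j)) \<sigma>)) =
      (\<Sum>w\<in>V k. if w = v then \<Sum>j=1..b k - 1. haar (Some (k, v, j)) \<rho> * cnj (haar (Some (k, v, j)) \<sigma>) else 0)"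
    using haar_outside[OF assms(1)] by (intro sum.cong) (auto simp: v_def)
  also have "\<dots> = (\<Sum>j=1..b k - 1. haar (Some (k, v, j)) \<rho> * cnj (haar (Some (k, v, j)) \<sigma>))"
    using v finite_V by simp
  also have "\<dots> = of_bool (anc \<rho> k = anc \<sigma> k) / (of_nat (prod_above k) * of_nat (card (rays T))) -
    of_bool (tail G (anc \<sigma> k) = v) / (of_nat (b k * prod_above k) * of_nat (card (rays T)))"
  proof (cases "tail G (anc \<sigma> k) = v")
    case True
    then have s': "anc \<sigma> k = E v s" using s by simp
    have eq: "anc \<rho> k = anc \<sigma> k \<longleftrightarrow> r = s"
      using v s' E_inj[OF assms(1) v(1) r(1) s(1)] by simp
    have "(\<Sum>j=1..b k - 1. haar (Some (k, v, j)) \<rho> * cnj (haar (Some (k, v, j)) \<sigma>)) =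
        (\<Sum>j=1..b k - 1. omega b k ^ (r * j) * cnj (omega b k ^ (s * j))) / (of_nat (b k) * (of_nat (prod_above k) * of_nat (card (rays T))))"
      unfolding haar_product[OF assms(1) v(1) r(1) v(2) s(1) s'] by (simp add: sum_divide_distrib)
    also have "\<dots> = (of_bool (r = s) * of_nat (b k) - 1) / (of_nat (b k) * (of_nat (prod_above k) * of_nat (card (rays T))))"
      unfolding sum_omega_modes[of r b k s, OF r(1) s(1)] ..
    also have "\<dots> = of_bool (r = s) / (of_nat (prod_above k) * of_nat (card (rays T))) - 1 / (of_nat (b k * prod_above k) * of_nat (card (rays T)))"
      using b_pos[OF assms(1)] by (simp add: diff_divide_distrib mult.assoc)
    finally show ?thesis using True eq by simp
  next
    case False
    then have "anc \<rho> k \<noteq> anc \<sigma> k" by (auto simp: v_def)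
    then show ?thesis using False haar_outside[OF assms(1) v(1)] by simp
  qed
  finally show ?thesis by (auto simp: v_def)
qed

lemma sum_index:
  fixes F :: "(nat \<times> 'a \<times> nat) option \<Rightarrow> 'c::comm_monoid_add"
  shows "(\<Sum>i\<in>I. F i) = F None + (\<Sum>k\<le>N. \<Sum>v\<in>V k. \<Sum>j=1..b k - 1. F (Some (k, v, j)))"
    and finite_index: "finite I"
proof -
  define S where "S = (SIGMA k:{..N}. SIGMA v:V k. {1..b k - 1})"
  have I: "I = insert None (Some ` S)"
    unfolding summand_index_def S_def by (auto simp: image_iff)
  have fin: "finite S" unfolding S_def by (intro finite_SigmaI) (auto simp: finite_V)
  then show "finite I" unfolding I by simp
  have "(\<Sum>i\<in>I. F i) = F None + (\<Sum>x\<in>S. F (Some x))"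
    unfolding I using fin by (subst sum.insert) (auto simp: sum.reindex)
  also have "(\<Sum>x\<in>S. F (Some x)) = (\<Sum>k\<le>N. \<Sum>v\<in>V k. \<Sum>j=1..b k - 1. F (Some (k, v, j)))"
  proof -
    have "(\<Sum>v\<in>V k. \<Sum>j=1..b k - 1. F (Some (k, v, j))) = (\<Sum>p\<in>V k \<times> {1..b k - 1}. F (Some (k, p)))" for k
      unfolding sum.cartesian_product by (simp add: case_prod_unfold)
    then show ?thesis
      unfolding S_def by (simp add: sum.Sigma finite_V case_prod_unfold)
  qed
  finally show "(\<Sum>i\<in>I. F i) = F None + (\<Sum>k\<le>N. \<Sum>v\<in>V k. \<Sum>j=1..b k - 1. F (Some (k, v, j)))" .
qed

text \<open>The contributions of the generations telescope.\<close>

lemma haar_complete: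
  assumes "\<rho> \<in> rays T" "\<sigma> \<in> rays T"
  shows "(\<Sum>i\<in>I. haar i \<rho> * cnj (haar i \<sigma>)) = of_bool (\<rho> = \<sigma>) / of_nat (card (rays T))"
proof -
  \<comment> \<open>Up to a constant factor, \<open>A (Suc k)\<close> is the kernel of averaging
    over half-lines with a common edge of generation k, and \<open>A 0\<close> that of averaging
    over all. Equally, \<open>A k\<close> averages over half-lines with a common vertex of
    generation k, so each generation contributes a difference.\<close>
  define A where "A k = (case k of 0 \<Rightarrow> 1 / (of_nat (card (rays T)) * of_nat (card (rays T))) |
     Suc k \<Rightarrow> of_bool (anc \<rho> k = anc \<sigma> k) / (of_nat (prod_above k) * complex_of_nat (card (rays T))))" for k
  have "(\<Sum>v\<in>V k. \<Sum>j=1..b k - 1. haar (Some (k, v, j)) \<rho> * cnj (haar (Some (k, v, j)) \<sigma>)) = A (Suc k) - A k"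
    if k: "k \<le> N" for k
  proof -
    have "A k = of_bool (tail G (anc \<rho> k) = tail G (anc \<sigma> k)) / (of_nat (b k * prod_above k) * of_nat (card (rays T)))"
    proof (cases k)
      case 0
      then show ?thesis using tail_anc_0[OF assms(1)] tail_anc_0[OF assms(2)] card_rays_0 by (simp add: A_def)
    next
      case (Suc k')
      then show ?thesis
        using tail_anc_eq_iff[OF assms, of k'] prod_above_step[of k'] k by (simp add: A_def)
    qed
    then show ?thesis unfolding haar_level_kernel[OF k assms] by (simp add: A_def)
  qed
  then have "(\<Sum>i\<in>I. haar i \<rho> * cnj (haar i \<sigma>)) = A 0 + (\<Sum>k\<le>N. A (Suc k) - A k)"
    unfolding sum_index by (simp add: haar_None A_def)
  also have "\<dots> = A (Suc N)"
    by (simp add: sum_telescope lessThan_Suc_atMost[symmetric] sum_lessThan_telescope)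
  \<comment> \<open>For k = N the edge is the half-line itself, and \<open>prod_above N\<close> is
    an empty product.\<close>
  also have "\<dots> = of_bool (\<rho> = \<sigma>) / of_nat (card (rays T))"
    using assms by (simp add: A_def anc_N prod_above_def)
  finally show ?thesis .
qed

text \<open>The edges at v have equally many half-lines below them, so the sum is a multiple of the
  sum of the Fourier vector, that is, of its inner product with the constant mode 0.\<close>

lemma sum_haar_zero:
  assumes "k \<le> N" "v \<in> V k" "j \<in> {1..b k - 1}"
  shows "(\<Sum>\<rho>\<in>rays T. haar (Some (k, v, j)) \<rho>) = 0"
proof -
  define c where "c = complex_of_nat (prod_above k) * of_real (sqrt (real (\<Prod>i\<le>k. b i)))"
  have "(\<Sum>\<rho>\<in>rays T. \<Sum>r=1..b k. fourier_vec b k j r * of_bool (anc \<rho> k = E v r)) =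
      (\<Sum>r=1..b k. fourier_vec b k j r * (\<Sum>\<rho>\<in>rays T. of_bool (anc \<rho> k = E v r)))"
    by (subst sum.swap) (simp add: sum_distrib_left)
  also have "\<dots> = (\<Sum>r=1..b k. fourier_vec b k j r * of_nat (prod_above k))"
  proof (rule sum.cong)
    fix r assume r: "r \<in> {1..b k}"
    have "(\<Sum>\<rho>\<in>rays T. of_bool (anc \<rho> k = E v r)) = (of_nat (card (rays_below k (E v r))) :: complex)"
      unfolding rays_below_def using finite_rays by (simp add: of_bool_def sum.If_cases Int_def)
    then show "fourier_vec b k j r * (\<Sum>\<rho>\<in>rays T. of_bool (anc \<rho> k = E v r)) = fourier_vec b k j r * of_nat (prod_above k)"
      using card_rays_below[of "E v r" k] E_level[OF assms(1,2) r] assms(1) by simp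
  qed simp
  also have "\<dots> = (\<Sum>r=1..b k. omega b k ^ (r * j) * cnj (omega b k ^ (r * 0))) * of_nat (prod_above k) / of_real (sqrt (real (b k)))"
    unfolding fourier_vec_def by (simp add: sum_distrib_right sum_divide_distrib)
  also have "(\<Sum>r=1..b k. omega b k ^ (r * j) * cnj (omega b k ^ (r * 0))) = 0"
    using sum_omega_edges[of b k j 0, OF b_pos[OF assms(1)]] assms(3) by (auto simp: mod_eq_0_iff_dvd dest: dvd_imp_le)
  finally show ?thesis
    by (simp add: haar_def sum_divide_distrib[symmetric])
qed

lemma haar_constant_below:
  assumes "\<rho> \<in> rays T" "\<sigma> \<in> rays T" "k < k'" "k' \<le> N" "tail G (anc \<rho> k') = tail G (anc \<sigma> k')"
  shows "anc \<rho> k = anc \<sigma> k"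
proof -
  have "anc \<rho> (k' - 1) = anc \<sigma> (k' - 1)"
    using tail_anc_eq_iff[OF assms(1,2), of "k' - 1"] assms by simp
  then show ?thesis using anc_eq_downward[OF assms(1,2), of k "k' - 1"] assms by simp
qed

text \<open>Mean zero on the half-lines through v. It yields orthogonality to the modes of earlier
  generations, vanishing of the coefficient at radii before v, and vanishing at v itself.\<close>

lemma sum_haar_vanish:
  fixes F :: "'b \<Rightarrow> complex"
  assumes "k \<le> N" "v \<in> V k" "j \<in> {1..b k - 1}"
    and F: "\<And>\<rho> \<sigma>. \<rho> \<in> rays T \<Longrightarrow> \<sigma> \<in> rays T \<Longrightarrow> tail G (anc \<rho> k) = v \<Longrightarrow> tail G (anc \<sigma> k) = v \<Longrightarrow> F \<rho> = F \<sigma>"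
  shows "(\<Sum>\<rho>\<in>rays T. haar (Some (k, v, j)) \<rho> * F \<rho>) = 0"
proof (cases "\<exists>\<sigma>\<in>rays T. tail G (anc \<sigma> k) = v")
  case True
  then obtain \<sigma> where \<sigma>: "\<sigma> \<in> rays T" "tail G (anc \<sigma> k) = v" by blast
  have "haar (Some (k, v, j)) \<rho> * F \<rho> = haar (Some (k, v, j)) \<rho> * F \<sigma>" if "\<rho> \<in> rays T" for \<rho>
    using F[OF that \<sigma>(1) _ \<sigma>(2)] haar_outside[OF assms(1,2), of \<rho> j] by (cases "tail G (anc \<rho> k) = v") auto
  then have "(\<Sum>\<rho>\<in>rays T. haar (Some (k, v, j)) \<rho> * F \<rho>) = (\<Sum>\<rho>\<in>rays T. haar (Some (k, v, j)) \<rho>) * F \<sigma>"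
    unfolding sum_distrib_right by (rule sum.cong[OF refl])
  then show ?thesis using sum_haar_zero[OF assms(1-3)] by simp
next
  case False
  then show ?thesis using haar_outside[OF assms(1,2)] by (auto intro!: sum.neutral)
qed

lemma haar_eq_if_same_anc: "anc \<rho> k = anc \<sigma> k \<Longrightarrow> haar (Some (k, v, j)) \<rho> = haar (Some (k, v, j)) \<sigma>"
  by (simp add: haar_def)

text \<open>Three reasons: the constant and the modes of earlier generations are constant on the
  half-lines through v, where the later mode has mean zero; modes at different vertices of one
  generation have disjoint supports; at one vertex the Fourier vectors are orthogonal. The claim
  \<open>mixed\<close> puts the later mode first, and the other order is its conjugate.\<close>

lemma haar_orthogonal:
  assumes "i \<in> I" "i' \<in> I" "i \<noteq> i'"
  shows "(\<Sum>\<rho>\<in>rays T. haar i \<rho> * cnj (haar i' \<rho>)) = 0"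
proof -
  have mixed: "(\<Sum>\<rho>\<in>rays T. haar (Some (k, v, j)) \<rho> * cnj (haar i' \<rho>)) = 0"
    if i: "Some (k, v, j) \<in> I" and i': "i' = None \<or> (\<exists>k' v' j'. i' = Some (k', v', j') \<and> i' \<in> I \<and>
      (k' < k \<or> k' = k \<and> v' \<noteq> v \<or> k' = k \<and> v' = v \<and> j' \<noteq> j))" for k v j i'
  proof -
    have k: "k \<le> N" "v \<in> V k" "j \<in> {1..b k - 1}" using i by (auto simp: summand_index_def)
    consider "i' = None" | k' v' j' where "i' = Some (k', v', j')" "k' < k"
      | v' j' where "i' = Some (k, v', j')" "v' \<noteq> v" "v' \<in> V k" | j' where "i' = Some (k, v, j')" "j' \<noteq> j" "j' \<in> {1..b k - 1}"
      using i' by (auto simp: summand_index_def)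
    then show ?thesis
    proof cases
      case 1
      then show ?thesis using sum_haar_vanish[OF k, of "\<lambda>_. 1 / of_nat (card (rays T))"] by (simp add: haar_None)
    next
      case 2
      show ?thesis
        by (rule sum_haar_vanish[OF k]) (use haar_constant_below[OF _ _ 2(2) k(1)] 2(1) haar_eq_if_same_anc in metis)
    next
      case 3
      have "haar (Some (k, v, j)) \<rho> * cnj (haar i' \<rho>) = 0" for \<rho>
        using haar_outside[OF k(1,2), of \<rho> j] haar_outside[OF k(1) 3(3), of \<rho> j'] 3 by (cases "tail G (anc \<rho> k) = v") auto
      then show ?thesis by (intro sum.neutral ballI)
    next
      case 4
      define c where "c = of_nat (b k) * (of_nat (prod_above k) * complex_of_nat (card (rays T)))"
      have b: "0 < b k" using b_pos k by blast
      have "(\<Sum>\<rho>\<in>rays T. haar (Some (k, v, j)) \<rho> * cnj (haar i' \<rho>)) =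
          (\<Sum>\<rho>\<in>rays T. \<Sum>r=1..b k. of_bool (anc \<rho> k = E v r) * (omega b k ^ (r * j) * cnj (omega b k ^ (r * j')) / c))"
      proof (rule sum.cong)
        fix \<rho> assume \<rho>: "\<rho> \<in> rays T"
        obtain r where r: "r \<in> {1..b k}" "anc \<rho> k = E (tail G (anc \<rho> k)) r" "tail G (anc \<rho> k) \<in> V k"
          using anc_E[OF \<rho> k(1)] .
        show "haar (Some (k, v, j)) \<rho> * cnj (haar i' \<rho>) =
          (\<Sum>r=1..b k. of_bool (anc \<rho> k = E v r) * (omega b k ^ (r * j) * cnj (omega b k ^ (r * j')) / c))"
        proof (cases "tail G (anc \<rho> k) = v")
          case True
          then have r': "anc \<rho> k = E v r" using r by simp
          have "(\<Sum>s=1..b k. of_bool (anc \<rho> k = E v s) * (omega b k ^ (s * j) * cnj (omega b k ^ (s * j')) / c)) =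
              (\<Sum>s=1..b k. if s = r then omega b k ^ (r * j) * cnj (omega b k ^ (r * j')) / c else 0)"
            using r' E_inj[OF k(1,2) r(1)] by (intro sum.cong) auto
          then show ?thesis
            using haar_product[OF k(1,2) r(1) r' r(1) r', of j j'] r(1) 4(1) by (simp add: c_def)
        next
          case False
          then have "anc \<rho> k \<noteq> E v s" if "s \<in> {1..b k}" for s using E_level[OF k(1,2) that] by auto
          then show ?thesis using haar_outside[OF k(1,2) False] by (auto intro!: sum.neutral[symmetric])
        qed
      qed simp
      also have "\<dots> = (\<Sum>r=1..b k. of_nat (prod_above k) * (omega b k ^ (r * j) * cnj (omega b k ^ (r * j')) / c))"
      proof (subst sum.swap, rule sum.cong)
        fix r assume r: "r \<in> {1..b k}"
        have "(\<Sum>\<rho>\<in>rays T. of_bool (anc \<rho> k = E v r)) = (of_nat (card (rays_below k (E v r))) :: complex)"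
          unfolding rays_below_def using finite_rays by (simp add: of_bool_def sum.If_cases Int_def)
        then show "(\<Sum>\<rho>\<in>rays T. of_bool (anc \<rho> k = E v r) * (omega b k ^ (r * j) * cnj (omega b k ^ (r * j')) / c)) =
            of_nat (prod_above k) * (omega b k ^ (r * j) * cnj (omega b k ^ (r * j')) / c)"
          using card_rays_below[of "E v r" k] E_level[OF k(1,2) r] k(1) by (simp only: sum_distrib_right[symmetric])
      qed simp
      also have "\<dots> = of_nat (prod_above k) / c * (\<Sum>r=1..b k. omega b k ^ (r * j) * cnj (omega b k ^ (r * j')))"
        by (simp add: sum_distrib_left)
      also have "\<dots> = 0"
      proof -
        have "j < b k" "j' < b k" using 4(3) k(3) b by auto
        then show ?thesis using sum_omega_edges[of b k j j', OF b] 4(2) by simp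
      qed
      finally show ?thesis .
    qed
  qed
  have swap: "(\<Sum>\<rho>\<in>rays T. haar i \<rho> * cnj (haar i' \<rho>)) = cnj (\<Sum>\<rho>\<in>rays T. haar i' \<rho> * cnj (haar i \<rho>))"
    by (simp add: mult.commute)
  show ?thesis
  proof (cases i)
    case None
    with assms obtain k v j where "i' = Some (k, v, j)" by (cases i') auto
    then show ?thesis using mixed[of k v j i] None assms swap by simp
  next
    case (Some x)
    obtain k v j where i: "i = Some (k, v, j)" using Some by (cases x) auto
    show ?thesis
    proof (cases i')
      case None
      then show ?thesis using mixed[of k v j i'] i assms by simp
    next
      case (Some y)
      obtain k' v' j' where i': "i' = Some (k', v', j')" using Some by (cases y) auto
      show ?thesis
      proof (cases "k < k'")
        case True
        then show ?thesis using mixed[of k' v' j' i] i i' assms swap by auto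
      next
        case False
        then have "k' < k \<or> k' = k" by linarith
        then have "k' < k \<or> k' = k \<and> v' \<noteq> v \<or> k' = k \<and> v' = v \<and> j' \<noteq> j"
          using assms(3) i i' by auto
        then show ?thesis using mixed[of k v j i'] i i' assms by blast
      qed
    qed
  qed
qed

section \<open>Expansion and Parseval's identity for functions of the half-line\<close>

definition haar_coeff :: "('b \<Rightarrow> complex) \<Rightarrow> (nat \<times> 'a \<times> nat) option \<Rightarrow> complex" where
  "haar_coeff F i = (\<Sum>\<rho>\<in>rays T. cnj (haar i \<rho>) * F \<rho>)"

lemma haar_expansion:
  assumes "\<rho> \<in> rays T"
  shows "F \<rho> = of_nat (card (rays T)) * (\<Sum>i\<in>I. haar i \<rho> * haar_coeff F i)"
proof -
  have "(\<Sum>i\<in>I. haar i \<rho> * haar_coeff F i) = (\<Sum>\<sigma>\<in>rays T. (\<Sum>i\<in>I. haar i \<rho> * cnj (haar i \<sigma>)) * F \<sigma>)"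
    unfolding haar_coeff_def sum_distrib_left sum_distrib_right by (subst sum.swap) (simp add: mult.assoc)
  also have "\<dots> = (\<Sum>\<sigma>\<in>rays T. if \<rho> = \<sigma> then F \<sigma> / of_nat (card (rays T)) else 0)"
    using assms by (intro sum.cong) (auto simp: haar_complete)
  finally show ?thesis using assms finite_rays card_rays_pos by auto
qed

lemma haar_parseval:
  "(\<Sum>\<rho>\<in>rays T. (cmod (F \<rho>))\<^sup>2) = real (card (rays T)) * (\<Sum>i\<in>I. (cmod (haar_coeff F i))\<^sup>2)"
proof -
  have "complex_of_real (\<Sum>\<rho>\<in>rays T. (cmod (F \<rho>))\<^sup>2) = (\<Sum>\<rho>\<in>rays T. F \<rho> * cnj (F \<rho>))"
    by (simp only: of_real_sum complex_norm_square)
  also have "\<dots> = (\<Sum>\<rho>\<in>rays T. of_nat (card (rays T)) * (\<Sum>i\<in>I. haar i \<rho> * haar_coeff F i) * cnj (F \<rho>))"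
    using haar_expansion[of _ F] by (intro sum.cong) auto
  also have "\<dots> = of_nat (card (rays T)) * (\<Sum>i\<in>I. haar_coeff F i * (\<Sum>\<rho>\<in>rays T. haar i \<rho> * cnj (F \<rho>)))"
    unfolding sum_distrib_left sum_distrib_right by (subst sum.swap) (simp add: algebra_simps)
  also have "\<dots> = of_nat (card (rays T)) * (\<Sum>i\<in>I. haar_coeff F i * cnj (haar_coeff F i))"
    by (simp add: haar_coeff_def)
  also have "\<dots> = complex_of_real (real (card (rays T)) * (\<Sum>i\<in>I. (cmod (haar_coeff F i))\<^sup>2))"
    by (simp only: of_real_mult of_real_sum complex_norm_square of_real_of_nat_eq)
  finally show ?thesis by (simp only: of_real_eq_iff)
qed

end

section \<open>Integration along half-lines\<close>

text \<open>By the hypothesis \<open>em\<close>, M is the sum of the images of the Q i under the X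
  i. The identity extends from indicators to nonnegative functions by linearity and monotone
  limits.\<close>

lemma nn_integral_sum_distr:
  fixes h :: "'x \<Rightarrow> ennreal"
  assumes "finite A" and X[measurable]: "\<And>i. i \<in> A \<Longrightarrow> X i \<in> measurable (Q i) M"
    and em: "\<And>B. B \<in> sets M \<Longrightarrow> emeasure M B = (\<Sum>i\<in>A. emeasure (Q i) (X i -` B \<inter> space (Q i)))"
    and h: "h \<in> borel_measurable M"
  shows "(\<integral>\<^sup>+x. h x \<partial>M) = (\<Sum>i\<in>A. \<integral>\<^sup>+y. h (X i y) \<partial>Q i)"
  using h
proof (induction rule: borel_measurable_induct)
  case (cong f g)
  have "(\<integral>\<^sup>+y. f (X i y) \<partial>Q i) = (\<integral>\<^sup>+y. g (X i y) \<partial>Q i)" if "i \<in> A" for i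
    by (rule nn_integral_cong) (use cong(3) measurable_space[OF X[OF that]] in auto)
  moreover have "(\<integral>\<^sup>+x. f x \<partial>M) = (\<integral>\<^sup>+x. g x \<partial>M)"
    by (rule nn_integral_cong) (use cong in auto)
  ultimately show ?case using cong by simp
next
  case (set B)
  have "(\<integral>\<^sup>+y. indicator B (X i y) \<partial>Q i) = emeasure (Q i) (X i -` B \<inter> space (Q i))" if i: "i \<in> A" for i
  proof -
    have "(\<integral>\<^sup>+y. indicator B (X i y) \<partial>Q i) = (\<integral>\<^sup>+y. indicator (X i -` B \<inter> space (Q i)) y \<partial>Q i)"
      by (rule nn_integral_cong) (auto simp: indicator_def)
    then show ?thesis using measurable_sets[OF X[OF i] set] by simp
  qed
  then show ?case using set em by simp
next
  case (mult u c)
  then show ?case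
    using X by (simp add: nn_integral_cmult sum_distrib_left measurable_compose[OF X])
next
  case (add u v)
  then show ?case
    using X by (simp add: nn_integral_add sum.distrib measurable_compose[OF X])
next
  case (seq U)
  have inc: "incseq (\<lambda>n. (\<lambda>y. U n (X i y)))" for i
    using \<open>incseq U\<close> by (auto simp: incseq_def le_fun_def)
  have SUP: "(SUP n. U n) x = (SUP n. U n x)" for x by (metis SUP_apply image_cong)
  have "(\<integral>\<^sup>+x. (SUP n. U n) x \<partial>M) = (SUP n. \<integral>\<^sup>+x. U n x \<partial>M)"
    unfolding SUP by (rule nn_integral_monotone_convergence_SUP) (use seq in auto)
  also have "\<dots> = (SUP n. \<Sum>i\<in>A. \<integral>\<^sup>+y. U n (X i y) \<partial>Q i)"
    using seq by simp
  also have "\<dots> = (\<Sum>i\<in>A. SUP n. \<integral>\<^sup>+y. U n (X i y) \<partial>Q i)"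
    using inc by (intro ennreal_SUP_sum) (auto simp: incseq_def le_fun_def intro!: nn_integral_mono)
  also have "\<dots> = (\<Sum>i\<in>A. \<integral>\<^sup>+y. (SUP n. U n) (X i y) \<partial>Q i)"
    unfolding SUP
    by (intro sum.cong refl nn_integral_monotone_convergence_SUP[symmetric] inc)
      (use seq(1) X in \<open>auto intro: measurable_compose\<close>)
  finally show ?case .
qed

lemma gauss_pos: "0 < gauss s"
  by (simp add: gauss_def)

lemma gauss_measurable[measurable]: "gauss \<in> borel_measurable borel"
  unfolding gauss_def[abs_def] by measurable

context regular_metric_tree
begin

abbreviation level_set where "level_set \<equiv> t ` {..N}"

lemma open_ivl_borel[measurable]: "open_ivl T e \<in> sets borel"
  by (auto simp: open_ivl_def)

lemma piece_borel[measurable]: "piece m \<in> sets borel"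
  by (auto simp: piece_def)

lemma space_tree_length: "space (tree_length T) = points T"
  unfolding tree_length_def by (rule space_measure_of) auto

lemma Inner_measurable: "e \<in> edges T \<Longrightarrow> Inner e \<in> measurable (restrict_space lborel (open_ivl T e)) (tree_length T)"
proof (rule measurableI)
  assume e: "e \<in> edges T"
  show "Inner e r \<in> space (tree_length T)" if "r \<in> space (restrict_space lborel (open_ivl T e))" for r
    using that e by (simp add: space_tree_length Inner_points space_restrict_space)
  fix A assume "A \<in> sets (tree_length T)"
  then have "edge_trace T e A \<in> sets borel" using e by (simp add: sets_tree_length)
  moreover have "Inner e -` A \<inter> space (restrict_space lborel (open_ivl T e)) = edge_trace T e A"
    by (auto simp: edge_trace_def space_restrict_space)
  ultimately show "Inner e -` A \<inter> space (restrict_space lborel (open_ivl T e)) \<in> sets (restrict_space lborel (open_ivl T e))"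
    by (auto simp: sets_restrict_space_iff edge_trace_def)
qed

text \<open>Sets of vertices have empty traces and so are measurable; only the restrictions to the
  open edges matter.\<close>

lemma measurable_tree_lengthI:
  assumes "\<And>x. x \<in> points T \<Longrightarrow> f x \<in> space M"
    and "\<And>e. e \<in> edges T \<Longrightarrow> (\<lambda>r. f (Inner e r)) \<in> measurable (restrict_space lborel (open_ivl T e)) M"
  shows "f \<in> measurable (tree_length T) M"
proof (rule measurableI)
  fix B assume B: "B \<in> sets M"
  have "edge_trace T e (f -` B \<inter> points T) \<in> sets borel" if e: "e \<in> edges T" for e
  proof -
    have "edge_trace T e (f -` B \<inter> points T) = (\<lambda>r. f (Inner e r)) -` B \<inter> space (restrict_space lborel (open_ivl T e))"
      using e by (auto simp: edge_trace_def space_restrict_space Inner_points)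
    moreover have "\<dots> \<in> sets (restrict_space lborel (open_ivl T e))"
      by (rule measurable_sets[OF assms(2)[OF e] B])
    ultimately show ?thesis by (simp add: sets_restrict_space_iff)
  qed
  then show "f -` B \<inter> space (tree_length T) \<in> sets (tree_length T)"
    by (simp add: sets_tree_length space_tree_length)
qed (use assms in \<open>simp add: space_tree_length\<close>)

lemma root_dist_measurable: "root_dist T \<in> borel_measurable (tree_length T)"
proof (rule measurable_tree_lengthI)
  show "(\<lambda>r. root_dist T (Inner e r)) \<in> borel_measurable (restrict_space lborel (open_ivl T e))" for e
    unfolding root_dist.simps by (intro measurable_restrict_space1) measurable
qed simp

lemma measurable_mu: "measurable (mu T) M = measurable (tree_length T) M"
  by (rule measurable_cong_sets) (simp_all add: mu_def)

lemma nn_integral_tree_length: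
  assumes "h \<in> borel_measurable (tree_length T)"
  shows "(\<integral>\<^sup>+x. h x \<partial>tree_length T) = (\<Sum>e\<in>edges T. \<integral>\<^sup>+r. h (Inner e r) \<partial>restrict_space lborel (open_ivl T e))"
proof (rule nn_integral_sum_distr[OF finite_edges Inner_measurable _ assms])
  fix B assume B: "B \<in> sets (tree_length T)"
  have "emeasure lborel (edge_trace T e B) =
      emeasure (restrict_space lborel (open_ivl T e)) (Inner e -` B \<inter> space (restrict_space lborel (open_ivl T e)))" for e
  proof -
    have "Inner e -` B \<inter> space (restrict_space lborel (open_ivl T e)) = edge_trace T e B"
      by (auto simp: edge_trace_def space_restrict_space)
    then show ?thesis
      by (simp add: emeasure_restrict_space edge_trace_def)
  qed
  then show "emeasure (tree_length T) B = (\<Sum>e\<in>edges T.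
      emeasure (restrict_space lborel (open_ivl T e)) (Inner e -` B \<inter> space (restrict_space lborel (open_ivl T e))))"
    using emeasure_tree_length[OF finite_edges B] by simp
qed

lemma nn_integral_mu_edge:
  assumes "h \<in> borel_measurable (restrict_space lborel (open_ivl T e))"
  shows "(\<integral>\<^sup>+r. h r \<partial>mu_edge T e) =
    (\<integral>\<^sup>+r. ennreal (gauss (vertex_dist T (tail G e) + r)) * h r \<partial>restrict_space lborel (open_ivl T e))"
  unfolding mu_edge_def by (rule nn_integral_density[OF _ assms], intro measurable_restrict_space1) measurable

lemma nn_integral_mu_edges:
  assumes h: "h \<in> borel_measurable (mu T)"
  shows "(\<integral>\<^sup>+x. h x \<partial>mu T) = (\<Sum>e\<in>edges T. \<integral>\<^sup>+r. h (Inner e r) \<partial>mu_edge T e)"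
proof -
  have h': "h \<in> borel_measurable (tree_length T)" using h by (simp add: measurable_mu)
  have "(\<integral>\<^sup>+x. h x \<partial>mu T) = (\<integral>\<^sup>+x. ennreal (gauss (root_dist T x)) * h x \<partial>tree_length T)"
    unfolding mu_def using root_dist_measurable h' by (intro nn_integral_density) measurable
  also have "\<dots> = (\<Sum>e\<in>edges T. \<integral>\<^sup>+r. ennreal (gauss (root_dist T (Inner e r))) * h (Inner e r) \<partial>restrict_space lborel (open_ivl T e))"
    using root_dist_measurable h' by (intro nn_integral_tree_length) measurable
  also have "\<dots> = (\<Sum>e\<in>edges T. \<integral>\<^sup>+r. h (Inner e r) \<partial>mu_edge T e)"
    using measurable_compose[OF Inner_measurable h'] by (intro sum.cong refl) (simp add: nn_integral_mu_edge)
  finally show ?thesis .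
qed

text \<open>Moves an edge to its place on [0, \<infinity>), turning arc length into distance from
  the root, so that different edges can be added under one integral sign.\<close>

lemma nn_integral_mu_edge_shift:
  assumes e: "e \<in> level_edges m" "m \<le> N" and h: "h \<in> borel_measurable (restrict_space lborel (open_ivl T e))"
  shows "(\<integral>\<^sup>+r. h r \<partial>mu_edge T e) = (\<integral>\<^sup>+s. ennreal (gauss s) * h (s - t m) * indicator (piece m) s \<partial>lborel)"
    and "(\<lambda>s. ennreal (gauss s) * h (s - t m) * indicator (piece m) s) \<in> borel_measurable lborel"
proof -
  define H where "H r = ennreal (gauss (t m + r)) * (h r * indicator (open_ivl T e) r)" for r
  have dist: "vertex_dist T (tail G e) = t m" using e by (simp add: level_edges_def vertex_dist_V)
  have "(\<lambda>r. h r * indicator (open_ivl T e) r) \<in> borel_measurable borel"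
    using h by (subst (asm) borel_measurable_restrict_space_iff_ennreal) auto
  then have H[measurable]: "H \<in> borel_measurable borel"
    unfolding H_def[abs_def] by measurable
  have shift: "H (- t m + 1 * s) = ennreal (gauss s) * h (s - t m) * indicator (piece m) s" for s
    using open_ivl_level(1)[OF e] by (simp add: H_def indicator_def)
  have "(\<integral>\<^sup>+r. h r \<partial>mu_edge T e) = (\<integral>\<^sup>+r. H r \<partial>lborel)"
    unfolding nn_integral_mu_edge[OF h]
    by (subst nn_integral_restrict_space) (auto simp: H_def[abs_def] dist mult.assoc)
  also have "\<dots> = (\<integral>\<^sup>+s. H (- t m + 1 * s) \<partial>lborel)"
    using nn_integral_real_affine[OF H, of 1 "- t m"] by simp
  finally show "(\<integral>\<^sup>+r. h r \<partial>mu_edge T e) = (\<integral>\<^sup>+s. ennreal (gauss s) * h (s - t m) * indicator (piece m) s \<partial>lborel)"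
    unfolding shift .
  have "(\<lambda>s. H (- t m + 1 * s)) \<in> borel_measurable borel" by measurable
  then show "(\<lambda>s. ennreal (gauss s) * h (s - t m) * indicator (piece m) s) \<in> borel_measurable lborel"
    unfolding shift by simp
qed

definition weight :: "real \<Rightarrow> ennreal" where
  "weight s = ennreal (real (branching_fn T (points T) s) * gauss s)"

lemma AE_not_level: "AE s in lborel. s \<notin> level_set"
  by (rule AE_not_in) (simp add: finite_imp_null_set_lborel)

lemma weight_piece: "m \<le> N \<Longrightarrow> s \<in> piece m \<Longrightarrow> weight s = of_nat (card (level_edges m)) * ennreal (gauss s)"
  using gauss_pos[of s] by (simp add: weight_def branching_points ennreal_mult ennreal_of_nat_eq_real_of_nat less_imp_le)

text \<open>Ensures that \<open>nu\<close> and Lebesgue measure have the same null sets on [0,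
  \<infinity>).\<close>

lemma weight_pos: "0 \<le> s \<Longrightarrow> s \<notin> level_set \<Longrightarrow> 0 < weight s"
proof -
  assume s: "0 \<le> s" "s \<notin> level_set"
  then obtain m where m: "m \<le> N" "s \<in> piece m" using piece_cases[OF s] by blast
  have "0 < card (level_edges m)"
    using card_rays_level[OF m(1)] card_rays_pos by (metis gr0I mult_zero_left less_irrefl)
  then show ?thesis using gauss_pos[of s] m unfolding weight_def branching_points[OF m] by simp
qed

lemma sum_ray_points:
  fixes f :: "('a, 'b) point \<Rightarrow> 'c::comm_semiring_1"
  assumes "m \<le> N" "s \<in> piece m"
  shows "(\<Sum>\<rho>\<in>rays T. f (ray_point \<rho> s)) = of_nat (prod_above m) * (\<Sum>e\<in>level_edges m. f (Inner e (s - t m)))"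
proof -
  have fib: "card {\<sigma> \<in> rays T. anc \<sigma> m = anc \<rho> m} = prod_above m" if "\<rho> \<in> rays T" for \<rho>
    using card_rays_below[OF anc_level[OF that assms(1)] assms(1)] by (simp add: rays_below_def)
  have "(\<Sum>\<rho>\<in>rays T. f (ray_point \<rho> s)) = (\<Sum>\<rho>\<in>rays T. f (Inner (anc \<rho> m) (s - t m)))"
    using assms by (intro sum.cong) (auto simp: ray_point_inner)
  also have "\<dots> = of_nat (prod_above m) * (\<Sum>e\<in>(\<lambda>\<rho>. anc \<rho> m) ` rays T. f (Inner e (s - t m)))"
    by (rule sum_const_fibres[OF finite_rays fib])
  finally show ?thesis using anc_image assms by simp
qed

text \<open>On piece m every edge of generation m is passed by the same number of half-lines. The
  sum over these edges is therefore their number times the average over half-lines, and their number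
  is the branching factor in the density of \<open>nu\<close>.\<close>

lemma nn_integral_mu:
  assumes h: "h \<in> borel_measurable (mu T)"
  shows "(\<integral>\<^sup>+x. h x \<partial>mu T) = (\<integral>\<^sup>+s. weight s * ((\<Sum>\<rho>\<in>rays T. h (ray_point \<rho> s)) / of_nat (card (rays T))) * indicator {0..} s \<partial>lborel)"
proof -
  have hI: "(\<lambda>r. h (Inner e r)) \<in> borel_measurable (restrict_space lborel (open_ivl T e))" if "e \<in> edges T" for e
    using measurable_compose[OF Inner_measurable[OF that], of h borel] h by (simp add: measurable_mu)
  define F where "F m e s = ennreal (gauss s) * h (Inner e (s - t m)) * indicator (piece m) s" for m e s
  have F: "(\<integral>\<^sup>+r. h (Inner e r) \<partial>mu_edge T e) = (\<integral>\<^sup>+s. F m e s \<partial>lborel)" "F m e \<in> borel_measurable lborel"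
    if "e \<in> level_edges m" "m \<le> N" for m e
    using nn_integral_mu_edge_shift[OF that hI[OF level_edges_edges[OF that(1)]]]
    by (auto simp: F_def[abs_def])
  have "(\<integral>\<^sup>+x. h x \<partial>mu T) = (\<Sum>m\<le>N. \<Sum>e\<in>level_edges m. \<integral>\<^sup>+r. h (Inner e r) \<partial>mu_edge T e)"
    unfolding nn_integral_mu_edges[OF h] edges_eq_Union
    by (rule sum.UNION_disjoint) (auto simp: finite_level_edges dest: level_edges_unique)
  also have "\<dots> = (\<Sum>m\<le>N. \<Sum>e\<in>level_edges m. \<integral>\<^sup>+s. F m e s \<partial>lborel)"
    using F by (intro sum.cong) auto
  also have "\<dots> = (\<Sum>m\<le>N. \<integral>\<^sup>+s. (\<Sum>e\<in>level_edges m. F m e s) \<partial>lborel)"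
    by (intro sum.cong refl nn_integral_sum[symmetric] F(2)) auto
  also have "\<dots> = (\<integral>\<^sup>+s. (\<Sum>m\<le>N. \<Sum>e\<in>level_edges m. F m e s) \<partial>lborel)"
    by (intro nn_integral_sum[symmetric] borel_measurable_sum F(2)) auto
  also have "\<dots> = (\<integral>\<^sup>+s. weight s * ((\<Sum>\<rho>\<in>rays T. h (ray_point \<rho> s)) / of_nat (card (rays T))) * indicator {0..} s \<partial>lborel)"
  proof (rule nn_integral_cong_AE, rule AE_mp[OF AE_not_level], intro AE_I2 impI)
    fix s assume s: "s \<notin> level_set"
    show "(\<Sum>m\<le>N. \<Sum>e\<in>level_edges m. F m e s) =
      weight s * ((\<Sum>\<rho>\<in>rays T. h (ray_point \<rho> s)) / of_nat (card (rays T))) * indicator {0..} s"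
    proof (cases "0 \<le> s")
      case True
      then obtain m where m: "m \<le> N" "s \<in> piece m" using piece_cases[OF True s] by blast
      have "(\<Sum>k\<le>N. \<Sum>e\<in>level_edges k. F k e s) = (\<Sum>k\<le>N. if k = m then \<Sum>e\<in>level_edges m. F m e s else 0)"
        using piece_unique[OF _ m(2) _ m(1)] by (intro sum.cong refl) (auto simp: F_def indicator_def)
      also have "\<dots> = ennreal (gauss s) * (\<Sum>e\<in>level_edges m. h (Inner e (s - t m)))"
        using m by (simp add: F_def sum_distrib_left)
      \<comment> \<open>Inserts a factor 1: the number of half-lines, counted by their edges of
        generation m, over itself.\<close>
      also have "\<dots> = ennreal (gauss s) * (\<Sum>e\<in>level_edges m. h (Inner e (s - t m))) * (of_nat (card (level_edges m) * prod_above m) / of_nat (card (rays T)))"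
      proof -
        have "(of_nat (card (level_edges m) * prod_above m) / of_nat (card (rays T)) :: ennreal) = 1"
          unfolding card_rays_level[OF m(1), symmetric] using card_rays_pos
          by (intro ennreal_divide_self) (auto simp: ennreal_of_nat_eq_real_of_nat)
        then show ?thesis by simp
      qed
      also have "\<dots> = weight s * ((\<Sum>\<rho>\<in>rays T. h (ray_point \<rho> s)) / of_nat (card (rays T)))"
        unfolding weight_piece[OF m] sum_ray_points[OF m, of h]
        by (simp add: divide_ennreal_def algebra_simps)
      finally show ?thesis using True by simp
    next
      case False
      then have "s \<notin> piece m" if "m \<le> N" for m
        using piece_gt[of s m] t_nonneg[OF that] by auto
      then show ?thesis using False by (simp add: F_def)
    qed
  qed
  finally show ?thesis .
qed

section \<open>Measurability and null sets for the radial measure\<close>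

lemma measurable_cong_finite:
  fixes f g :: "real \<Rightarrow> complex"
  assumes "f \<in> borel_measurable (restrict_space borel {c..})" "\<And>s. c \<le> s \<Longrightarrow> s \<notin> level_set \<Longrightarrow> f s = g s"
  shows "g \<in> borel_measurable (restrict_space borel {c..})"
proof (rule measurable_discrete_difference[OF assms(1), of "level_set \<inter> {c..}"])
  show "{x} \<in> sets (restrict_space borel {c..})" if "x \<in> level_set \<inter> {c..}" for x
    using that by (auto simp: sets_restrict_space_iff)
qed (use assms(2) in \<open>auto simp: space_restrict_space countable_finite\<close>)

lemma indicator_piece:
  "m \<le> N \<Longrightarrow> s \<in> piece m \<Longrightarrow> k \<le> N \<Longrightarrow> indicator (piece k) s = (if k = m then 1 else 0 :: 'c::zero_neq_one)"
  by (cases "s \<in> piece k") (auto dest: piece_unique)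

text \<open>A cardinality depending on s carries no measurability of its own, but off the levels it
  is constant on each piece.\<close>

lemma weight_measurable: "weight \<in> borel_measurable (restrict_space borel {0..})"
proof (rule measurable_discrete_difference[of "\<lambda>s. \<Sum>m\<le>N. of_nat (card (level_edges m)) * ennreal (gauss s) * indicator (piece m) s" _ _ "level_set \<inter> {0..}"])
  show "(\<lambda>s. \<Sum>m\<le>N. of_nat (card (level_edges m)) * ennreal (gauss s) * indicator (piece m) s) \<in> borel_measurable (restrict_space borel {0..})"
    by (intro measurable_restrict_space1) measurable
  show "{x} \<in> sets (restrict_space borel {0..})" if "x \<in> level_set \<inter> {0..}" for x
    using that by (auto simp: sets_restrict_space_iff)
  fix s assume "s \<in> space (restrict_space borel {0::real..})" "s \<notin> level_set \<inter> {0..}"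
  then have s: "0 \<le> s" "s \<notin> level_set" by (auto simp: space_restrict_space)
  obtain m where m: "m \<le> N" "s \<in> piece m" using piece_cases[OF s] by blast
  have "(\<Sum>k\<le>N. of_nat (card (level_edges k)) * ennreal (gauss s) * indicator (piece k) s) =
      (\<Sum>k\<le>N. if k = m then weight s else 0)"
    by (intro sum.cong refl) (simp add: indicator_piece[OF m] weight_piece[OF m])
  then show "(\<Sum>k\<le>N. of_nat (card (level_edges k)) * ennreal (gauss s) * indicator (piece k) s) = weight s"
    using m by simp
qed (auto simp: countable_finite)

lemma space_nu: "space (nu T) = {0..}" and sets_nu: "sets (nu T) = sets (restrict_space borel {0..})"
  by (simp_all add: nu_def space_restrict_space sets_restrict_space)

lemma measurable_nu_from: "0 \<le> c \<Longrightarrow> measurable (nu_from T c) M = measurable (restrict_space borel {c..}) M"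
proof (rule measurable_cong_sets)
  assume c: "0 \<le> c"
  have "sets (nu_from T c) = (\<inter>) {c..} ` (\<inter>) {0..} ` sets borel"
    by (simp add: nu_from_def sets_restrict_space sets_nu)
  also have "\<dots> = (\<inter>) {c..} ` sets borel"
  proof -
    have "{c..} \<inter> ({0..} \<inter> A) = {c..} \<inter> A" for A using c by auto
    then show ?thesis by (simp add: image_image)
  qed
  finally show "sets (nu_from T c) = sets (restrict_space borel {c..})" by (simp add: sets_restrict_space)
qed simp

lemma nn_integral_nu_from:
  assumes c: "0 \<le> c" and h: "h \<in> borel_measurable (restrict_space borel {c..})"
  shows "(\<integral>\<^sup>+s. h s \<partial>nu_from T c) = (\<integral>\<^sup>+s. weight s * h s * indicator {c..} s \<partial>lborel)"
proof -
  have sub: "{c..} \<inter> {0..} \<in> sets (nu T)"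
    using c by (auto simp: sets_nu sets_restrict_space_iff)
  have ind: "(\<lambda>s. h s * indicator {c..} s) \<in> borel_measurable borel"
    using h by (subst (asm) borel_measurable_restrict_space_iff_ennreal) auto
  have m0: "measurable (restrict_space lborel {0..}) borel = measurable (restrict_space borel {0::real..}) (borel :: ennreal measure)"
    by (rule measurable_cong_sets) (simp_all add: sets_restrict_space)
  have "(\<integral>\<^sup>+s. h s \<partial>nu_from T c) = (\<integral>\<^sup>+s. h s * indicator {c..} s \<partial>nu T)"
    unfolding nu_from_def by (rule nn_integral_restrict_space) (use sub in \<open>simp add: space_nu\<close>)
  also have "\<dots> = (\<integral>\<^sup>+s. weight s * (h s * indicator {c..} s) \<partial>restrict_space lborel {0..})"
    unfolding nu_def weight_def[symmetric]
    by (rule nn_integral_density) (use weight_measurable ind in \<open>auto simp: m0 intro: measurable_restrict_space1\<close>)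
  also have "\<dots> = (\<integral>\<^sup>+s. weight s * (h s * indicator {c..} s) * indicator {0..} s \<partial>lborel)"
    by (rule nn_integral_restrict_space) auto
  also have "\<dots> = (\<integral>\<^sup>+s. weight s * h s * indicator {c..} s \<partial>lborel)"
    using c by (intro nn_integral_cong) (auto simp: indicator_def)
  finally show ?thesis .
qed

lemma AE_nu_from:
  assumes "0 \<le> c"
  shows "(AE s in nu_from T c. Q s) \<longleftrightarrow> (AE s in lborel. c \<le> s \<longrightarrow> Q s)"
proof -
  have sub: "{c..} \<inter> {0..} \<in> sets (nu T)"
    using assms by (auto simp: sets_nu sets_restrict_space_iff)
  have m0: "measurable (restrict_space lborel {0..}) borel = measurable (restrict_space borel {0::real..}) (borel :: ennreal measure)"
    by (rule measurable_cong_sets) (simp_all add: sets_restrict_space)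
  have "(AE s in nu_from T c. Q s) \<longleftrightarrow> (AE s in nu T. c \<le> s \<longrightarrow> Q s)"
    unfolding nu_from_def by (subst AE_restrict_space_iff) (use sub in \<open>auto simp: space_nu\<close>)
  also have "\<dots> \<longleftrightarrow> (AE s in restrict_space lborel {0..}. 0 < weight s \<longrightarrow> c \<le> s \<longrightarrow> Q s)"
    unfolding nu_def weight_def[symmetric] by (rule AE_density) (use weight_measurable m0 in simp)
  also have "\<dots> \<longleftrightarrow> (AE s in lborel. 0 \<le> s \<longrightarrow> 0 < weight s \<longrightarrow> c \<le> s \<longrightarrow> Q s)"
    by (subst AE_restrict_space_iff) auto
  also have "\<dots> \<longleftrightarrow> (AE s in lborel. c \<le> s \<longrightarrow> Q s)"
  proof
    assume "AE s in lborel. 0 \<le> s \<longrightarrow> 0 < weight s \<longrightarrow> c \<le> s \<longrightarrow> Q s"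
    with AE_not_level show "AE s in lborel. c \<le> s \<longrightarrow> Q s"
      by eventually_elim (use assms weight_pos in auto)
  next
    assume "AE s in lborel. c \<le> s \<longrightarrow> Q s"
    then show "AE s in lborel. 0 \<le> s \<longrightarrow> 0 < weight s \<longrightarrow> c \<le> s \<longrightarrow> Q s"
      by eventually_elim simp
  qed
  finally show ?thesis .
qed

text \<open>Off the levels, f along \<rho> is a finite sum of shifted restrictions to edges, one for
  each piece.\<close>

lemma ray_measurable:
  fixes f :: "('a, 'b) point \<Rightarrow> complex"
  assumes f: "f \<in> borel_measurable (mu T)" and \<rho>: "\<rho> \<in> rays T" and c: "0 \<le> c"
  shows "(\<lambda>s. f (ray_point \<rho> s)) \<in> borel_measurable (restrict_space borel {c..})"
proof (rule measurable_cong_finite)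
  have "(\<lambda>s. indicator (piece m) s *\<^sub>R f (Inner (anc \<rho> m) (s - t m))) \<in> borel_measurable borel" if m: "m \<le> N" for m
  proof -
    note l = anc_level[OF \<rho> m]
    have "(\<lambda>r. f (Inner (anc \<rho> m) r)) \<in> borel_measurable (restrict_space lborel (open_ivl T (anc \<rho> m)))"
      using measurable_compose[OF Inner_measurable[OF level_edges_edges[OF l]], of f borel] f by (simp add: measurable_mu)
    then have "(\<lambda>r. indicator (open_ivl T (anc \<rho> m)) r *\<^sub>R f (Inner (anc \<rho> m) r)) \<in> borel_measurable borel"
      by (subst (asm) borel_measurable_restrict_space_iff) auto
    then have "(\<lambda>s. indicator (open_ivl T (anc \<rho> m)) (s - t m) *\<^sub>R f (Inner (anc \<rho> m) (s - t m))) \<in> borel_measurable borel"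
      by (rule measurable_compose[rotated]) measurable
    moreover have "indicator (open_ivl T (anc \<rho> m)) (s - t m) = (indicator (piece m) s :: real)" for s
      using open_ivl_level(1)[OF l m] by (simp add: indicator_def)
    ultimately show ?thesis by simp
  qed
  then have "(\<lambda>s. \<Sum>m\<le>N. indicator (piece m) s *\<^sub>R f (Inner (anc \<rho> m) (s - t m))) \<in> borel_measurable borel"
    by (intro borel_measurable_sum) auto
  then show "(\<lambda>s. \<Sum>m\<le>N. indicator (piece m) s *\<^sub>R f (Inner (anc \<rho> m) (s - t m))) \<in> borel_measurable (restrict_space borel {c..})"
    by (rule measurable_restrict_space1)
  fix s assume s: "c \<le> s" "s \<notin> level_set"
  obtain m where m: "m \<le> N" "s \<in> piece m" using piece_cases[OF order_trans[OF c s(1)] s(2)] by blast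
  have "(\<Sum>k\<le>N. indicator (piece k) s *\<^sub>R f (Inner (anc \<rho> k) (s - t k))) = (\<Sum>k\<le>N. if k = m then f (ray_point \<rho> s) else 0)"
    by (intro sum.cong refl) (simp add: indicator_piece[OF m] ray_point_inner[OF \<rho> m])
  then show "(\<Sum>k\<le>N. indicator (piece k) s *\<^sub>R f (Inner (anc \<rho> k) (s - t k))) = f (ray_point \<rho> s)"
    using m by simp
qed

end

section \<open>Components and Parseval's identity\<close>

lemma L2_iff: "f \<in> L2 M \<longleftrightarrow> f \<in> borel_measurable M \<and> (\<integral>\<^sup>+x. ennreal ((cmod (f x))\<^sup>2) \<partial>M) < \<infinity>"
  by (auto simp: L2_def integrable_iff_bounded)

lemma L2_nn_integral: "f \<in> L2 M \<Longrightarrow> (\<integral>\<^sup>+x. ennreal ((cmod (f x))\<^sup>2) \<partial>M) = ennreal (\<integral>x. (cmod (f x))\<^sup>2 \<partial>M)"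
  by (rule nn_integral_eq_integral) (auto simp: L2_def)

lemma L2_add:
  assumes f: "f \<in> L2 M" and g: "g \<in> L2 M"
  shows "(\<lambda>x. f x + g x) \<in> L2 M"
proof -
  have [measurable]: "f \<in> borel_measurable M" "g \<in> borel_measurable M"
    using f g by (auto simp: L2_def)
  have "integrable M (\<lambda>x. (cmod (f x + g x))\<^sup>2)"
  proof (rule Bochner_Integration.integrable_bound)
    show "integrable M (\<lambda>x. 2 * (cmod (f x))\<^sup>2 + 2 * (cmod (g x))\<^sup>2)"
      using f g by (auto simp: L2_def)
    have "(cmod (u + v))\<^sup>2 \<le> 2 * (cmod u)\<^sup>2 + 2 * (cmod v)\<^sup>2" for u v
    proof -
      have "(cmod (u + v))\<^sup>2 \<le> (cmod u + cmod v)\<^sup>2"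
        by (intro power_mono norm_triangle_ineq) simp
      also have "\<dots> \<le> 2 * (cmod u)\<^sup>2 + 2 * (cmod v)\<^sup>2"
        using zero_le_power2[of "cmod u - cmod v"] by (simp add: power2_eq_square algebra_simps)
      finally show ?thesis .
    qed
    then show "AE x in M. norm ((cmod (f x + g x))\<^sup>2) \<le> norm (2 * (cmod (f x))\<^sup>2 + 2 * (cmod (g x))\<^sup>2)"
      by (intro AE_I2) (simp add: abs_of_nonneg)
  qed measurable
  then show ?thesis by (simp add: L2_def)
qed

lemma L2_cmult: "f \<in> L2 M \<Longrightarrow> (\<lambda>x. c * f x) \<in> L2 M"
  by (auto simp: L2_def norm_mult power_mult_distrib)

lemma L2_zero: "(\<lambda>x. 0) \<in> L2 M"
  by (simp add: L2_def)

lemma L2_sum: "finite A \<Longrightarrow> (\<And>i. i \<in> A \<Longrightarrow> f i \<in> L2 M) \<Longrightarrow> (\<lambda>x. \<Sum>i\<in>A. f i x) \<in> L2 M"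
  by (induction rule: finite_induct) (auto intro: L2_add L2_zero)

text \<open>The totals of the positive and of the negative parts differ by the sum of the q i. This
  turns a cancellation over half-lines into an equality of nonnegative integrals.\<close>

lemma sum_ennreal_pos_neg:
  fixes q :: "'i \<Rightarrow> real"
  assumes "finite A" "(\<Sum>i\<in>A. q i) = 0"
  shows "(\<Sum>i\<in>A. ennreal (q i)) = (\<Sum>i\<in>A. ennreal (- q i))"
proof -
  have "ennreal x = ennreal (max 0 x)" for x :: real
    by (simp add: max_def ennreal_neg)
  then have "(\<Sum>i\<in>A. ennreal (f i)) = ennreal (\<Sum>i\<in>A. max 0 (f i))" for f
    by (subst sum_ennreal[symmetric]) auto
  moreover have "(\<Sum>i\<in>A. max 0 (q i)) - (\<Sum>i\<in>A. max 0 (- q i)) = (\<Sum>i\<in>A. q i)"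
    unfolding sum_subtractf[symmetric] by (intro sum.cong) (auto simp: max_def)
  ultimately show ?thesis using assms(2) by simp
qed

context regular_metric_tree
begin

lemma level_set_nonneg: "s \<in> level_set \<Longrightarrow> 0 \<le> s"
  using t_nonneg by auto

text \<open>\<open>nn_integral_mu\<close> handles nonnegative integrands only; complex ones are
  reduced to it through real and imaginary, positive and negative parts. A nonintegrable q has
  integral 0 by convention.\<close>

lemma integral_mu_eq_0:
  fixes q :: "('a, 'b) point \<Rightarrow> complex"
  assumes q: "q \<in> borel_measurable (mu T)"
    and zero: "AE s in lborel. 0 \<le> s \<longrightarrow> (\<Sum>\<rho>\<in>rays T. q (ray_point \<rho> s)) = 0"
  shows "(\<integral>x. q x \<partial>mu T) = 0"
proof -
  have real: "(\<integral>x. p x \<partial>mu T) = 0"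
    if p: "p \<in> borel_measurable (mu T)" "AE s in lborel. 0 \<le> s \<longrightarrow> (\<Sum>\<rho>\<in>rays T. p (ray_point \<rho> s)) = 0" for p :: "_ \<Rightarrow> real"
  proof (cases "integrable (mu T) p")
    case True
    have "(\<integral>\<^sup>+x. ennreal (p x) \<partial>mu T) = (\<integral>\<^sup>+x. ennreal (- p x) \<partial>mu T)"
    proof -
      have "AE s in lborel. weight s * ((\<Sum>\<rho>\<in>rays T. ennreal (p (ray_point \<rho> s))) / of_nat (card (rays T))) * indicator {0..} s =
          weight s * ((\<Sum>\<rho>\<in>rays T. ennreal (- p (ray_point \<rho> s))) / of_nat (card (rays T))) * indicator {0..} s"
        using p(2)
      proof eventually_elim
        case (elim s)
        then show ?case
          using sum_ennreal_pos_neg[OF finite_rays, of "\<lambda>\<rho>. p (ray_point \<rho> s)"] by (auto simp: indicator_def)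
      qed
      then show ?thesis
        using p(1) by (subst (1 2) nn_integral_mu) (auto intro: nn_integral_cong_AE)
    qed
    then show ?thesis using True by (simp add: real_lebesgue_integral_def)
  qed (simp add: not_integrable_integral_eq)
  show ?thesis
  proof (cases "integrable (mu T) q")
    case True
    have "AE s in lborel. 0 \<le> s \<longrightarrow> (\<Sum>\<rho>\<in>rays T. Re (q (ray_point \<rho> s))) = 0"
      using zero by eventually_elim (simp add: Re_sum[symmetric])
    moreover have "AE s in lborel. 0 \<le> s \<longrightarrow> (\<Sum>\<rho>\<in>rays T. Im (q (ray_point \<rho> s))) = 0"
      using zero by eventually_elim (simp add: Im_sum[symmetric])
    ultimately have "(\<integral>x. Re (q x) \<partial>mu T) = 0" "(\<integral>x. Im (q x) \<partial>mu T) = 0"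
      using real[of "\<lambda>x. Re (q x)"] real[of "\<lambda>x. Im (q x)"] q by auto
    then show ?thesis using True by (simp add: complex_eq_iff integral_Re integral_Im)
  qed (simp add: not_integrable_integral_eq)
qed

lemma AE_not_Vertex: "AE x in mu T. \<exists>e r. x = Inner e r"
proof -
  have trace: "edge_trace T e (points T \<inter> range Vertex) = {}" for e
    by (auto simp: edge_trace_def)
  then have sets: "points T \<inter> range Vertex \<in> sets (tree_length T)"
    by (auto simp: sets_tree_length)
  have "points T \<inter> range Vertex \<in> null_sets (tree_length T)"
    using emeasure_tree_length[OF finite_edges sets] sets trace by (auto simp: null_sets_def)
  then have "AE x in tree_length T. \<exists>e r. x = Inner e r"
    by (rule AE_I') (auto simp: space_tree_length; metis point.exhaust rangeI)
  then show ?thesis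
    unfolding mu_def using root_dist_measurable by (subst AE_density) auto
qed

lemma Inner_eq_ray_point:
  assumes "Inner e r \<in> points T"
  obtains m \<rho> where "m \<le> N" "t m + r \<in> piece m" "\<rho> \<in> rays T" "anc \<rho> m = e" "Inner e r = ray_point \<rho> (t m + r)"
proof -
  have e: "e \<in> edges T" "r \<in> open_ivl T e" using assms by (auto simp: Inner_points)
  then obtain m where m: "m \<le> N" "e \<in> level_edges m" using edge_level by metis
  obtain \<rho> where \<rho>: "\<rho> \<in> rays T" "anc \<rho> m = e" using rays_below_nonempty[OF m(2,1)] by (auto simp: rays_below_def)
  have p: "t m + r \<in> piece m" using open_ivl_level(1)[OF m(2,1)] e by simp
  show ?thesis using that[OF m(1) p \<rho>] ray_point_inner[OF \<rho>(1) m(1) p] \<rho> by simp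
qed

lemma subtree_sets:
  assumes "e \<in> edges T"
  shows "subtree T e \<in> sets (mu T)"
proof -
  have "edge_trace T e' (subtree T e) \<in> sets borel" if "e' \<in> edges T" for e'
  proof -
    have "edge_trace T e' (subtree T e) = (if e \<in> set (edge_walk e') then open_ivl T e' else {})"
      using Inner_subtree[OF assms that] by (auto simp: edge_trace_def)
    then show ?thesis by auto
  qed
  then show ?thesis
    using subtree_points[OF assms] by (simp add: mu_def sets_tree_length)
qed

lemma points_sets: "points T \<in> sets (mu T)"
  using sets.top[of "tree_length T"] by (simp add: mu_def space_tree_length)

text \<open>At radius s every half-line contributes at most |\<phi> s|^2, hence so does their
  average.\<close>

lemma radial_function_L2:
  fixes \<phi> :: "real \<Rightarrow> complex"
  assumes S: "S \<in> sets (mu T)" and \<phi>: "\<phi> \<in> borel_measurable borel"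
    and fin: "(\<integral>\<^sup>+s. weight s * ennreal ((cmod (\<phi> s))\<^sup>2) * indicator {0..} s \<partial>lborel) < \<infinity>"
  shows "(\<lambda>x. if x \<in> S then \<phi> (root_dist T x) else 0) \<in> L2 (mu T)"
  unfolding L2_iff
proof
  have rd: "root_dist T \<in> borel_measurable (mu T)" using root_dist_measurable by (simp add: measurable_mu)
  show meas: "(\<lambda>x. if x \<in> S then \<phi> (root_dist T x) else 0) \<in> borel_measurable (mu T)"
    using S measurable_compose[OF rd \<phi>] by measurable
  have "(\<integral>\<^sup>+x. ennreal ((cmod (if x \<in> S then \<phi> (root_dist T x) else 0))\<^sup>2) \<partial>mu T) =
      (\<integral>\<^sup>+s. weight s * ((\<Sum>\<rho>\<in>rays T. ennreal ((cmod (if ray_point \<rho> s \<in> S then \<phi> (root_dist T (ray_point \<rho> s)) else 0))\<^sup>2)) / of_nat (card (rays T))) * indicator {0..} s \<partial>lborel)"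
    by (rule nn_integral_mu, rule measurable_compose[OF meas]) measurable
  also have "\<dots> \<le> (\<integral>\<^sup>+s. weight s * ennreal ((cmod (\<phi> s))\<^sup>2) * indicator {0..} s \<partial>lborel)"
  proof (rule nn_integral_mono_AE, rule AE_mp[OF AE_not_level], intro AE_I2 impI)
    fix s assume s: "s \<notin> level_set"
    show "weight s * ((\<Sum>\<rho>\<in>rays T. ennreal ((cmod (if ray_point \<rho> s \<in> S then \<phi> (root_dist T (ray_point \<rho> s)) else 0))\<^sup>2)) / of_nat (card (rays T))) * indicator {0..} s
      \<le> weight s * ennreal ((cmod (\<phi> s))\<^sup>2) * indicator {0..} s"
    proof (cases "0 \<le> s")
      case True
      obtain m where m: "m \<le> N" "s \<in> piece m" using piece_cases[OF True s] by blast
      have "(\<Sum>\<rho>\<in>rays T. ennreal ((cmod (if ray_point \<rho> s \<in> S then \<phi> (root_dist T (ray_point \<rho> s)) else 0))\<^sup>2)) \<le>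
          (\<Sum>\<rho>\<in>rays T. ennreal ((cmod (\<phi> s))\<^sup>2))"
        using root_dist_ray_point[OF _ m] by (intro sum_mono) auto
      then have "(\<Sum>\<rho>\<in>rays T. ennreal ((cmod (if ray_point \<rho> s \<in> S then \<phi> (root_dist T (ray_point \<rho> s)) else 0))\<^sup>2)) / of_nat (card (rays T)) \<le>
          of_nat (card (rays T)) * ennreal ((cmod (\<phi> s))\<^sup>2) / of_nat (card (rays T))"
        by (intro divide_right_mono_ennreal) simp
      also have "\<dots> = ennreal ((cmod (\<phi> s))\<^sup>2)"
        using card_rays_pos by (subst mult.commute, subst ennreal_mult_divide_eq) (auto simp: ennreal_of_nat_eq_real_of_nat)
      finally show ?thesis by (intro mult_right_mono mult_left_mono) auto
    qed simp
  qed
  finally show "(\<integral>\<^sup>+x. ennreal ((cmod (if x \<in> S then \<phi> (root_dist T x) else 0))\<^sup>2) \<partial>mu T) < \<infinity>"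
    using fin by (rule le_less_trans)
qed

section \<open>Radial spaces and points chosen on spheres\<close>

lemma radial_spaceI:
  assumes "f \<in> L2 (mu T)" "\<And>x. x \<in> points T \<Longrightarrow> x \<notin> S \<Longrightarrow> f x = 0"
    "\<And>x y. x \<in> S \<Longrightarrow> y \<in> S \<Longrightarrow> root_dist T x = root_dist T y \<Longrightarrow> f x = f y"
  shows "f \<in> radial_space T S"
  unfolding radial_space_def using assms by blast

lemma radial_spaceD:
  assumes "f \<in> radial_space T S"
  shows "f \<in> L2 (mu T)" "x \<in> points T \<Longrightarrow> x \<notin> S \<Longrightarrow> f x = 0"
    "x \<in> S \<Longrightarrow> y \<in> S \<Longrightarrow> root_dist T x = root_dist T y \<Longrightarrow> f x = f y"
  using assms unfolding radial_space_def by blast+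

lemma radial_space_add:
  assumes "f \<in> radial_space T S" "g \<in> radial_space T S"
  shows "(\<lambda>x. f x + g x) \<in> radial_space T S"
proof (rule radial_spaceI)
  show "(\<lambda>x. f x + g x) \<in> L2 (mu T)"
    by (intro L2_add radial_spaceD(1)[OF assms(1)] radial_spaceD(1)[OF assms(2)])
  show "f x + g x = 0" if "x \<in> points T" "x \<notin> S" for x
    using radial_spaceD(2)[OF assms(1) that] radial_spaceD(2)[OF assms(2) that] by simp
  show "f x + g x = f y + g y" if "x \<in> S" "y \<in> S" "root_dist T x = root_dist T y" for x y
    using radial_spaceD(3)[OF assms(1) that] radial_spaceD(3)[OF assms(2) that] by simp
qed

lemma radial_space_cmult:
  assumes "f \<in> radial_space T S"
  shows "(\<lambda>x. c * f x) \<in> radial_space T S"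
proof (rule radial_spaceI)
  show "(\<lambda>x. c * f x) \<in> L2 (mu T)"
    by (intro L2_cmult radial_spaceD(1)[OF assms])
  show "c * f x = 0" if "x \<in> points T" "x \<notin> S" for x
    using radial_spaceD(2)[OF assms that] by simp
  show "c * f x = c * f y" if "x \<in> S" "y \<in> S" "root_dist T x = root_dist T y" for x y
    using radial_spaceD(3)[OF assms that] by simp
qed

lemma radial_space_zero: "(\<lambda>x. 0) \<in> radial_space T S"
  by (rule radial_spaceI) (auto simp: L2_zero)

lemma radial_space_subspace: "L2_subspace (mu T) (radial_space T S)"
  unfolding L2_subspace_def
  by (auto intro: radial_spaceD(1) radial_space_zero radial_space_add radial_space_cmult)

lemma SOME_point:
  assumes "m \<le> N" "s \<in> piece m"
  defines "x \<equiv> SOME x. x \<in> points T \<and> root_dist T x = s"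
  shows "x \<in> points T" "root_dist T x = s"
proof -
  obtain \<rho> where "\<rho> \<in> rays T" using card_rays_pos by (auto simp: card_gt_0_iff)
  then have "\<exists>x. x \<in> points T \<and> root_dist T x = s"
    using ray_point_points root_dist_ray_point assms(1,2) by blast
  then show "x \<in> points T" "root_dist T x = s"
    unfolding x_def by (metis (mono_tags, lifting) someI_ex)+
qed

lemma SOME_subtree_point:
  assumes "m \<le> N" "s \<in> piece m" "e \<in> level_edges k" "k \<le> m"
  defines "x \<equiv> SOME x. x \<in> subtree T e \<and> root_dist T x = s"
  shows "x \<in> subtree T e" "root_dist T x = s"
proof -
  have "k \<le> N" using assms by simp
  then obtain \<rho> where "\<rho> \<in> rays T" "anc \<rho> k = e"
    using rays_below_nonempty[OF assms(3)] by (auto simp: rays_below_def)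
  then have "\<exists>x. x \<in> subtree T e \<and> root_dist T x = s"
    using ray_point_subtree[of \<rho> m s e k] root_dist_ray_point[of \<rho> m s] assms(1-4) \<open>k \<le> N\<close> by auto
  then show "x \<in> subtree T e" "root_dist T x = s"
    unfolding x_def by (metis (mono_tags, lifting) someI_ex)+
qed

end

context enumerated_tree
begin

section \<open>Components as Haar coefficients\<close>

abbreviation ray_values :: "(('a, 'b) point \<Rightarrow> complex) \<Rightarrow> real \<Rightarrow> 'b \<Rightarrow> complex" where
  "ray_values f s \<equiv> \<lambda>\<rho>. f (ray_point \<rho> s)"

definition component :: "(nat \<times> 'a \<times> nat) option \<Rightarrow> (('a, 'b) point \<Rightarrow> complex) \<Rightarrow> real \<Rightarrow> complex" where
  "component i f = (case i of None \<Rightarrow> root_component T f | Some (k, v, j) \<Rightarrow> mode_component T b E k v j f)"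

definition start :: "(nat \<times> 'a \<times> nat) option \<Rightarrow> real" where
  "start i = (case i of None \<Rightarrow> 0 | Some (k, v, j) \<Rightarrow> t k)"

lemma index_cases:
  assumes "i \<in> I"
  obtains "i = None" | k v j where "i = Some (k, v, j)" "k \<le> N" "v \<in> V k" "j \<in> {1..b k - 1}"
  using assms by (auto simp: summand_index_def)

lemma start_level_set: "i \<in> I \<Longrightarrow> start i \<in> level_set"
  by (erule index_cases) (auto simp: start_def t_0[symmetric])

lemma start_nonneg: "i \<in> I \<Longrightarrow> 0 \<le> start i"
  using start_level_set level_set_nonneg by blast

lemma root_component_eq_haar_coeff:
  assumes "m \<le> N" "s \<in> piece m"
  shows "root_component T f s = haar_coeff (ray_values f s) None"
  using SOME_point[OF assms] sphere_sum_points[OF assms, of f]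
  by (simp add: root_component_def J_root_def radial_proj_def haar_coeff_def haar_None sum_divide_distrib)

lemma haar_coeff_mode:
  assumes "k \<le> N" "v \<in> V k"
  shows "haar_coeff F (Some (k, v, j)) = (\<Sum>r=1..b k. cnj (fourier_vec b k j r) * (\<Sum>\<rho>\<in>rays_below k (E v r). F \<rho>)) /
    (of_nat (prod_above k) * of_real (sqrt (real (\<Prod>i\<le>k. b i))))"
proof -
  define c where "c = complex_of_nat (prod_above k) * of_real (sqrt (real (\<Prod>i\<le>k. b i)))"
  have below: "(\<Sum>\<rho>\<in>rays T. of_bool (anc \<rho> k = E v r) * F \<rho>) = (\<Sum>\<rho>\<in>rays_below k (E v r). F \<rho>)" for r
    unfolding rays_below_def sum.inter_filter[OF finite_rays] by (intro sum.cong) auto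
  have "haar_coeff F (Some (k, v, j)) = (\<Sum>\<rho>\<in>rays T. \<Sum>r=1..b k. cnj (fourier_vec b k j r) * (of_bool (anc \<rho> k = E v r) * F \<rho>) / c)"
  proof -
    have "cnj c = c" by (simp add: c_def)
    then have "cnj (fourier_vec b k j r * of_bool P / c) * x = cnj (fourier_vec b k j r) * (of_bool P * x) / c" for r P x
      by (cases P) simp_all
    then show ?thesis
      unfolding haar_coeff_def haar_def c_def[symmetric] option.case prod.case sum_divide_distrib cnj_sum sum_distrib_right
      by (intro sum.cong refl)
  qed
  also have "\<dots> = (\<Sum>r=1..b k. cnj (fourier_vec b k j r) * (\<Sum>\<rho>\<in>rays T. of_bool (anc \<rho> k = E v r) * F \<rho>)) / c"
    by (subst sum.swap) (simp add: sum_divide_distrib sum_distrib_left)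
  finally show ?thesis unfolding below c_def .
qed

lemma cnj_fourier_vec: "cnj (fourier_vec b k j r) = omega b k powi (- int (r * j)) / of_real (sqrt (real (b k)))"
proof -
  have "omega b k ^ (r * j) * cnj (omega b k ^ (r * j)) = 1" by (rule omega_unit)
  then have "cnj (omega b k ^ (r * j)) = inverse (omega b k ^ (r * j))"
    by (metis inverse_unique)
  then show ?thesis
    unfolding fourier_vec_def power_int_minus power_int_of_nat complex_cnj_divide by simp
qed

text \<open>Projecting to a subtree averages over the half-lines below its edge, and any chosen
  point of the sphere carries that average. Together with the scaling of \<open>J_edge\<close> this
  produces the denominator built into \<open>haar\<close>.\<close>

lemma mode_component_eq_haar_coeff:
  assumes "m \<le> N" "s \<in> piece m" "k \<le> m" "v \<in> V k"
  shows "mode_component T b E k v j f s = haar_coeff (ray_values f s) (Some (k, v, j))"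
proof -
  have k: "k \<le> N" using assms by simp
  have J: "J_edge T b k (E v r) (radial_proj T (subtree T (E v r)) f) s =
      (\<Sum>\<rho>\<in>rays_below k (E v r). f (ray_point \<rho> s)) / (of_nat (prod_above k) * of_real (sqrt (real (\<Prod>i\<le>k. b i))))"
    if "r \<in> {1..b k}" for r
  proof -
    have e: "E v r \<in> level_edges k" using E_level[OF k assms(4) that] by simp
    show ?thesis
      using SOME_subtree_point[OF assms(1,2) e assms(3)] sphere_sum[OF assms(1,2) e assms(3), of f]
      by (simp add: J_edge_def radial_proj_def del: of_nat_prod)
  qed
  show ?thesis
    unfolding haar_coeff_mode[OF k assms(4)] mode_component_def cnj_fourier_vec sum_divide_distrib
    by (intro sum.cong refl) (simp add: J del: of_nat_prod)
qed

text \<open>At radii before v all half-lines through v still coincide, while the mode has mean zero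
  on them.\<close>

lemma haar_coeff_vanish:
  assumes "m \<le> N" "s \<in> piece m" "m < k" "k \<le> N" "v \<in> V k" "j \<in> {1..b k - 1}"
  shows "haar_coeff (ray_values f s) (Some (k, v, j)) = 0"
proof -
  have "(\<Sum>\<rho>\<in>rays T. haar (Some (k, v, j)) \<rho> * cnj (f (ray_point \<rho> s))) = 0"
  proof (rule sum_haar_vanish[OF assms(4-6)])
    fix \<rho> \<sigma> assume *: "\<rho> \<in> rays T" "\<sigma> \<in> rays T" "tail G (anc \<rho> k) = v" "tail G (anc \<sigma> k) = v"
    then have "anc \<rho> m = anc \<sigma> m" using haar_constant_below[OF *(1,2) assms(3,4)] by simp
    then show "cnj (f (ray_point \<rho> s)) = cnj (f (ray_point \<sigma> s))"
      using ray_point_eq_iff[OF *(1,2) assms(1,2)] by simp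
  qed
  then have "cnj (\<Sum>\<rho>\<in>rays T. haar (Some (k, v, j)) \<rho> * cnj (f (ray_point \<rho> s))) = 0" by simp
  then show ?thesis by (simp add: haar_coeff_def)
qed

text \<open>The Haar coefficient is the component extended by 0 to the radii before its starting
  level, where the value of \<open>mode_component\<close> has no meaning. In this way one basis
  serves all radii.\<close>

lemma haar_coeff_eq_component:
  assumes "i \<in> I" "m \<le> N" "s \<in> piece m"
  shows "haar_coeff (ray_values f s) i = (if start i < s then component i f s else 0)"
  using assms(1)
proof (cases rule: index_cases)
  case 1
  have "0 < s" using piece_gt[OF assms(3)] t_nonneg[OF assms(2)] by simp
  then show ?thesis using 1 root_component_eq_haar_coeff[OF assms(2,3)] by (simp add: start_def component_def)
next
  case (2 k v j)
  have "start i < s \<longleftrightarrow> k \<le> m" using piece_less_iff[OF assms(3,2) 2(2)] 2 by (simp add: start_def)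
  then show ?thesis
    using mode_component_eq_haar_coeff[OF assms(2,3) _ 2(3)] haar_coeff_vanish[OF assms(2,3) _ 2(2-4)] 2
    by (auto simp: component_def)
qed

lemma component_measurable:
  assumes f: "f \<in> borel_measurable (mu T)" and i: "i \<in> I"
  shows "component i f \<in> borel_measurable (restrict_space borel {start i..})"
proof (rule measurable_cong_finite)
  show "(\<lambda>s. haar_coeff (ray_values f s) i) \<in> borel_measurable (restrict_space borel {start i..})"
    unfolding haar_coeff_def using ray_measurable[OF f _ start_nonneg[OF i]]
    by (intro borel_measurable_sum borel_measurable_times) auto
  fix s assume s: "start i \<le> s" "s \<notin> level_set"
  obtain m where m: "m \<le> N" "s \<in> piece m" using piece_cases[OF order_trans[OF start_nonneg[OF i] s(1)] s(2)] by blast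
  have "start i < s" using s start_level_set[OF i] by (cases "start i = s") auto
  then show "haar_coeff (ray_values f s) i = component i f s" using haar_coeff_eq_component[OF i m] by simp
qed

text \<open>Stated with nonnegative integrals so that no integrability is presupposed: square
  integrability of the components then comes out as a consequence.\<close>

lemma nn_parseval:
  assumes f: "f \<in> borel_measurable (mu T)"
  shows "(\<integral>\<^sup>+x. ennreal ((cmod (f x))\<^sup>2) \<partial>mu T) =
    (\<Sum>i\<in>I. \<integral>\<^sup>+s. ennreal ((cmod (component i f s))\<^sup>2) \<partial>nu_from T (start i))"
proof -
  define D where "D i s = weight s * ennreal ((cmod (component i f s))\<^sup>2) * indicator {start i..} s" for i s
  have cm: "(\<lambda>s. ennreal ((cmod (component i f s))\<^sup>2)) \<in> borel_measurable (restrict_space borel {start i..})" if "i \<in> I" for i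
    using component_measurable[OF f that] by measurable
  have D: "D i \<in> borel_measurable lborel" if i: "i \<in> I" for i
  proof -
    have "(\<lambda>s. weight s * indicator {0..} s) \<in> borel_measurable borel"
      using weight_measurable by (subst (asm) borel_measurable_restrict_space_iff_ennreal) auto
    moreover have "(\<lambda>s. ennreal ((cmod (component i f s))\<^sup>2) * indicator {start i..} s) \<in> borel_measurable borel"
      using cm[OF i] by (subst (asm) borel_measurable_restrict_space_iff_ennreal) auto
    ultimately have "(\<lambda>s. (weight s * indicator {0..} s) * (ennreal ((cmod (component i f s))\<^sup>2) * indicator {start i..} s)) \<in> borel_measurable borel"
      by (rule borel_measurable_times_ennreal)
    moreover have "(weight s * indicator {0..} s) * (ennreal ((cmod (component i f s))\<^sup>2) * indicator {start i..} s) = D i s" for s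
      using start_nonneg[OF i] by (auto simp: D_def indicator_def)
    ultimately show ?thesis by (simp cong: measurable_cong)
  qed
  have "(\<integral>\<^sup>+x. ennreal ((cmod (f x))\<^sup>2) \<partial>mu T) =
      (\<integral>\<^sup>+s. weight s * ((\<Sum>\<rho>\<in>rays T. ennreal ((cmod (f (ray_point \<rho> s)))\<^sup>2)) / of_nat (card (rays T))) * indicator {0..} s \<partial>lborel)"
    using f by (intro nn_integral_mu) measurable
  also have "\<dots> = (\<integral>\<^sup>+s. (\<Sum>i\<in>I. D i s) \<partial>lborel)"
  proof (rule nn_integral_cong_AE, rule AE_mp[OF AE_not_level], intro AE_I2 impI)
    fix s assume s: "s \<notin> level_set"
    show "weight s * ((\<Sum>\<rho>\<in>rays T. ennreal ((cmod (f (ray_point \<rho> s)))\<^sup>2)) / of_nat (card (rays T))) * indicator {0..} s = (\<Sum>i\<in>I. D i s)"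
    proof (cases "0 \<le> s")
      case True
      obtain m where m: "m \<le> N" "s \<in> piece m" using piece_cases[OF True s] by blast
      have "(\<Sum>\<rho>\<in>rays T. ennreal ((cmod (f (ray_point \<rho> s)))\<^sup>2)) / of_nat (card (rays T)) =
          ennreal (real (card (rays T)) * (\<Sum>i\<in>I. (cmod (haar_coeff (ray_values f s) i))\<^sup>2)) / of_nat (card (rays T))"
        by (simp add: haar_parseval[symmetric] sum_ennreal)
      also have "\<dots> = ennreal (\<Sum>i\<in>I. (cmod (haar_coeff (ray_values f s) i))\<^sup>2)"
        using card_rays_pos by (simp add: ennreal_of_nat_eq_real_of_nat divide_ennreal sum_nonneg)
      also have "\<dots> = (\<Sum>i\<in>I. ennreal ((cmod (component i f s))\<^sup>2) * indicator {start i..} s)"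
      proof (subst sum_ennreal[symmetric], simp, rule sum.cong)
        fix i assume i: "i \<in> I"
        have "start i \<noteq> s" using s start_level_set[OF i] by auto
        then show "ennreal ((cmod (haar_coeff (ray_values f s) i))\<^sup>2) = ennreal ((cmod (component i f s))\<^sup>2) * indicator {start i..} s"
          using haar_coeff_eq_component[OF i m] by (auto simp: indicator_def)
      qed simp
      finally show ?thesis using True by (simp add: D_def sum_distrib_left mult.assoc)
    next
      case False
      then have "indicator {start i..} s = (0 :: ennreal)" if "i \<in> I" for i
        using start_nonneg[OF that] by (simp add: indicator_def)
      then show ?thesis using False by (simp add: D_def)
    qed
  qed
  also have "\<dots> = (\<Sum>i\<in>I. \<integral>\<^sup>+s. D i s \<partial>lborel)"
    by (rule nn_integral_sum[OF D])
  also have "\<dots> = (\<Sum>i\<in>I. \<integral>\<^sup>+s. ennreal ((cmod (component i f s))\<^sup>2) \<partial>nu_from T (start i))"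
    using nn_integral_nu_from[OF start_nonneg cm] by (intro sum.cong) (auto simp: D_def)
  finally show ?thesis .
qed

lemma component_L2:
  assumes f: "f \<in> L2 (mu T)" and i: "i \<in> I"
  shows "component i f \<in> L2 (nu_from T (start i))"
proof -
  have fm: "f \<in> borel_measurable (mu T)" using f by (simp add: L2_def)
  have "(\<integral>\<^sup>+s. ennreal ((cmod (component i f s))\<^sup>2) \<partial>nu_from T (start i)) \<le> (\<integral>\<^sup>+x. ennreal ((cmod (f x))\<^sup>2) \<partial>mu T)"
    unfolding nn_parseval[OF fm] using i finite_index by (intro member_le_sum) auto
  also have "\<dots> < \<infinity>" using f by (simp add: L2_iff)
  finally show ?thesis
    using component_measurable[OF fm i] by (simp add: L2_iff measurable_nu_from[OF start_nonneg[OF i]])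
qed

lemma parseval:
  assumes f: "f \<in> L2 (mu T)"
  shows "(\<integral>x. (cmod (f x))\<^sup>2 \<partial>mu T) = (\<Sum>i\<in>I. \<integral>s. (cmod (component i f s))\<^sup>2 \<partial>nu_from T (start i))"
proof -
  have fm: "f \<in> borel_measurable (mu T)" using f by (simp add: L2_def)
  have "ennreal (\<integral>x. (cmod (f x))\<^sup>2 \<partial>mu T) = (\<Sum>i\<in>I. ennreal (\<integral>s. (cmod (component i f s))\<^sup>2 \<partial>nu_from T (start i)))"
    using nn_parseval[OF fm] L2_nn_integral[OF f] L2_nn_integral[OF component_L2[OF f]] by simp
  also have "\<dots> = ennreal (\<Sum>i\<in>I. \<integral>s. (cmod (component i f s))\<^sup>2 \<partial>nu_from T (start i))"
    by (rule sum_ennreal) simp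
  finally show ?thesis
    by (subst (asm) ennreal_inj) (auto intro: sum_nonneg)
qed

section \<open>The orthogonal decomposition\<close>

lemma sqrt_prod_square: "complex_of_real (sqrt (real (\<Prod>i\<le>k. b i))) * of_real (sqrt (real (\<Prod>i\<le>k. b i))) = of_nat (\<Prod>i\<le>k. b i)"
  unfolding of_real_mult[symmetric] by (simp del: of_nat_prod)

lemma sqrt_prod_nonzero: "k \<le> N \<Longrightarrow> complex_of_real (sqrt (real (\<Prod>i\<le>k. b i))) \<noteq> 0"
  using b_pos by (auto simp: prod_zero_iff)

text \<open>The left side is what undoing \<open>J_edge\<close> produces, the right side the factor
  in \<open>haar_expansion\<close>. They match because the number of half-lines is
  \<open>prod_above k\<close> times the product of the b i up to k.\<close>

lemma fourier_vec_eq_haar: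
  assumes "k \<le> N" "v \<in> V k" "r \<in> {1..b k}" "anc \<rho> k = E v r"
  shows "of_real (sqrt (real (\<Prod>i\<le>k. b i))) * fourier_vec b k j r = of_nat (card (rays T)) * haar (Some (k, v, j)) \<rho>"
proof -
  define q where "q = complex_of_real (sqrt (real (\<Prod>i\<le>k. b i)))"
  have n: "complex_of_nat (card (rays T)) = q * q * of_nat (prod_above k)"
    unfolding q_def sqrt_prod_square prod_below_above[OF assms(1), symmetric] by simp
  have "q \<noteq> 0" using sqrt_prod_nonzero[OF assms(1)] by (simp add: q_def)
  moreover have "complex_of_nat (prod_above k) \<noteq> 0" using prod_above_pos[of k] by simp
  ultimately show ?thesis
    unfolding haar_at[OF assms] n q_def[symmetric] by (simp add: field_simps)
qed

lemma J_edge_radial: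
  assumes "f \<in> radial_space T (subtree T e)" "e \<in> level_edges k" "k \<le> m" "m \<le> N" "s \<in> piece m"
    and \<rho>: "\<rho> \<in> rays T" "anc \<rho> k = e"
  shows "f (ray_point \<rho> s) = of_real (sqrt (real (\<Prod>i\<le>k. b i))) * J_edge T b k e f s"
proof -
  have k: "k \<le> N" using assms by simp
  have "ray_point \<rho> s \<in> subtree T e"
    using ray_point_subtree[OF \<rho>(1) assms(4,5,2) k] assms(3) \<rho>(2) by simp
  then have "f (ray_point \<rho> s) = f (SOME x. x \<in> subtree T e \<and> root_dist T x = s)"
    using SOME_subtree_point[OF assms(4,5,2,3)] root_dist_ray_point[OF \<rho>(1) assms(4,5)]
    by (intro radial_spaceD(3)[OF assms(1)]) auto
  then show ?thesis using sqrt_prod_nonzero[OF k] by (simp add: J_edge_def del: of_nat_prod)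
qed

lemma radial_outside:
  assumes "f \<in> radial_space T (subtree T e)" "e \<in> level_edges k" "k \<le> N" "m \<le> N" "s \<in> piece m"
    and \<rho>: "\<rho> \<in> rays T" "\<not> (k \<le> m \<and> anc \<rho> k = e)"
  shows "f (ray_point \<rho> s) = 0"
  using ray_point_subtree[OF \<rho>(1) assms(4,5,2,3)] \<rho>(2) ray_point_points[OF \<rho>(1) assms(4,5)]
  by (intro radial_spaceD(2)[OF assms(1)]) auto

text \<open>Elements of a summand separate into a fixed Haar function of the half-line and a
  function of the radius. This reduces orthogonality in \<open>L2\<close> to
  \<open>haar_orthogonal\<close>.\<close>

lemma summand_along_rays:
  assumes i: "i \<in> I" and g: "g \<in> summand T t b E i"
  shows "\<exists>\<phi>. AE s in lborel. 0 \<le> s \<longrightarrow> (\<forall>\<rho>\<in>rays T. g (ray_point \<rho> s) = haar i \<rho> * \<phi> s)"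
  using i
proof (cases rule: index_cases)
  case 1
  then have g: "g \<in> radial_space T (points T)" using g by simp
  obtain \<sigma> where \<sigma>: "\<sigma> \<in> rays T" using card_rays_pos by (auto simp: card_gt_0_iff)
  show ?thesis
  proof (intro exI, rule AE_mp[OF AE_not_level], intro AE_I2 impI ballI)
    fix s \<rho> assume s: "s \<notin> level_set" "0 \<le> s" and \<rho>: "\<rho> \<in> rays T"
    obtain m where m: "m \<le> N" "s \<in> piece m" using piece_cases[OF s(2,1)] by blast
    have "g (ray_point \<rho> s) = g (ray_point \<sigma> s)"
      using ray_point_points[OF _ m] root_dist_ray_point[OF _ m] \<rho> \<sigma>
      by (intro radial_spaceD(3)[OF g]) auto
    then show "g (ray_point \<rho> s) = haar i \<rho> * (of_nat (card (rays T)) * g (ray_point \<sigma> s))"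
      using 1 card_rays_pos by (simp add: haar_None)
  qed
next
  case (2 k v j)
  define q where "q = complex_of_real (sqrt (real (\<Prod>i\<le>k. b i)))"
  have "g \<in> mode_space T t b E k v j" using g 2(1) by simp
  then obtain f \<phi> where f: "\<And>r. r \<in> {1..b k} \<Longrightarrow> f r \<in> radial_space T (subtree T (E v r))"
    and g_eq: "g = (\<lambda>x. \<Sum>r=1..b k. f r x)"
    and J: "\<And>r. r \<in> {1..b k} \<Longrightarrow> AE s in nu_from T (t k). J_edge T b k (E v r) (f r) s = fourier_vec b k j r * \<phi> s"
    unfolding mode_space_def by blast
  have "AE s in lborel. \<forall>r\<in>{1..b k}. t k \<le> s \<longrightarrow> J_edge T b k (E v r) (f r) s = fourier_vec b k j r * \<phi> s"
    using J t_nonneg[OF 2(2)] by (subst AE_ball_countable) (auto simp: AE_nu_from)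
  \<comment> \<open>Before level t k all the f r vanish along the half-lines, while \<phi> is
    arbitrary there; hence the cutoff. The number of half-lines compensates the normalisation of
    \<open>haar\<close>.\<close>
  with AE_not_level have "AE s in lborel. 0 \<le> s \<longrightarrow> (\<forall>\<rho>\<in>rays T. g (ray_point \<rho> s) =
      haar i \<rho> * (if t k < s then of_nat (card (rays T)) * \<phi> s else 0))"
  proof eventually_elim
    case (elim s)
    show ?case
    proof (intro impI ballI)
      fix \<rho> assume s: "0 \<le> s" and \<rho>: "\<rho> \<in> rays T"
      obtain m where m: "m \<le> N" "s \<in> piece m" using piece_cases[OF s elim(1)] by blast
      have lt: "t k < s \<longleftrightarrow> k \<le> m" by (rule piece_less_iff[OF m(2,1) 2(2)])
      have zero: "f r (ray_point \<rho> s) = 0" if "r \<in> {1..b k}" "\<not> (k \<le> m \<and> anc \<rho> k = E v r)" for r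
        using radial_outside[OF f[OF that(1)] _ 2(2) m \<rho> that(2)] E_level[OF 2(2,3) that(1)] by blast
      show "g (ray_point \<rho> s) = haar i \<rho> * (if t k < s then of_nat (card (rays T)) * \<phi> s else 0)"
      proof (cases "k \<le> m \<and> (\<exists>r\<in>{1..b k}. anc \<rho> k = E v r)")
        case True
        then obtain r where r: "k \<le> m" "r \<in> {1..b k}" "anc \<rho> k = E v r" by blast
        have "g (ray_point \<rho> s) = (\<Sum>r'=1..b k. if r' = r then f r (ray_point \<rho> s) else 0)"
          unfolding g_eq using zero E_inj[OF 2(2,3) r(2)] r(3) by (intro sum.cong) auto
        also have "\<dots> = f r (ray_point \<rho> s)" using r(2) by simp
        also have "\<dots> = q * J_edge T b k (E v r) (f r) s"
          unfolding q_def using J_edge_radial[OF f[OF r(2)] _ r(1) m \<rho> r(3)] E_level[OF 2(2,3) r(2)] by blast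
        also have "J_edge T b k (E v r) (f r) s = fourier_vec b k j r * \<phi> s"
          using elim(2) r lt by auto
        also have "q * (fourier_vec b k j r * \<phi> s) = of_nat (card (rays T)) * haar i \<rho> * \<phi> s"
          using fourier_vec_eq_haar[OF 2(2,3) r(2,3), of j] 2(1) by (simp add: q_def mult.assoc[symmetric] del: of_nat_prod)
        finally show ?thesis using r(1) lt by (simp add: algebra_simps)
      next
        case False
        then have "g (ray_point \<rho> s) = 0"
          unfolding g_eq using zero by (intro sum.neutral) blast
        moreover have "haar i \<rho> = 0 \<or> \<not> t k < s"
        proof (cases "k \<le> m")
          case True
          have "tail G (anc \<rho> k) \<noteq> v"
            using anc_E[OF \<rho> 2(2)] False True by metis
          then show ?thesis using haar_outside[OF 2(2,3)] 2(1) by simp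
        qed (simp add: lt)
        ultimately show ?thesis by auto
      qed
    qed
  qed
  then show ?thesis
    by (intro exI[of _ "\<lambda>s. if t k < s then of_nat (card (rays T)) * \<phi> s else 0"])
qed

lemma J_edge_cmult: "J_edge T b k e (\<lambda>x. c * f x) s = c * J_edge T b k e f s"
  by (simp add: J_edge_def)

lemma mode_space_subspace:
  assumes "k \<le> N" "v \<in> V k"
  shows "L2_subspace (mu T) (mode_space T t b E k v j)"
  unfolding L2_subspace_def
proof (intro conjI ballI allI)
  show "mode_space T t b E k v j \<subseteq> L2 (mu T)"
    unfolding mode_space_def by (auto intro!: L2_sum dest: radial_spaceD(1))
  show "(\<lambda>x. 0) \<in> mode_space T t b E k v j"
    unfolding mode_space_def
  proof (rule CollectI, intro exI conjI)
    show "(\<lambda>x. 0) = (\<lambda>x. \<Sum>r=1..b k. (0 :: complex))" by simp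
    show "\<forall>r\<in>{1..b k}. (\<lambda>x. 0) \<in> radial_space T (subtree T (E v r))" by (simp add: radial_space_zero)
    show "\<exists>\<phi>\<in>L2 (nu_from T (t k)). \<forall>r\<in>{1..b k}. AE s in nu_from T (t k). J_edge T b k (E v r) (\<lambda>x. 0) s = fourier_vec b k j r * \<phi> s"
      by (intro bexI[OF _ L2_zero]) (simp add: J_edge_def)
  qed
next
  fix g h assume "g \<in> mode_space T t b E k v j" "h \<in> mode_space T t b E k v j"
  then obtain f \<phi> f' \<phi>' where
    f: "g = (\<lambda>x. \<Sum>r=1..b k. f r x)" "\<And>r. r \<in> {1..b k} \<Longrightarrow> f r \<in> radial_space T (subtree T (E v r))"
      "\<phi> \<in> L2 (nu_from T (t k))" "\<And>r. r \<in> {1..b k} \<Longrightarrow> AE s in nu_from T (t k). J_edge T b k (E v r) (f r) s = fourier_vec b k j r * \<phi> s"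
    and f': "h = (\<lambda>x. \<Sum>r=1..b k. f' r x)" "\<And>r. r \<in> {1..b k} \<Longrightarrow> f' r \<in> radial_space T (subtree T (E v r))"
      "\<phi>' \<in> L2 (nu_from T (t k))" "\<And>r. r \<in> {1..b k} \<Longrightarrow> AE s in nu_from T (t k). J_edge T b k (E v r) (f' r) s = fourier_vec b k j r * \<phi>' s"
    unfolding mode_space_def by blast
  show "(\<lambda>x. g x + h x) \<in> mode_space T t b E k v j"
    unfolding mode_space_def
  proof (rule CollectI, intro exI conjI ballI)
    show "(\<lambda>x. g x + h x) = (\<lambda>x. \<Sum>r=1..b k. f r x + f' r x)"
      by (simp add: f(1) f'(1) sum.distrib)
    show "(\<lambda>x. f r x + f' r x) \<in> radial_space T (subtree T (E v r))" if "r \<in> {1..b k}" for r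
      by (rule radial_space_add[OF f(2)[OF that] f'(2)[OF that]])
    show "\<exists>\<phi>\<in>L2 (nu_from T (t k)). \<forall>r\<in>{1..b k}. AE s in nu_from T (t k).
        J_edge T b k (E v r) (\<lambda>x. f r x + f' r x) s = fourier_vec b k j r * \<phi> s"
    proof (intro bexI[OF _ L2_add[OF f(3) f'(3)]] ballI)
      fix r assume r: "r \<in> {1..b k}"
      from f(4)[OF r] f'(4)[OF r] show "AE s in nu_from T (t k).
          J_edge T b k (E v r) (\<lambda>x. f r x + f' r x) s = fourier_vec b k j r * (\<phi> s + \<phi>' s)"
        by eventually_elim (simp add: J_edge_def add_divide_distrib distrib_left)
    qed
  qed
next
  fix c g assume "g \<in> mode_space T t b E k v j"
  then obtain f \<phi> where
    f: "g = (\<lambda>x. \<Sum>r=1..b k. f r x)" "\<And>r. r \<in> {1..b k} \<Longrightarrow> f r \<in> radial_space T (subtree T (E v r))"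
      "\<phi> \<in> L2 (nu_from T (t k))" "\<And>r. r \<in> {1..b k} \<Longrightarrow> AE s in nu_from T (t k). J_edge T b k (E v r) (f r) s = fourier_vec b k j r * \<phi> s"
    unfolding mode_space_def by blast
  show "(\<lambda>x. c * g x) \<in> mode_space T t b E k v j"
    unfolding mode_space_def
  proof (rule CollectI, intro exI conjI ballI)
    show "(\<lambda>x. c * g x) = (\<lambda>x. \<Sum>r=1..b k. c * f r x)"
      by (simp add: f(1) sum_distrib_left)
    show "(\<lambda>x. c * f r x) \<in> radial_space T (subtree T (E v r))" if "r \<in> {1..b k}" for r
      by (rule radial_space_cmult[OF f(2)[OF that]])
    show "\<exists>\<phi>\<in>L2 (nu_from T (t k)). \<forall>r\<in>{1..b k}. AE s in nu_from T (t k).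
        J_edge T b k (E v r) (\<lambda>x. c * f r x) s = fourier_vec b k j r * \<phi> s"
    proof (intro bexI[OF _ L2_cmult[OF f(3), of c]] ballI)
      fix r assume r: "r \<in> {1..b k}"
      from f(4)[OF r] show "AE s in nu_from T (t k).
          J_edge T b k (E v r) (\<lambda>x. c * f r x) s = fourier_vec b k j r * (c * \<phi> s)"
        by eventually_elim (simp add: J_edge_cmult)
    qed
  qed
qed

lemma summand_subspace: "i \<in> I \<Longrightarrow> L2_subspace (mu T) (summand T t b E i)"
  by (erule index_cases) (simp_all add: radial_space_subspace mode_space_subspace)

lemma summand_orthogonal:
  assumes "i \<in> I" "i' \<in> I" "i \<noteq> i'" "g \<in> summand T t b E i" "h \<in> summand T t b E i'"
  shows "L2_inner (mu T) g h = 0"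
proof -
  obtain \<phi> where \<phi>: "AE s in lborel. 0 \<le> s \<longrightarrow> (\<forall>\<rho>\<in>rays T. g (ray_point \<rho> s) = haar i \<rho> * \<phi> s)"
    using summand_along_rays[OF assms(1,4)] by blast
  obtain \<psi> where \<psi>: "AE s in lborel. 0 \<le> s \<longrightarrow> (\<forall>\<rho>\<in>rays T. h (ray_point \<rho> s) = haar i' \<rho> * \<psi> s)"
    using summand_along_rays[OF assms(2,5)] by blast
  have meas: "g \<in> borel_measurable (mu T)" "h \<in> borel_measurable (mu T)"
  proof -
    have "g \<in> L2 (mu T)" "h \<in> L2 (mu T)"
      using summand_subspace[OF assms(1)] summand_subspace[OF assms(2)] assms(4,5)
      unfolding L2_subspace_def by blast+
    then show "g \<in> borel_measurable (mu T)" "h \<in> borel_measurable (mu T)" by (simp_all add: L2_def)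
  qed
  show ?thesis
    unfolding L2_inner_def
  proof (rule integral_mu_eq_0)
    show "(\<lambda>x. g x * cnj (h x)) \<in> borel_measurable (mu T)"
      by (intro borel_measurable_times meas measurable_compose[OF meas(2)]
          borel_measurable_continuous_onI continuous_intros)
    show "AE s in lborel. 0 \<le> s \<longrightarrow> (\<Sum>\<rho>\<in>rays T. g (ray_point \<rho> s) * cnj (h (ray_point \<rho> s))) = 0"
      using \<phi> \<psi>
    proof eventually_elim
      case (elim s)
      show ?case
      proof
        assume "0 \<le> s"
        with elim have "(\<Sum>\<rho>\<in>rays T. g (ray_point \<rho> s) * cnj (h (ray_point \<rho> s))) =
            (\<Sum>\<rho>\<in>rays T. (haar i \<rho> * cnj (haar i' \<rho>)) * (\<phi> s * cnj (\<psi> s)))"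
          by (intro sum.cong) auto
        also have "\<dots> = 0"
          unfolding sum_distrib_right[symmetric] haar_orthogonal[OF assms(1-3)] by simp
        finally show "(\<Sum>\<rho>\<in>rays T. g (ray_point \<rho> s) * cnj (h (ray_point \<rho> s))) = 0" .
      qed
    qed
  qed
qed

text \<open>The i-th term of the Haar expansion as a function on the tree, obtained by undoing
  \<open>J_root\<close> or \<open>J_edge\<close> on the component. The indicator discards the radii
  before the component starts.\<close>

definition projection :: "(nat \<times> 'a \<times> nat) option \<Rightarrow> (('a, 'b) point \<Rightarrow> complex) \<Rightarrow> ('a, 'b) point \<Rightarrow> complex" where
  "projection i f x = (let \<phi> = (\<lambda>s. indicator {start i..} s *\<^sub>R component i f s) in
     case i of None \<Rightarrow> if x \<in> points T then \<phi> (root_dist T x) else 0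
     | Some (k, v, j) \<Rightarrow> (\<Sum>r=1..b k. of_real (sqrt (real (\<Prod>i\<le>k. b i))) * fourier_vec b k j r *
          (if x \<in> subtree T (E v r) then \<phi> (root_dist T x) else 0)))"

lemma projection_ray_point:
  assumes i: "i \<in> I" and m: "m \<le> N" "s \<in> piece m" and \<rho>: "\<rho> \<in> rays T"
  shows "projection i f (ray_point \<rho> s) = of_nat (card (rays T)) * (haar i \<rho> * haar_coeff (ray_values f s) i)"
proof -
  note rd = root_dist_ray_point[OF \<rho> m]
  have s: "s \<notin> level_set" by (rule piece_not_level[OF m(2,1)])
  have ne: "start i \<noteq> s" using s start_level_set[OF i] by auto
  from i show ?thesis
  proof (cases rule: index_cases)
    case 1
    then show ?thesis
      using ne rd ray_point_points[OF \<rho> m] haar_coeff_eq_component[OF i m] card_rays_pos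
      by (simp add: projection_def haar_None indicator_def)
  next
    case (2 k v j)
    have lt: "start i < s \<longleftrightarrow> k \<le> m" using piece_less_iff[OF m(2,1) 2(2)] 2(1) by (simp add: start_def)
    have sub: "ray_point \<rho> s \<in> subtree T (E v r) \<longleftrightarrow> k \<le> m \<and> anc \<rho> k = E v r" if "r \<in> {1..b k}" for r
      using ray_point_subtree[OF \<rho> m _ 2(2)] E_level[OF 2(2,3) that] by blast
    show ?thesis
    proof (cases "k \<le> m \<and> (\<exists>r\<in>{1..b k}. anc \<rho> k = E v r)")
      case True
      then obtain r where r: "k \<le> m" "r \<in> {1..b k}" "anc \<rho> k = E v r" by blast
      have "projection i f (ray_point \<rho> s) = (\<Sum>r'=1..b k. if r' = r then
          of_real (sqrt (real (\<Prod>i\<le>k. b i))) * fourier_vec b k j r * component i f s else 0)"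
        unfolding projection_def 2(1) Let_def option.case prod.case
      proof (rule sum.cong[OF refl])
        fix r' assume r': "r' \<in> {1..b k}"
        have "anc \<rho> k = E v r' \<longleftrightarrow> r' = r" using E_inj[OF 2(2,3) r(2) r'] r(3) by auto
        then show "of_real (sqrt (real (\<Prod>i\<le>k. b i))) * fourier_vec b k j r' *
            (if ray_point \<rho> s \<in> subtree T (E v r') then indicator {start (Some (k, v, j))..} (root_dist T (ray_point \<rho> s)) *\<^sub>R
              component (Some (k, v, j)) f (root_dist T (ray_point \<rho> s)) else 0) =
          (if r' = r then of_real (sqrt (real (\<Prod>i\<le>k. b i))) * fourier_vec b k j r * component (Some (k, v, j)) f s else 0)"
          using sub[OF r'] r(1) lt rd 2(1) by (simp add: indicator_def)
      qed
      also have "\<dots> = of_nat (card (rays T)) * haar i \<rho> * component i f s"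
        using r(2) fourier_vec_eq_haar[OF 2(2,3) r(2,3), of j] 2(1) by (simp del: of_nat_prod)
      finally show ?thesis using haar_coeff_eq_component[OF i m] lt r(1) by simp
    next
      case False
      have "projection i f (ray_point \<rho> s) = 0"
        unfolding projection_def 2(1) Let_def option.case prod.case
        using False sub by (intro sum.neutral) auto
      moreover have "haar i \<rho> = 0 \<or> haar_coeff (ray_values f s) i = 0"
      proof (cases "k \<le> m")
        case True
        have "tail G (anc \<rho> k) \<noteq> v"
          using anc_E[OF \<rho> 2(2)] False True by metis
        then show ?thesis using haar_outside[OF 2(2,3)] 2(1) by simp
      next
        case False
        then show ?thesis using haar_coeff_eq_component[OF i m] lt by simp
      qed
      ultimately show ?thesis by auto
    qed
  qed
qed

lemma radial_component_space:
  assumes f: "f \<in> L2 (mu T)" and i: "i \<in> I" and S: "S \<in> sets (mu T)"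
  shows "(\<lambda>x. if x \<in> S then indicator {start i..} (root_dist T x) *\<^sub>R component i f (root_dist T x) else 0) \<in> radial_space T S"
proof (rule radial_spaceI)
  have fm: "f \<in> borel_measurable (mu T)" using f by (simp add: L2_def)
  note cm = component_measurable[OF fm i]
  show "(\<lambda>x. if x \<in> S then indicator {start i..} (root_dist T x) *\<^sub>R component i f (root_dist T x) else 0) \<in> L2 (mu T)"
  proof (rule radial_function_L2[OF S])
    show "(\<lambda>s. indicator {start i..} s *\<^sub>R component i f s) \<in> borel_measurable borel"
      using cm by (subst (asm) borel_measurable_restrict_space_iff) auto
    have "(\<lambda>s. ennreal ((cmod (component i f s))\<^sup>2)) \<in> borel_measurable (restrict_space borel {start i..})"
      using cm by measurable
    from nn_integral_nu_from[OF start_nonneg[OF i] this]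
    have "(\<integral>\<^sup>+s. weight s * ennreal ((cmod (component i f s))\<^sup>2) * indicator {start i..} s \<partial>lborel) < \<infinity>"
      using component_L2[OF f i] by (simp add: L2_iff)
    moreover have "weight s * ennreal ((cmod (indicator {start i..} s *\<^sub>R component i f s))\<^sup>2) * indicator {0..} s =
        weight s * ennreal ((cmod (component i f s))\<^sup>2) * indicator {start i..} s" for s
      using start_nonneg[OF i] by (auto simp: indicator_def)
    ultimately show "(\<integral>\<^sup>+s. weight s * ennreal ((cmod (indicator {start i..} s *\<^sub>R component i f s))\<^sup>2) * indicator {0..} s \<partial>lborel) < \<infinity>"
      by simp
  qed
qed auto

lemma projection_summand:
  assumes f: "f \<in> L2 (mu T)" and i: "i \<in> I"
  shows "projection i f \<in> summand T t b E i"
  using i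
proof (cases rule: index_cases)
  case 1
  then show ?thesis
    using radial_component_space[OF f i points_sets] unfolding 1 by (simp add: projection_def[abs_def])
next
  case (2 k v j)
  define q where "q = complex_of_real (sqrt (real (\<Prod>i\<le>k. b i)))"
  have q: "q \<noteq> 0" unfolding q_def by (rule sqrt_prod_nonzero[OF 2(2)])
  define h where "h r x = q * fourier_vec b k j r *
      (if x \<in> subtree T (E v r) then indicator {start i..} (root_dist T x) *\<^sub>R component i f (root_dist T x) else 0)" for r x
  have "projection i f = (\<lambda>x. \<Sum>r=1..b k. h r x)"
    unfolding projection_def[abs_def] h_def q_def 2(1) by simp
  moreover have "h r \<in> radial_space T (subtree T (E v r))" if r: "r \<in> {1..b k}" for r
    unfolding h_def[abs_def] using E_level[OF 2(2,3) r]
    by (intro radial_space_cmult radial_component_space[OF f i] subtree_sets level_edges_edges) auto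
  moreover have "component i f \<in> L2 (nu_from T (t k))"
    using component_L2[OF f i] 2(1) by (simp add: start_def)
  moreover have "AE s in nu_from T (t k). J_edge T b k (E v r) (h r) s = fourier_vec b k j r * component i f s"
    if r: "r \<in> {1..b k}" for r
    unfolding AE_nu_from[OF t_nonneg[OF 2(2)]]
  proof (rule AE_mp[OF AE_not_level], intro AE_I2 impI)
    fix s assume s: "s \<notin> level_set" "t k \<le> s"
    obtain m where m: "m \<le> N" "s \<in> piece m" using piece_cases[OF order_trans[OF t_nonneg[OF 2(2)] s(2)] s(1)] by blast
    have "t k \<noteq> s" using s(1) 2(2) by auto
    then have km: "k \<le> m" using piece_less_iff[OF m(2,1) 2(2)] s(2) by simp
    have e: "E v r \<in> level_edges k" using E_level[OF 2(2,3) r] by blast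
    show "J_edge T b k (E v r) (h r) s = fourier_vec b k j r * component i f s"
      using SOME_subtree_point[OF m e km] q s(2) 2(1)
      unfolding J_edge_def q_def[symmetric] by (simp add: h_def start_def)
  qed
  ultimately show ?thesis
    unfolding 2(1) summand.simps mode_space_def by blast
qed

lemma decomposition: "orthogonal_decomposition (mu T) I (summand T t b E)"
  unfolding orthogonal_decomposition_def
proof (intro conjI ballI impI)
  show "finite I" by (rule finite_index)
  show "L2_subspace (mu T) (summand T t b E i)" if "i \<in> I" for i
    by (rule summand_subspace[OF that])
  show "L2_inner (mu T) g h = 0"
    if "i \<in> I" "i' \<in> I" "i \<noteq> i'" "g \<in> summand T t b E i" "h \<in> summand T t b E i'" for i i' g h
    by (rule summand_orthogonal[OF that])
  fix f assume f: "f \<in> L2 (mu T)"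
  show "\<exists>g. (\<forall>i\<in>I. g i \<in> summand T t b E i) \<and> (AE x in mu T. f x = (\<Sum>i\<in>I. g i x))"
  proof (intro exI conjI ballI)
    show "projection i f \<in> summand T t b E i" if "i \<in> I" for i
      by (rule projection_summand[OF f that])
    \<comment> \<open>The expansion holds at every inner point of every edge; only the vertices are
      left to the null set.\<close>
    have eq: "f x = (\<Sum>i\<in>I. projection i f x)" if "x \<in> points T" "x = Inner e r" for x e r
    proof -
      have "Inner e r \<in> points T" using that by simp
      then obtain m \<rho> where *: "m \<le> N" "t m + r \<in> piece m" "\<rho> \<in> rays T" "anc \<rho> m = e"
          "Inner e r = ray_point \<rho> (t m + r)"
        by (rule Inner_eq_ray_point)
      show ?thesis
        unfolding that(2) *(5) using projection_ray_point[OF _ *(1-3), of _ f] haar_expansion[OF *(3), of "ray_values f (t m + r)"]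
        by (simp add: sum_distrib_left)
    qed
    have "AE x in mu T. x \<in> points T"
      using AE_space[of "mu T"] by (simp add: mu_def space_tree_length)
    with AE_not_Vertex show "AE x in mu T. f x = (\<Sum>i\<in>I. projection i f x)"
      by eventually_elim (use eq in blast)
  qed
qed

end

section \<open>Weak derivatives of the components\<close>

lemma has_weak_deriv_weak_deriv: "has_weak_deriv U f g \<Longrightarrow> has_weak_deriv U f (weak_deriv U f)"
  unfolding weak_deriv_def by (rule someI[of "has_weak_deriv U f"])

context regular_metric_tree
begin

text \<open>Off the levels the density of \<open>nu\<close> on [0, d] is at least
  \<open>gauss d\<close>, because spheres are nonempty and the Gaussian decreases. With |g| \<le> 1
  + |g|^2 this bounds the integral of |g| over [0, d].\<close>

lemma L2_nu_set_integrable: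
  assumes G: "g \<in> L2 (nu_from T 0)"
  shows "set_integrable lborel {0..d} g"
proof -
  have gm: "g \<in> borel_measurable (restrict_space borel {0..})"
    using G by (simp add: L2_def measurable_nu_from)
  then have g0: "(\<lambda>s. indicator {0..} s *\<^sub>R g s) \<in> borel_measurable borel"
    by (subst (asm) borel_measurable_restrict_space_iff) auto
  have "(\<lambda>s. indicator {0..d} s *\<^sub>R (indicator {0..} s *\<^sub>R g s)) \<in> borel_measurable borel"
    using g0 by measurable
  moreover have "indicator {0..d} s *\<^sub>R (indicator {0..} s *\<^sub>R g s) = indicator {0..d} s *\<^sub>R g s" for s
    by (simp add: indicator_def)
  ultimately have meas: "(\<lambda>s. indicator {0..d} s *\<^sub>R g s) \<in> borel_measurable borel"
    by (simp only:)
  have fin: "(\<integral>\<^sup>+s. weight s * ennreal ((cmod (g s))\<^sup>2) * indicator {0..} s \<partial>lborel) < \<infinity>"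
    using G gm nn_integral_nu_from[of 0 "\<lambda>s. ennreal ((cmod (g s))\<^sup>2)"] by (simp add: L2_iff)
  define C where "C = 1 / gauss d"
  have gd: "0 < gauss d" by (rule gauss_pos)
  have C: "0 < C" using gd by (simp add: C_def)
  have "(\<integral>\<^sup>+s. ennreal (cmod (indicator {0..d} s *\<^sub>R g s)) \<partial>lborel) \<le>
      (\<integral>\<^sup>+s. indicator {0..d} s + ennreal C * (weight s * ennreal ((cmod (g s))\<^sup>2) * indicator {0..} s) \<partial>lborel)"
  proof (rule nn_integral_mono_AE, rule AE_mp[OF AE_not_level], intro AE_I2 impI)
    fix s assume s: "s \<notin> level_set"
    show "ennreal (cmod (indicator {0..d} s *\<^sub>R g s)) \<le> indicator {0..d} s + ennreal C * (weight s * ennreal ((cmod (g s))\<^sup>2) * indicator {0..} s)"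
    proof (cases "s \<in> {0..d}")
      case True
      then have s0: "0 \<le> s" "s \<le> d" by auto
      obtain m where m: "m \<le> N" "s \<in> piece m" using piece_cases[OF s0(1) s] by blast
      have "0 < card (level_edges m)"
        using card_rays_level[OF m(1)] card_rays_pos by (metis gr0I mult_zero_left less_irrefl)
      moreover have "gauss d \<le> gauss s"
        using power_mono[OF s0(2,1), of 2] by (simp add: gauss_def divide_right_mono)
      ultimately have "1 * gauss d \<le> real (card (level_edges m)) * gauss s"
        using gd by (intro mult_mono) auto
      then have "ennreal (gauss d) \<le> weight s"
        unfolding weight_def branching_points[OF m] by (intro ennreal_leI) simp
      then have "ennreal C * (ennreal (gauss d) * ennreal ((cmod (g s))\<^sup>2)) \<le> ennreal C * (weight s * ennreal ((cmod (g s))\<^sup>2))"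
        by (intro mult_left_mono mult_right_mono) auto
      moreover have "ennreal C * (ennreal (gauss d) * ennreal ((cmod (g s))\<^sup>2)) = ennreal ((cmod (g s))\<^sup>2)"
        using gd by (simp add: C_def ennreal_mult[symmetric])
      moreover have "cmod (g s) \<le> 1 + (cmod (g s))\<^sup>2"
      proof -
        have "0 \<le> (cmod (g s) - 1)\<^sup>2" by simp
        then have "2 * cmod (g s) \<le> 1 + (cmod (g s))\<^sup>2" by (simp add: power2_eq_square algebra_simps)
        then show ?thesis using norm_ge_zero[of "g s"] by linarith
      qed
      then have "ennreal (cmod (g s)) \<le> 1 + ennreal ((cmod (g s))\<^sup>2)"
        by (metis ennreal_1 ennreal_leI ennreal_plus zero_le_one zero_le_power2)
      ultimately have "ennreal (cmod (g s)) \<le> 1 + ennreal C * (weight s * ennreal ((cmod (g s))\<^sup>2))"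
        by (metis add_left_mono order_trans)
      then show ?thesis using True by simp
    next
      case False
      then show ?thesis by simp
    qed
  qed
  also have "\<dots> = (\<integral>\<^sup>+s. indicator {0..d} s \<partial>lborel) + ennreal C * (\<integral>\<^sup>+s. weight s * ennreal ((cmod (g s))\<^sup>2) * indicator {0..} s \<partial>lborel)"
  proof -
    have w0: "(\<lambda>s. weight s * indicator {0..} s) \<in> borel_measurable borel"
      using weight_measurable by (subst (asm) borel_measurable_restrict_space_iff_ennreal) auto
    have "(\<lambda>s. (weight s * indicator {0..} s) * ennreal ((cmod (indicator {0..} s *\<^sub>R g s))\<^sup>2)) \<in> borel_measurable borel"
      by (rule borel_measurable_times_ennreal[OF w0 measurable_compose[OF g0]]) measurable
    moreover have "(weight s * indicator {0..} s) * ennreal ((cmod (indicator {0..} s *\<^sub>R g s))\<^sup>2) =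
        weight s * ennreal ((cmod (g s))\<^sup>2) * indicator {0..} s" for s
      by (simp add: indicator_def)
    ultimately have "(\<lambda>s. weight s * ennreal ((cmod (g s))\<^sup>2) * indicator {0..} s) \<in> borel_measurable lborel"
      by simp
    then show ?thesis by (subst nn_integral_add) (auto simp: nn_integral_cmult)
  qed
  also have "\<dots> < \<infinity>"
    using fin emeasure_lborel_Icc_eq[of 0 d] by (auto simp: ennreal_mult_less_top ennreal_add_less_top)
  finally show ?thesis
    unfolding set_integrable_def using meas by (intro integrableI_bounded) auto
qed

text \<open>A single half-line is dominated by the sum over all of them, that is, by their number
  times the average computed in \<open>nn_integral_mu\<close>.\<close>

lemma ray_values_L2:
  assumes f: "f \<in> L2 (mu T)" and \<rho>: "\<rho> \<in> rays T"
  shows "(\<lambda>s. f (ray_point \<rho> s)) \<in> L2 (nu_from T 0)"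
  unfolding L2_iff
proof
  have fm: "f \<in> borel_measurable (mu T)" using f by (simp add: L2_def)
  note rm = ray_measurable[OF fm \<rho> order_refl]
  show "(\<lambda>s. f (ray_point \<rho> s)) \<in> borel_measurable (nu_from T 0)"
    using rm by (simp add: measurable_nu_from)
  define n where "n = (of_nat (card (rays T)) :: ennreal)"
  have n: "n \<noteq> 0" "n \<noteq> top" using card_rays_pos by (auto simp: n_def)
  have meas: "(\<lambda>s. weight s * ennreal ((cmod (f (ray_point \<rho> s)))\<^sup>2) * indicator {0..} s) \<in> borel_measurable lborel" if "\<rho> \<in> rays T" for \<rho>
  proof -
    have "(\<lambda>s. weight s * ennreal ((cmod (f (ray_point \<rho> s)))\<^sup>2)) \<in> borel_measurable (restrict_space borel {0..})"
      by (intro borel_measurable_times_ennreal weight_measurable measurable_compose[OF ray_measurable[OF fm that order_refl]]) measurable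
    then show ?thesis by (subst (asm) borel_measurable_restrict_space_iff_ennreal) auto
  qed
  have "(\<integral>\<^sup>+s. ennreal ((cmod (f (ray_point \<rho> s)))\<^sup>2) \<partial>nu_from T 0) = (\<integral>\<^sup>+s. weight s * ennreal ((cmod (f (ray_point \<rho> s)))\<^sup>2) * indicator {0..} s \<partial>lborel)"
    using rm by (intro nn_integral_nu_from) auto
  also have "\<dots> \<le> (\<integral>\<^sup>+s. n * (weight s * ((\<Sum>\<rho>\<in>rays T. ennreal ((cmod (f (ray_point \<rho> s)))\<^sup>2)) / n) * indicator {0..} s) \<partial>lborel)"
  proof (rule nn_integral_mono)
    fix s
    have "ennreal ((cmod (f (ray_point \<rho> s)))\<^sup>2) \<le> (\<Sum>\<rho>\<in>rays T. ennreal ((cmod (f (ray_point \<rho> s)))\<^sup>2))"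
      using \<rho> finite_rays by (intro member_le_sum) auto
    also have "\<dots> = n * ((\<Sum>\<rho>\<in>rays T. ennreal ((cmod (f (ray_point \<rho> s)))\<^sup>2)) / n)"
      unfolding ennreal_times_divide mult.commute[of n] by (rule ennreal_mult_divide_eq[OF n, symmetric])
    finally have "weight s * ennreal ((cmod (f (ray_point \<rho> s)))\<^sup>2) * indicator {0..} s \<le>
        weight s * (n * ((\<Sum>\<rho>\<in>rays T. ennreal ((cmod (f (ray_point \<rho> s)))\<^sup>2)) / n)) * indicator {0..} s"
      by (intro mult_right_mono mult_left_mono) auto
    then show "weight s * ennreal ((cmod (f (ray_point \<rho> s)))\<^sup>2) * indicator {0..} s \<le>
        n * (weight s * ((\<Sum>\<rho>\<in>rays T. ennreal ((cmod (f (ray_point \<rho> s)))\<^sup>2)) / n) * indicator {0..} s)"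
      by (simp only: mult_ac)
  qed
  also have "\<dots> = n * (\<integral>\<^sup>+s. weight s * ((\<Sum>\<rho>\<in>rays T. ennreal ((cmod (f (ray_point \<rho> s)))\<^sup>2)) / n) * indicator {0..} s \<partial>lborel)"
  proof (rule nn_integral_cmult)
    have "(\<lambda>s. (\<Sum>\<rho>\<in>rays T. weight s * ennreal ((cmod (f (ray_point \<rho> s)))\<^sup>2) * indicator {0..} s) / n) \<in> borel_measurable lborel"
      using meas by (intro borel_measurable_divide_ennreal borel_measurable_sum) auto
    moreover have "(\<Sum>\<rho>\<in>rays T. weight s * ennreal ((cmod (f (ray_point \<rho> s)))\<^sup>2) * indicator {0..} s) / n =
        weight s * ((\<Sum>\<rho>\<in>rays T. ennreal ((cmod (f (ray_point \<rho> s)))\<^sup>2)) / n) * indicator {0..} s" for s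
      by (simp add: sum_distrib_left[symmetric] sum_distrib_right[symmetric] divide_ennreal_def mult_ac)
    ultimately show "(\<lambda>s. weight s * ((\<Sum>\<rho>\<in>rays T. ennreal ((cmod (f (ray_point \<rho> s)))\<^sup>2)) / n) * indicator {0..} s) \<in> borel_measurable lborel"
      by simp
  qed
  also have "\<dots> = n * (\<integral>\<^sup>+x. ennreal ((cmod (f x))\<^sup>2) \<partial>mu T)"
    unfolding n_def using fm by (subst nn_integral_mu) auto
  also have "\<dots> < \<infinity>"
    using f n by (simp add: L2_iff ennreal_mult_less_top top.not_eq_extremum)
  finally show "(\<integral>\<^sup>+s. ennreal ((cmod (f (ray_point \<rho> s)))\<^sup>2) \<partial>nu_from T 0) < \<infinity>" .
qed

lemma measurable_mu_edge: "measurable (mu_edge T e) M = measurable (restrict_space lborel (open_ivl T e)) M"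
  by (rule measurable_cong_sets) (simp_all add: mu_edge_def)

lemma L2_mu_edges:
  assumes "\<And>e. e \<in> edges T \<Longrightarrow> (\<lambda>r. f (Inner e r)) \<in> L2 (mu_edge T e)"
  shows "f \<in> L2 (mu T)"
  unfolding L2_iff
proof
  show f: "f \<in> borel_measurable (mu T)"
    unfolding measurable_mu using assms by (intro measurable_tree_lengthI) (auto simp: L2_def measurable_mu_edge)
  have "(\<integral>\<^sup>+x. ennreal ((cmod (f x))\<^sup>2) \<partial>mu T) = (\<Sum>e\<in>edges T. \<integral>\<^sup>+r. ennreal ((cmod (f (Inner e r)))\<^sup>2) \<partial>mu_edge T e)"
    using f by (intro nn_integral_mu_edges) measurable
  also have "\<dots> < \<infinity>"
    using assms finite_edges by (auto simp: L2_iff)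
  finally show "(\<integral>\<^sup>+x. ennreal ((cmod (f x))\<^sup>2) \<partial>mu T) < \<infinity>" .
qed

lemma open_open_ivl: "open (open_ivl T e)"
  by (simp add: open_ivl_def)

lemma AE_mu_edge:
  assumes "AE r in lborel. r \<in> open_ivl T e \<longrightarrow> Q r"
  shows "AE r in mu_edge T e. Q r"
proof -
  have "AE r in restrict_space lborel (open_ivl T e). Q r"
    using assms by (subst AE_restrict_space_iff) auto
  then show ?thesis
    unfolding mu_edge_def by (subst AE_density) (auto intro!: measurable_restrict_space1)
qed

text \<open>\<open>tree_deriv\<close> takes the arbitrary choice \<open>weak_deriv\<close>, not the
  square integrable derivative that \<open>H1\<close> provides. By uniqueness the two agree almost
  everywhere, so the choice is square integrable as well.\<close>

lemma H10_edge:
  assumes "f \<in> H10_mu T" "e \<in> edges T"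
  shows "(\<lambda>r. f (Inner e r)) \<in> L2 (mu_edge T e)"
    and "has_weak_deriv (open_ivl T e) (\<lambda>r. f (Inner e r)) (\<lambda>r. tree_deriv T f (Inner e r))"
    and "(\<lambda>r. tree_deriv T f (Inner e r)) \<in> L2 (mu_edge T e)"
proof -
  define u where "u r = f (Inner e r)" for r
  define D where "D = weak_deriv (open_ivl T e) u"
  have H1: "u \<in> H1 (mu_edge T e) (open_ivl T e)"
    using assms by (simp add: H10_mu_def u_def[abs_def])
  then show "(\<lambda>r. f (Inner e r)) \<in> L2 (mu_edge T e)" by (simp add: H1_def u_def[abs_def])
  obtain g where g: "g \<in> L2 (mu_edge T e)" "has_weak_deriv (open_ivl T e) u g"
    using H1 by (auto simp: H1_def)
  have D: "has_weak_deriv (open_ivl T e) u D"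
    unfolding D_def by (rule has_weak_deriv_weak_deriv[OF g(2)])
  have D_eq: "(\<lambda>r. tree_deriv T f (Inner e r)) = D"
    by (simp add: D_def u_def[abs_def])
  from D show "has_weak_deriv (open_ivl T e) (\<lambda>r. f (Inner e r)) (\<lambda>r. tree_deriv T f (Inner e r))"
    unfolding D_eq u_def[abs_def] .
  have "D \<in> borel_measurable (restrict_space lborel (open_ivl T e))"
    using locally_integrable_measurable[OF has_weak_derivD(2)[OF D] open_open_ivl]
    by (subst borel_measurable_restrict_space_iff) auto
  then have Dm: "D \<in> borel_measurable (mu_edge T e)" by (simp add: measurable_mu_edge)
  have "AE r in mu_edge T e. g r = D r"
    by (rule AE_mu_edge[OF weak_deriv_unique[OF g(2) D open_open_ivl]])
  then have "(\<integral>\<^sup>+r. ennreal ((cmod (g r))\<^sup>2) \<partial>mu_edge T e) = (\<integral>\<^sup>+r. ennreal ((cmod (D r))\<^sup>2) \<partial>mu_edge T e)"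
    by (intro nn_integral_cong_AE) auto
  with g(1) Dm show "(\<lambda>r. tree_deriv T f (Inner e r)) \<in> L2 (mu_edge T e)"
    unfolding D_eq by (simp add: L2_iff)
qed

lemma H10_L2: "f \<in> H10_mu T \<Longrightarrow> f \<in> L2 (mu T)"
  and tree_deriv_L2: "f \<in> H10_mu T \<Longrightarrow> tree_deriv T f \<in> L2 (mu T)"
  using L2_mu_edges[of f] L2_mu_edges[of "tree_deriv T f"] H10_edge[of f] by auto

section \<open>Continuity and the fundamental theorem along half-lines\<close>

lemma topspace_tree: "topspace (tree_topology T) = points T"
proof -
  have "openin (tree_topology T) (points T)"
    unfolding openin_tree_topology
  proof (intro conjI ballI subset_refl)
    fix e assume "e \<in> edges T"
    then have "{s \<in> closed_ivl T e. edge_point T e s \<in> points T} = closed_ivl T e"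
      using edge_point_points by auto
    then show "openin (top_of_set (closed_ivl T e)) {s \<in> closed_ivl T e. edge_point T e s \<in> points T}" by simp
  qed
  moreover have "topspace (tree_topology T) \<subseteq> points T"
    using openin_topspace[of "tree_topology T"] unfolding openin_tree_topology by blast
  ultimately show ?thesis using openin_subset by blast
qed

lemma continuous_on_edge:
  fixes f :: "('a, 'b) point \<Rightarrow> complex"
  assumes "continuous_map (tree_topology T) euclidean f" "e \<in> edges T"
  shows "continuous_on (closed_ivl T e) (\<lambda>s. f (edge_point T e s))"
  unfolding continuous_openin_preimage_eq
proof (intro allI impI)
  fix U :: "complex set" assume "open U"
  then have "openin (tree_topology T) {x \<in> points T. f x \<in> U}"
    using openin_continuous_map_preimage[OF assms(1)] by (simp add: topspace_tree)
  then have "openin (top_of_set (closed_ivl T e)) {s \<in> closed_ivl T e. edge_point T e s \<in> {x \<in> points T. f x \<in> U}}"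
    using assms(2) by (simp add: openin_tree_topology)
  moreover have "{s \<in> closed_ivl T e. edge_point T e s \<in> {x \<in> points T. f x \<in> U}} =
      closed_ivl T e \<inter> (\<lambda>s. f (edge_point T e s)) -` U"
    using edge_point_points[OF assms(2)] by auto
  ultimately show "openin (top_of_set (closed_ivl T e)) (closed_ivl T e \<inter> (\<lambda>s. f (edge_point T e s)) -` U)"
    by simp
qed

lemma closed_pieces: "{0..} = (\<Union>m\<le>N. closed_piece m)"
proof (intro equalityI subsetI)
  fix s :: real assume "s \<in> {0..}"
  show "s \<in> (\<Union>m\<le>N. closed_piece m)"
  proof (cases "s \<in> level_set")
    case True
    then show ?thesis using t_Suc by (force simp: closed_piece_def less_imp_le)
  next
    case False
    obtain m where m: "m \<le> N" "s \<in> piece m" using piece_cases[OF _ False] \<open>s \<in> {0..}\<close> by auto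
    then have "s \<in> closed_piece m" by (auto simp: piece_def closed_piece_def split: if_splits)
    with m show ?thesis by blast
  qed
next
  fix s assume "s \<in> (\<Union>m\<le>N. closed_piece m)"
  then obtain m where "m \<le> N" "s \<in> closed_piece m" by blast
  then show "s \<in> {0..}" using t_nonneg[of m] by (auto simp: closed_piece_def split: if_splits)
qed

lemma continuous_on_ray:
  fixes f :: "('a, 'b) point \<Rightarrow> complex"
  assumes "continuous_map (tree_topology T) euclidean f" and \<rho>: "\<rho> \<in> rays T"
  shows "continuous_on {0..} (\<lambda>s. f (ray_point \<rho> s))"
  unfolding closed_pieces
proof (rule continuous_on_closed_Union)
  fix m assume "m \<in> {..N}"
  then have m: "m \<le> N" by simp
  show "closed (closed_piece m)" by (simp add: closed_piece_def)
  note l = anc_level[OF \<rho> m]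
  have "continuous_on (closed_piece m) (\<lambda>s. f (edge_point T (anc \<rho> m) (s - t m)))"
    by (rule continuous_on_compose2[OF continuous_on_edge[OF assms(1) level_edges_edges[OF l]]])
      (auto intro!: continuous_intros simp: open_ivl_level(2)[OF l m])
  then show "continuous_on (closed_piece m) (\<lambda>s. f (ray_point \<rho> s))"
    using ray_point_closed[OF \<rho> m] by (simp cong: continuous_on_cong)
qed simp

text \<open>An interval of radii that avoids the levels stays inside one open edge, where
  \<open>weak_deriv_FTC\<close> applies.\<close>

lemma ray_FTC_piece:
  assumes f: "f \<in> H10_mu T" and \<rho>: "\<rho> \<in> rays T" and xy: "0 \<le> x" "x \<le> y" "{x..y} \<inter> level_set = {}"
  shows "f (ray_point \<rho> y) - f (ray_point \<rho> x) = (LINT s:{x..y}|lborel. tree_deriv T f (ray_point \<rho> s))"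
proof -
  have x: "x \<notin> level_set" using xy by auto
  obtain m where m: "m \<le> N" "x \<in> piece m" using piece_cases[OF xy(1) x] by blast
  have sub: "{x..y} \<subseteq> piece m"
  proof
    fix s assume s: "s \<in> {x..y}"
    have "s < t (Suc m)" if "m < N"
    proof (rule ccontr)
      assume "\<not> s < t (Suc m)"
      then have "t (Suc m) \<in> {x..y}" using s m that by (auto simp: piece_def)
      then show False using xy(3) that by auto
    qed
    then show "s \<in> piece m" using s piece_gt[OF m(2)] by (auto simp: piece_def)
  qed
  define e where "e = anc \<rho> m"
  have l: "e \<in> level_edges m" unfolding e_def by (rule anc_level[OF \<rho> m(1)])
  note ed = level_edges_edges[OF l]
  have cont: "continuous_map (tree_topology T) euclidean f" using f by (simp add: H10_mu_def)
  have U: "{x - t m..y - t m} \<subseteq> open_ivl T e"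
    using sub open_ivl_level(1)[OF l m(1)] by auto
  have "continuous_on (open_ivl T e) (\<lambda>r. f (Inner e r))"
  proof -
    have "continuous_on (open_ivl T e) (\<lambda>r. f (edge_point T e r))"
      by (rule continuous_on_subset[OF continuous_on_edge[OF cont ed] open_subset_closed_ivl])
    then show ?thesis using edge_point_inner by (simp cong: continuous_on_cong)
  qed
  from weak_deriv_FTC[OF H10_edge(2)[OF f ed] open_open_ivl this _ U]
  have "f (Inner e (y - t m)) - f (Inner e (x - t m)) = (LINT r:{x - t m..y - t m}|lborel. tree_deriv T f (Inner e r))"
    using xy(2) by simp
  also have "\<dots> = (LINT s|lborel. indicator {x - t m..y - t m} (- t m + 1 * s) *\<^sub>R tree_deriv T f (Inner e (- t m + 1 * s)))"
    unfolding set_lebesgue_integral_def by (subst lborel_integral_real_affine[of 1 _ "- t m"]) auto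
  also have "\<dots> = (LINT s:{x..y}|lborel. tree_deriv T f (ray_point \<rho> s))"
    unfolding set_lebesgue_integral_def
  proof (rule Bochner_Integration.integral_cong)
    show "indicator {x - t m..y - t m} (- t m + 1 * s) *\<^sub>R tree_deriv T f (Inner e (- t m + 1 * s)) =
        indicator {x..y} s *\<^sub>R tree_deriv T f (ray_point \<rho> s)" for s
      using ray_point_inner[OF \<rho> m(1), of s] sub by (cases "s \<in> {x..y}") (auto simp: e_def indicator_def)
  qed simp
  finally have "f (Inner e (y - t m)) - f (Inner e (x - t m)) = (LINT s:{x..y}|lborel. tree_deriv T f (ray_point \<rho> s))" .
  moreover have "y \<in> piece m" using sub xy(2) by auto
  ultimately show ?thesis
    using ray_point_inner[OF \<rho> m] ray_point_inner[OF \<rho> m(1), of y] by (simp add: e_def)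
qed

text \<open>Continuity of f along \<rho>, together with integrability of the derivative up to the
  vertices, glues the formulas for the separate edges.\<close>

lemma ray_FTC:
  assumes f: "f \<in> H10_mu T" and \<rho>: "\<rho> \<in> rays T" and cy: "0 \<le> c" "c \<le> y"
  shows "f (ray_point \<rho> y) - f (ray_point \<rho> c) = (LINT s:{c..y}|lborel. tree_deriv T f (ray_point \<rho> s))"
    and "set_integrable lborel {c..y} (\<lambda>s. tree_deriv T f (ray_point \<rho> s))"
proof -
  have int: "set_integrable lborel {c..d} (\<lambda>s. tree_deriv T f (ray_point \<rho> s))" for d
    using cy(1) by (intro set_integrable_subset[OF L2_nu_set_integrable[OF ray_values_L2[OF tree_deriv_L2[OF f] \<rho>], of d]]) auto
  then show "set_integrable lborel {c..y} (\<lambda>s. tree_deriv T f (ray_point \<rho> s))" .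
  have cont: "continuous_map (tree_topology T) euclidean f" using f by (simp add: H10_mu_def)
  show "f (ray_point \<rho> y) - f (ray_point \<rho> c) = (LINT s:{c..y}|lborel. tree_deriv T f (ray_point \<rho> s))"
  proof (rule FTC_piecewise[OF int])
    show "continuous_on {c..} (\<lambda>s. f (ray_point \<rho> s))"
      using cy(1) by (intro continuous_on_subset[OF continuous_on_ray[OF cont \<rho>]]) auto
    show "finite level_set" by simp
    show "f (ray_point \<rho> y) - f (ray_point \<rho> x) = (LINT s:{x..y}|lborel. tree_deriv T f (ray_point \<rho> s))"
      if "c \<le> x" "x \<le> y" "{x..y} \<inter> level_set = {}" for x y
      using that cy(1) by (intro ray_FTC_piece[OF f \<rho>]) auto
  qed (rule cy(2))
qed

end

context enumerated_tree
begin

text \<open>Haar coefficients are finite linear combinations of values along half-lines, so the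
  fundamental theorem passes to them by linearity and from there back to a weak derivative. Off the
  levels they are the components.\<close>

lemma component_weak_deriv:
  assumes f: "f \<in> H10_mu T" and i: "i \<in> I"
  shows "has_weak_deriv {start i<..} (component i f) (component i (tree_deriv T f))"
proof (rule has_weak_deriv_cong_finite)
  note c0 = start_nonneg[OF i]
  define D where "D \<rho> s = tree_deriv T f (ray_point \<rho> s)" for \<rho> s
  have cont: "continuous_map (tree_topology T) euclidean f" using f by (simp add: H10_mu_def)
  have D: "set_integrable lborel {start i..y} (D \<rho>)" if "\<rho> \<in> rays T" for \<rho> y
    unfolding D_def[abs_def]
    using ray_FTC(2)[OF f that c0, of y] by (cases "start i \<le> y") auto
  have Dh: "set_integrable lborel {start i..y} (\<lambda>s. cnj (haar i \<rho>) * D \<rho> s)" if "\<rho> \<in> rays T" for \<rho> y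
    by (rule set_integrable_mult_right) (use D[OF that] in blast)
  show "has_weak_deriv {start i<..} (\<lambda>s. haar_coeff (ray_values f s) i) (\<lambda>s. haar_coeff (ray_values (tree_deriv T f) s) i)"
  proof (rule FTC_has_weak_deriv)
    show "set_integrable lborel {start i..d} (\<lambda>s. haar_coeff (ray_values (tree_deriv T f) s) i)" for d
      using Dh unfolding haar_coeff_def D_def set_integrable_def scaleR_sum_right
      by (intro Bochner_Integration.integrable_sum) auto
    show "continuous_on {start i..} (\<lambda>s. haar_coeff (ray_values f s) i)"
      unfolding haar_coeff_def using c0
      by (intro continuous_on_sum continuous_on_mult continuous_on_const continuous_on_subset[OF continuous_on_ray[OF cont]]) auto
    show "haar_coeff (ray_values f y) i - haar_coeff (ray_values f (start i)) i = (LINT s:{start i..y}|lborel. haar_coeff (ray_values (tree_deriv T f) s) i)"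
      if y: "start i \<le> y" for y
    proof -
      have "haar_coeff (ray_values f y) i - haar_coeff (ray_values f (start i)) i =
          (\<Sum>\<rho>\<in>rays T. cnj (haar i \<rho>) * (f (ray_point \<rho> y) - f (ray_point \<rho> (start i))))"
        by (simp add: haar_coeff_def sum_subtractf right_diff_distrib)
      also have "\<dots> = (\<Sum>\<rho>\<in>rays T. LINT s:{start i..y}|lborel. cnj (haar i \<rho>) * D \<rho> s)"
        using ray_FTC(1)[OF f _ c0 y] by (simp add: D_def)
      also have "\<dots> = (LINT s:{start i..y}|lborel. \<Sum>\<rho>\<in>rays T. cnj (haar i \<rho>) * D \<rho> s)"
        using Dh unfolding set_lebesgue_integral_def set_integrable_def scaleR_sum_right
        by (intro Bochner_Integration.integral_sum[symmetric])
      finally show ?thesis by (simp add: haar_coeff_def D_def)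
    qed
  qed
  show "finite level_set" by simp
  have "haar_coeff (ray_values g s) i = component i g s" if s: "s \<in> {start i<..} - level_set" for g s
  proof -
    have "0 \<le> s" "s \<notin> level_set" using s c0 by auto
    then obtain m where m: "m \<le> N" "s \<in> piece m" by (rule piece_cases)
    show ?thesis using haar_coeff_eq_component[OF i m] s by simp
  qed
  then show "\<And>s. s \<in> {start i<..} - level_set \<Longrightarrow> haar_coeff (ray_values f s) i = component i f s"
    "\<And>s. s \<in> {start i<..} - level_set \<Longrightarrow> haar_coeff (ray_values (tree_deriv T f) s) i = component i (tree_deriv T f) s"
    by blast+
qed

lemma haar_coeff_start:
  assumes f: "f \<in> H10_mu T" and i: "i \<in> I"
  shows "haar_coeff (ray_values f (start i)) i = 0"
  using i
proof (cases rule: index_cases)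
  case 1
  have "f (ray_point \<rho> 0) = 0" if "\<rho> \<in> rays T" for \<rho>
    using ray_point_level[OF that, of 0] tail_anc_0[OF that] f by (simp add: t_0 H10_mu_def)
  then show ?thesis using 1 by (simp add: haar_coeff_def start_def)
next
  case (2 k v j)
  have "(\<Sum>\<rho>\<in>rays T. haar (Some (k, v, j)) \<rho> * cnj (f (ray_point \<rho> (t k)))) = 0"
    by (rule sum_haar_vanish[OF 2(2-4)]) (simp add: ray_point_level 2(2))
  then have "cnj (\<Sum>\<rho>\<in>rays T. haar (Some (k, v, j)) \<rho> * cnj (f (ray_point \<rho> (t k)))) = 0" by simp
  then show ?thesis using 2(1) by (simp add: haar_coeff_def start_def)
qed

lemma component_H10:
  assumes f: "f \<in> H10_mu T" and i: "i \<in> I"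
  shows "component i f \<in> H10_nu T (start i)"
proof -
  note c0 = start_nonneg[OF i]
  have cont: "continuous_map (tree_topology T) euclidean f" using f by (simp add: H10_mu_def)
  have "component i f \<in> H1 (nu_from T (start i)) {start i<..}"
    using component_L2[OF H10_L2[OF f] i] component_L2[OF tree_deriv_L2[OF f] i] component_weak_deriv[OF f i]
    by (auto simp: H1_def)
  \<comment> \<open>The Haar coefficient serves as the continuous representative; the component is
    compared with it only off the levels.\<close>
  moreover have "continuous_on {start i..} (\<lambda>s. haar_coeff (ray_values f s) i)"
    unfolding haar_coeff_def using c0
    by (intro continuous_on_sum continuous_on_mult continuous_on_const continuous_on_subset[OF continuous_on_ray[OF cont]]) auto
  moreover have "AE s in nu_from T (start i). component i f s = haar_coeff (ray_values f s) i"
    unfolding AE_nu_from[OF c0]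
  proof (rule AE_mp[OF AE_not_level], intro AE_I2 impI)
    fix s assume s: "s \<notin> level_set" "start i \<le> s"
    have "start i < s" using s start_level_set[OF i] by (cases "start i = s") auto
    obtain m where m: "m \<le> N" "s \<in> piece m" using piece_cases[OF order_trans[OF c0 s(2)] s(1)] by blast
    show "component i f s = haar_coeff (ray_values f s) i" using haar_coeff_eq_component[OF i m] \<open>start i < s\<close> by simp
  qed
  ultimately show ?thesis
    using haar_coeff_start[OF f i] unfolding H10_nu_def by blast
qed

text \<open>The weak derivative of a component is again an arbitrary choice. By uniqueness it agrees
  almost everywhere with the component of \<open>tree_deriv T f\<close>, to which Parseval's
  identity refers.\<close>

lemma integral_weak_deriv:
  assumes f: "f \<in> H10_mu T" and i: "i \<in> I"
  shows "(\<integral>s. (cmod (weak_deriv {start i<..} (component i f) s))\<^sup>2 \<partial>nu_from T (start i)) =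
    (\<integral>s. (cmod (component i (tree_deriv T f) s))\<^sup>2 \<partial>nu_from T (start i))"
proof (rule integral_cong_AE)
  note c0 = start_nonneg[OF i]
  note wd = component_weak_deriv[OF f i]
  define W where "W = weak_deriv {start i<..} (component i f)"
  have W: "has_weak_deriv {start i<..} (component i f) W"
    unfolding W_def by (rule has_weak_deriv_weak_deriv[OF wd])
  have "W \<in> borel_measurable (restrict_space borel {start i..})"
  proof (rule measurable_cong_finite)
    show "(\<lambda>s. indicator {start i<..} s *\<^sub>R W s) \<in> borel_measurable (restrict_space borel {start i..})"
      by (rule measurable_restrict_space1[OF locally_integrable_measurable[OF has_weak_derivD(2)[OF W]]]) simp
    show "indicator {start i<..} s *\<^sub>R W s = W s" if "start i \<le> s" "s \<notin> level_set" for s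
      using that start_level_set[OF i] by (cases "start i = s") auto
  qed
  then show "(\<lambda>s. (cmod (weak_deriv {start i<..} (component i f) s))\<^sup>2) \<in> borel_measurable (nu_from T (start i))"
    unfolding W_def[symmetric] measurable_nu_from[OF c0] by measurable
  have "component i (tree_deriv T f) \<in> borel_measurable (nu_from T (start i))"
    using component_L2[OF tree_deriv_L2[OF f] i] by (simp add: L2_def)
  then show "(\<lambda>s. (cmod (component i (tree_deriv T f) s))\<^sup>2) \<in> borel_measurable (nu_from T (start i))"
    by measurable
  have "AE s in lborel. start i \<le> s \<longrightarrow> W s = component i (tree_deriv T f) s"
    using weak_deriv_unique[OF W wd open_greaterThan] AE_not_level
  proof eventually_elim
    case (elim s)
    then show ?case using start_level_set[OF i] by (cases "start i = s") auto
  qed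
  then show "AE s in nu_from T (start i). (cmod (weak_deriv {start i<..} (component i f) s))\<^sup>2 = (cmod (component i (tree_deriv T f) s))\<^sup>2"
    unfolding W_def[symmetric] AE_nu_from[OF c0] by eventually_elim simp
qed

end

theorem proposition4p4:
  fixes T :: "('a, 'b) metric_tree" and N :: nat
    and t :: "nat \<Rightarrow> real" and b :: "nat \<Rightarrow> nat" and E :: "'a \<Rightarrow> nat \<Rightarrow> 'b"
  assumes regular: "regular_tree T N t b"
    and enum: "\<And>k v. k \<le> N \<Longrightarrow> v \<in> generation T t k \<Longrightarrow> bij_betw (E v) {1..b k} (out_edges T v)"
  shows "orthogonal_decomposition (mu T) (summand_index T N t b) (summand T t b E) \<and>
    (\<forall>f\<in>L2 (mu T).
      root_component T f \<in> L2 (nu_from T 0) \<and>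
      (\<forall>k\<le>N. \<forall>v\<in>generation T t k. \<forall>j\<in>{1..b k - 1}.
         mode_component T b E k v j f \<in> L2 (nu_from T (t k))) \<and>
      (\<integral>x. (cmod (f x))\<^sup>2 \<partial>mu T) =
        (\<integral>s. (cmod (root_component T f s))\<^sup>2 \<partial>nu_from T 0) +
        (\<Sum>k\<le>N. \<Sum>v\<in>generation T t k. \<Sum>j=1..b k - 1.
           \<integral>s. (cmod (mode_component T b E k v j f s))\<^sup>2 \<partial>nu_from T (t k))) \<and>
    (\<forall>f\<in>H10_mu T.
      root_component T f \<in> H10_nu T 0 \<and>
      (\<forall>k\<le>N. \<forall>v\<in>generation T t k. \<forall>j\<in>{1..b k - 1}.
         mode_component T b E k v j f \<in> H10_nu T (t k)) \<and>
      (\<integral>x. (cmod (tree_deriv T f x))\<^sup>2 \<partial>mu T) =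
        (\<integral>s. (cmod (weak_deriv {0<..} (root_component T f) s))\<^sup>2 \<partial>nu_from T 0) +
        (\<Sum>k\<le>N. \<Sum>v\<in>generation T t k. \<Sum>j=1..b k - 1.
           \<integral>s. (cmod (weak_deriv {t k<..} (mode_component T b E k v j f) s))\<^sup>2 \<partial>nu_from T (t k)))"
proof -
  interpret enumerated_tree T N t b E
    by unfold_locales (fact regular, fact enum)
  have None: "None \<in> summand_index T N t b"
    by (simp add: summand_index_def)
  have Some: "Some (k, v, j) \<in> summand_index T N t b"
    if "k \<le> N" "v \<in> generation T t k" "j \<in> {1..b k - 1}" for k v j
    using that by (simp add: summand_index_def)
  have comp: "component None f = root_component T f" "component (Some (k, v, j)) f = mode_component T b E k v j f"
    "start None = 0" "start (Some (k, v, j)) = t k" for f k v j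
    by (simp_all add: component_def start_def)
  show ?thesis
  proof (intro conjI ballI allI impI)
    show "orthogonal_decomposition (mu T) (summand_index T N t b) (summand T t b E)"
      by (rule decomposition)
  next
    fix f assume f: "f \<in> L2 (mu T)"
    show "root_component T f \<in> L2 (nu_from T 0)"
      using component_L2[OF f None] by (simp add: comp)
    show "mode_component T b E k v j f \<in> L2 (nu_from T (t k))"
      if "k \<le> N" "v \<in> generation T t k" "j \<in> {1..b k - 1}" for k v j
      using component_L2[OF f Some[OF that]] by (simp add: comp)
    show "(\<integral>x. (cmod (f x))\<^sup>2 \<partial>mu T) =
        (\<integral>s. (cmod (root_component T f s))\<^sup>2 \<partial>nu_from T 0) +
        (\<Sum>k\<le>N. \<Sum>v\<in>generation T t k. \<Sum>j=1..b k - 1.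
           \<integral>s. (cmod (mode_component T b E k v j f s))\<^sup>2 \<partial>nu_from T (t k))"
      unfolding parseval[OF f] sum_index comp ..
  next
    fix f assume f: "f \<in> H10_mu T"
    show "root_component T f \<in> H10_nu T 0"
      using component_H10[OF f None] by (simp add: comp)
    show "mode_component T b E k v j f \<in> H10_nu T (t k)"
      if "k \<le> N" "v \<in> generation T t k" "j \<in> {1..b k - 1}" for k v j
      using component_H10[OF f Some[OF that]] by (simp add: comp)
    have "(\<integral>x. (cmod (tree_deriv T f x))\<^sup>2 \<partial>mu T) =
        (\<Sum>i\<in>summand_index T N t b. \<integral>s. (cmod (weak_deriv {start i<..} (component i f) s))\<^sup>2 \<partial>nu_from T (start i))"
      unfolding parseval[OF tree_deriv_L2[OF f]] by (intro sum.cong refl integral_weak_deriv[OF f, symmetric])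
    then show "(\<integral>x. (cmod (tree_deriv T f x))\<^sup>2 \<partial>mu T) =
        (\<integral>s. (cmod (weak_deriv {0<..} (root_component T f) s))\<^sup>2 \<partial>nu_from T 0) +
        (\<Sum>k\<le>N. \<Sum>v\<in>generation T t k. \<Sum>j=1..b k - 1.
           \<integral>s. (cmod (weak_deriv {t k<..} (mode_component T b E k v j f) s))\<^sup>2 \<partial>nu_from T (t k))"
      unfolding sum_index comp .
  qed
qed

end
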